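(* Let $X$ be a Hausdorff space which is a continuous image of a compact interval space. If $X$ is a CO space, then $X$ is scattered.
   Context: A topological space $X$ is a CO space if every closed subset of $X$ is homeomorphic to some clopen subset of $X$. An interval space is a topological space whose topology is the order topology of some linear ordering of its points. A compact Hausdorff space $X$ is scattered if every nonempty subset of $X$ has an isolated point in its relative topology. *)

theory Defs
  imports "HOL-Analysis.Analysis"
begin

text \<open>
  The relation \<open>r\<close> is a reflexive (non-strict) linear order on \<open>A\<close>, as in
  \<^const>\<open>linear_order_on\<close>. The carrier \<open>A\<close> itself belongs to the subbase, so that the space
  has carrier \<open>A\<close> also when \<open>A\<close> has only one point and the open rays are empty.
\<close>

definition order_topology_on :: "'a set \<Rightarrow> 'a rel \<Rightarrow> 'a topology" where
  "order_topology_on A r = topology_generated_by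
     (insert A ((\<lambda>a. {x \<in> A. (x, a) \<in> r \<and> x \<noteq> a}) ` A \<union> (\<lambda>a. {x \<in> A. (a, x) \<in> r \<and> x \<noteq> a}) ` A))"

lemma topspace_order_topology_on [simp]: "topspace (order_topology_on A r) = A"
  by (auto simp: order_topology_on_def)

lemma order_topology_on_UNIV:
  "order_topology_on UNIV {(x, y). x \<le> y} = (euclidean :: 'a::linorder_topology topology)"
proof -
  have rays: "{x. x \<le> a \<and> x \<noteq> a} = {..<a}" "{x. a \<le> x \<and> x \<noteq> a} = {a<..}" for a :: 'a
    by auto
  let ?S = "range (\<lambda>a::'a. {..<a}) \<union> range (\<lambda>a. {a<..})"
  have "generate_topology ?S U" if "generate_topology_on (insert UNIV ?S) U" for U
    using that
  proof induction
    case Empty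
    show ?case
      using open_empty[where ?'a = 'a] unfolding open_generated_order .
  next
    case (Basis s)
    then show ?case by (auto intro: generate_topology.intros)
  qed (auto intro: generate_topology.intros)
  moreover have "generate_topology_on (insert UNIV ?S) U" if "generate_topology ?S U" for U
    using that by induction (auto intro: generate_topology_on.intros)
  ultimately have "generate_topology_on (insert UNIV ?S) U \<longleftrightarrow> open U" for U
    unfolding open_generated_order by blast
  then show ?thesis
    by (simp add: topology_eq order_topology_on_def openin_topology_generated_by_iff rays
        flip: open_openin)
qed

definition interval_space :: "'a topology \<Rightarrow> bool" where
  "interval_space X \<longleftrightarrow> (\<exists>r. linear_order_on (topspace X) r \<and> X = order_topology_on (topspace X) r)"

definition CO_space :: "'a topology \<Rightarrow> bool" where
  "CO_space X \<longleftrightarrow>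
     (\<forall>C. closedin X C \<longrightarrow>
       (\<exists>U. closedin X U \<and> openin X U \<and> subtopology X C homeomorphic_space subtopology X U))"

definition scattered_space :: "'a topology \<Rightarrow> bool" where
  "scattered_space X \<longleftrightarrow>
     (\<forall>S. S \<subseteq> topspace X \<and> S \<noteq> {} \<longrightarrow> (\<exists>x\<in>S. openin (subtopology X S) {x}))"

end

(*
  Suppose that the kernel of X (its largest dense-in-itself subset) is nonempty. An isolated point
  of the boundary of the kernel gets as its colour the rank at which the scattered part of X
  accumulates there. In place, by passing to a closed subset, the coloured points can be given
  arbitrary new colours, and by the CO property the closed subset has a clopen copy in X. So the
  discrete set G of coloured points carries one colouring g such that every colouring c of G
  is the restriction of g to a clopen copy of the closure of G.

  Call a rule "class" if it selects points of the closure of G by the local behaviour of a colouring.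
  If for every i in an index set some colouring has points of class i and none of any other class
  j in that set, then the clopen copies give a discrete set of points of X of the size of the
  index set. By recursion along a well-order one constructs such families of every cardinality:
  almost disjoint sets of indices produce new classes at a given cardinal from as many
  old ones, and monotone normality and sequences inherited from the linear order amalgamate
  colourings on disjoint parts of G. Taking more indices than X has points gives a contradiction.
*)
theory Submission
  imports Defs
begin

section \<open>Compact ordered spaces\<close>

text \<open>A class must be realised anew inside arbitrarily small parts of \<open>G\<close>, and
  such a part may be poorer than \<open>G\<close> itself. The cure is an ideal of negligible subsets
  of \<open>G\<close> that is proper, invariant under homeomorphisms between closures, and maximal
  with these properties. The sets whose positive points contain no discrete set of a given infinite
  size form another such ideal as soon as \<open>G\<close> has such a discrete set, so by maximality
  every non-negligible part is as rich as \<open>G\<close>. Hence each gain in the size of discrete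
  sets, obtained globally from open copies, can be fed back into every piece.

  Of the linear order only what passes to continuous images is kept: monotone normality, convergent
  sequences in infinite sets, and the fact that a limit of disjoint convex pieces has whole pieces
  close by. The last fact makes what happens inside one piece visible at the limit. The cardinality
  of the support near a point then serves as an extra invariant: it tells apart families that were
  built at different cardinals.\<close>

locale compact_ordered_space =
  fixes K :: "'b topology" and lt :: "'b \<Rightarrow> 'b \<Rightarrow> bool"
  assumes irrefl: "\<not> lt x x"
    and trans: "lt x y \<Longrightarrow> lt y z \<Longrightarrow> lt x z"
    and total: "x \<in> topspace K \<Longrightarrow> y \<in> topspace K \<Longrightarrow> x \<noteq> y \<Longrightarrow> lt x y \<or> lt y x"
    and dom: "lt x y \<Longrightarrow> x \<in> topspace K \<and> y \<in> topspace K"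
    and ray_lower: "openin K {x. lt x a}"
    and ray_upper: "openin K {x. lt a x}"
    and convex_base: "openin K U \<Longrightarrow> k \<in> U \<Longrightarrow>
      \<exists>H. openin K H \<and> k \<in> H \<and> H \<subseteq> U \<and> (\<forall>x y z. x \<in> H \<and> z \<in> H \<and> lt x y \<and> lt y z \<longrightarrow> y \<in> H)"
    and compact: "compact_space K"
begin

text \<open>All axioms are symmetric in the direction of the order, so interpreting the locale for
  the reversed relation supplies the mirror image of each one-sided lemma.\<close>

lemma dual: "compact_ordered_space K (\<lambda>x y. lt y x)"
proof
  show "\<exists>H. openin K H \<and> k \<in> H \<and> H \<subseteq> U \<and> (\<forall>x y z. x \<in> H \<and> z \<in> H \<and> lt y x \<and> lt z y \<longrightarrow> y \<in> H)"
    if "openin K U" "k \<in> U" for U k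
    using convex_base[OF that] by blast
  show "lt z x" if "lt y x" "lt z y" for x y z using that(2,1) by (rule trans)
  show "lt y x \<or> lt x y" if "x \<in> topspace K" "y \<in> topspace K" "x \<noteq> y" for x y
    using total[OF that] by blast
qed (simp_all add: irrefl dom ray_lower ray_upper compact)

lemma finite_min:
  assumes "finite C" "C \<noteq> {}" "C \<subseteq> topspace K"
  shows "\<exists>m\<in>C. \<forall>c\<in>C. \<not> lt c m"
  using assms
proof (induction C rule: finite_ne_induct)
  case (singleton x)
  then show ?case using irrefl by blast
next
  case (insert x F)
  then obtain m where m: "m \<in> F" "\<forall>c\<in>F. \<not> lt c m" by auto
  show ?case
  proof (cases "lt x m")
    case True
    then have "\<forall>c\<in>insert x F. \<not> lt c x" using m irrefl trans by blast
    then show ?thesis by blast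
  next
    case False
    then show ?thesis using m by blast
  qed
qed

text \<open>If \<open>C\<close> had no least point, the open rays above its points would cover it. A
  finite subcover uses finitely many endpoints, and the least of them lies in none of these
  rays.\<close>

lemma closed_min:
  assumes C: "closedin K C" "C \<noteq> {}"
  shows "\<exists>m\<in>C. \<forall>c\<in>C. \<not> lt c m"
proof (rule ccontr)
  assume neg: "\<not> ?thesis"
  have CK: "C \<subseteq> topspace K" using C closedin_subset by blast
  have "compactin K C" using C compact closedin_compact_space by blast
  moreover have "C \<subseteq> \<Union>((\<lambda>c. {x. lt c x}) ` C)" using neg by blast
  moreover have "\<And>U. U \<in> (\<lambda>c. {x. lt c x}) ` C \<Longrightarrow> openin K U" using ray_upper by auto
  ultimately obtain \<F> where F: "finite \<F>" "\<F> \<subseteq> (\<lambda>c. {x. lt c x}) ` C" "C \<subseteq> \<Union>\<F>"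
    unfolding compactin_def by (metis (no_types, lifting))
  then obtain D where D: "finite D" "D \<subseteq> C" "C \<subseteq> \<Union>((\<lambda>c. {x. lt c x}) ` D)"
    by (metis (no_types, lifting) finite_subset_image)
  then have "D \<noteq> {}" using C by auto
  then obtain m where "m \<in> D" "\<forall>c\<in>D. \<not> lt c m" using finite_min D CK by (meson subset_trans)
  then show False using D by blast
qed

section \<open>Monotone normality of a compact linear order\<close>

definition upper_gap :: "'b \<Rightarrow> 'b set \<Rightarrow> 'b set"
  where "upper_gap a U = {b \<in> topspace K - U. lt a b}"

lemma upper_gap_min:
  assumes "openin K U" "a \<in> U" "upper_gap a U \<noteq> {}"
  shows "\<exists>m\<in>upper_gap a U. \<forall>c\<in>upper_gap a U. \<not> lt c m"
proof -
  have aK: "a \<in> topspace K" using assms openin_subset by blast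
  have "upper_gap a U = topspace K - (U \<union> {x. lt x a})"
    using assms aK total irrefl trans dom unfolding upper_gap_def by blast
  then have "closedin K (upper_gap a U)"
    using assms ray_lower by (simp add: closedin_diff openin_Un)
  then show ?thesis using closed_min assms by blast
qed

text \<open>The function \<open>\<mu>\<close> picks a point of each nonempty open interval as the least one in an
  auxiliary well-order, so that overlapping intervals cannot have crossing picks.\<close>

lemma upper_bound_exists:
  fixes \<mu> :: "'b set \<Rightarrow> 'b"
  assumes \<mu>: "\<And>S. S \<noteq> {} \<Longrightarrow> \<mu> S \<in> S"
    and U: "openin K U" "a \<in> U"
  shows "\<exists>B. openin K B \<and> a \<in> B \<and> (\<forall>x\<in>B. lt a x \<longrightarrow> x \<in> U) \<and> (\<forall>b. lt a b \<and> b \<notin> U \<longrightarrow>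
      (\<exists>r. lt a r \<and> \<not> lt b r \<and>
        B = (if {x. lt a x \<and> lt x r} = {} then {x. lt x r} else {x. lt x (\<mu> {x. lt a x \<and> lt x r})})))"
proof (cases "upper_gap a U = {}")
  case True
  then have "\<not> lt a b" if "b \<notin> U" for b using that dom by (auto simp: upper_gap_def)
  moreover have "x \<in> U" if "lt a x" for x using that calculation by blast
  moreover have "a \<in> topspace K" using U openin_subset by blast
  ultimately show ?thesis by (intro exI[of _ "topspace K"]) blast
next
  case False
  then obtain r where r: "r \<in> upper_gap a U" "\<forall>c\<in>upper_gap a U. \<not> lt c r"
    using upper_gap_min U by blast
  let ?I = "{x. lt a x \<and> lt x r}"
  let ?B = "if ?I = {} then {x. lt x r} else {x. lt x (\<mu> ?I)}"
  have ar: "lt a r" using r by (auto simp: upper_gap_def)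
  have "openin K ?B" using ray_lower by simp
  moreover have "a \<in> ?B" using ar \<mu>[of ?I] by auto
  moreover have "x \<in> U" if "x \<in> ?B" "lt a x" for x
  proof -
    have "lt x r"
    proof (cases "?I = {}")
      case True
      then show ?thesis using that(1) unfolding if_P[OF True] by blast
    next
      case False
      then show ?thesis
        using that(1) \<mu>[of ?I] trans[of x "\<mu> ?I" r] unfolding if_not_P[OF False] by blast
    qed
    then show ?thesis using r(2) that dom by (auto simp: upper_gap_def)
  qed
  moreover have "\<not> lt b r" if "lt a b" "b \<notin> U" for b
    using that r(2) dom by (auto simp: upper_gap_def)
  ultimately show ?thesis using ar by (intro exI[of _ ?B]) blast
qed

text \<open>\<open>M a U\<close> is bounded on both sides by picked points. Suppose a < b, neither
  point lies in the open set of the other, and \<open>x\<close> lies in both neighbourhoods. The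
  obstacles satisfy a < x < r \<le> b and a \<le> s < x < b, so \<open>?I\<close> and
  \<open>?J\<close> are nonempty and \<mu> J < x < \<mu> I. Then both picks lie in both intervals,
  and being least there in the same well-order, which is unrelated to \<open>lt\<close>, they
  coincide: a contradiction.\<close>

lemma monotone_normality:
  "\<exists>M. (\<forall>U a. openin K U \<and> a \<in> U \<longrightarrow> openin K (M a U) \<and> a \<in> M a U) \<and>
     (\<forall>U V a b. openin K U \<and> a \<in> U \<and> openin K V \<and> b \<in> V \<and> a \<notin> V \<and> b \<notin> U \<longrightarrow> M a U \<inter> M b V = {})"
proof -
  obtain R :: "'b rel" where R: "well_order_on UNIV R" using well_order_on by blast
  have FR: "Field R = UNIV" using R well_order_on_Field by blast
  interpret R: wo_rel R using R FR by (simp add: wo_rel_def)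
  define \<mu> where "\<mu> S = R.minim S" for S
  have \<mu>1: "\<mu> S \<in> S" if "S \<noteq> {}" for S using R.minim_in[of S] that by (simp add: FR \<mu>_def)
  have \<mu>2: "(\<mu> S, s) \<in> R" if "s \<in> S" for s S using R.minim_least[of S s] that by (simp add: FR \<mu>_def)
  have anti: "x = y" if "(x,y) \<in> R" "(y,x) \<in> R" for x y
    using that R.ANTISYM by (auto simp: antisym_def)
  interpret D: compact_ordered_space K "\<lambda>x y. lt y x" by (rule dual)
  let ?u = "\<lambda>a U B. openin K B \<and> a \<in> B \<and> (\<forall>x\<in>B. lt a x \<longrightarrow> x \<in> U) \<and> (\<forall>b. lt a b \<and> b \<notin> U \<longrightarrow>
      (\<exists>r. lt a r \<and> \<not> lt b r \<and>
        B = (if {x. lt a x \<and> lt x r} = {} then {x. lt x r} else {x. lt x (\<mu> {x. lt a x \<and> lt x r})})))"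
  let ?l = "\<lambda>a U B. openin K B \<and> a \<in> B \<and> (\<forall>x\<in>B. lt x a \<longrightarrow> x \<in> U) \<and> (\<forall>b. lt b a \<and> b \<notin> U \<longrightarrow>
      (\<exists>r. lt r a \<and> \<not> lt r b \<and>
        B = (if {x. lt x a \<and> lt r x} = {} then {x. lt r x} else {x. lt (\<mu> {x. lt x a \<and> lt r x}) x})))"
  define u where "u a U = (SOME B. ?u a U B)" for a U
  define l where "l a U = (SOME B. ?l a U B)" for a U
  have u: "?u a U (u a U)" if "openin K U" "a \<in> U" for a U
    unfolding u_def by (rule someI_ex[of "?u a U"], rule upper_bound_exists) (use that \<mu>1 in auto)
  have l: "?l a U (l a U)" if "openin K U" "a \<in> U" for a U
    unfolding l_def by (rule someI_ex[of "?l a U"], rule D.upper_bound_exists) (use that \<mu>1 in auto)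
  define M where "M a U = u a U \<inter> l a U" for a U
  have main: "u a U \<inter> l b V = {}"
    if U: "openin K U" "a \<in> U" and V: "openin K V" "b \<in> V" and n: "a \<notin> V" "b \<notin> U" and ab: "lt a b" for U V a b
  proof (rule ccontr)
    assume "u a U \<inter> l b V \<noteq> {}"
    then obtain x where xu: "x \<in> u a U" and xl: "x \<in> l b V" by blast
    obtain r where r: "lt a r" "\<not> lt b r" and ur:
      "u a U = (if {x. lt a x \<and> lt x r} = {} then {x. lt x r} else {x. lt x (\<mu> {x. lt a x \<and> lt x r})})"
      using u[OF U] ab n by blast
    obtain s where s: "lt s b" "\<not> lt s a" and ls:
      "l b V = (if {x. lt x b \<and> lt s x} = {} then {x. lt s x} else {x. lt (\<mu> {x. lt x b \<and> lt s x}) x})"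
      using l[OF V] ab n by blast
    let ?I = "{x. lt a x \<and> lt x r}" and ?J = "{x. lt x b \<and> lt s x}"
    have rb: "r = b \<or> lt r b" using r total dom ab by blast
    have as: "a = s \<or> lt a s" using s total dom ab by blast
    have xr: "lt x r"
    proof (cases "?I = {}")
      case True
      then show ?thesis using xu unfolding ur if_P[OF True] by blast
    next
      case False
      then show ?thesis
        using xu \<mu>1[of ?I] trans[of x "\<mu> ?I" r] unfolding ur if_not_P[OF False] by blast
    qed
    have xs: "lt s x"
    proof (cases "?J = {}")
      case True
      then show ?thesis using xl unfolding ls if_P[OF True] by blast
    next
      case False
      then show ?thesis
        using xl \<mu>1[of ?J] trans[of s "\<mu> ?J" x] unfolding ls if_not_P[OF False] by blast
    qed
    have "lt a x" using as xs trans[of a s x] by blast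
    then have xI: "x \<in> ?I" using xr by blast
    have "lt x b" using xr rb trans[of x r b] by blast
    then have xJ: "x \<in> ?J" using xs by blast
    have IJ: "?I \<noteq> {}" "?J \<noteq> {}" using xI xJ by blast+
    have xm: "lt x (\<mu> ?I)" using xu unfolding ur if_not_P[OF IJ(1)] by blast
    have mx: "lt (\<mu> ?J) x" using xl unfolding ls if_not_P[OF IJ(2)] by blast
    have mI: "\<mu> ?I \<in> ?I" using \<mu>1[of ?I] xI by blast
    have mJ: "\<mu> ?J \<in> ?J" using \<mu>1[of ?J] xJ by blast
    have "lt (\<mu> ?I) b" using mI rb trans[of "\<mu> ?I" r b] by blast
    then have "\<mu> ?I \<in> ?J" using trans[OF xs xm] by blast
    moreover have "lt a (\<mu> ?J)" using mJ as trans[of a s "\<mu> ?J"] by blast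
    then have "\<mu> ?J \<in> ?I" using trans[OF mx xr] by blast
    ultimately have "\<mu> ?I = \<mu> ?J" using anti \<mu>2 by metis
    then show False using trans[OF xm] mx irrefl by metis
  qed
  have "M a U \<inter> M b V = {}"
    if U: "openin K U" "a \<in> U" and V: "openin K V" "b \<in> V" and n: "a \<notin> V" "b \<notin> U" for U V a b
  proof -
    have "a \<noteq> b" using U n by blast
    moreover have "a \<in> topspace K" "b \<in> topspace K" using U V openin_subset by blast+
    ultimately consider "lt a b" | "lt b a" using total by blast
    then show ?thesis
    proof cases
      case 1 then show ?thesis using main[OF U V n] by (auto simp: M_def)
    next
      case 2 then show ?thesis using main[OF V U n(2,1)] by (auto simp: M_def)
    qed
  qed
  moreover have "openin K (M a U) \<and> a \<in> M a U" if "openin K U" "a \<in> U" for a U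
    using u[OF that] l[OF that] by (auto simp: M_def)
  ultimately show ?thesis by (intro exI[of _ M]) blast
qed

section \<open>Convergent sequences in a compact linear order\<close>

lemma t1: "t1_space K"
  unfolding t1_space_def
proof clarify
  fix x y assume "x \<in> topspace K" "y \<in> topspace K" "x \<noteq> y"
  then consider "lt x y" | "lt y x" using total by blast
  then show "\<exists>U. openin K U \<and> x \<in> U \<and> y \<notin> U"
    using irrefl ray_lower ray_upper by cases blast+
qed

text \<open>Compactness yields an accumulation point \<open>k\<close>. A convex neighbourhood of
  \<open>k\<close> contains terms of arbitrarily large index, and convexity catches every term
  between two of these, hence a whole tail.\<close>

lemma increasing_convergent:
  assumes inc: "\<And>m n. m < n \<Longrightarrow> lt (y m) (y n)"
  shows "\<exists>k. limitin K y k sequentially"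
proof -
  have inj: "inj y"
    by (rule linorder_injI) (metis inc irrefl)
  have ran: "range y \<subseteq> topspace K" using dom inc by blast
  have "infinite (range y)" using inj by (simp add: range_inj_infinite)
  then have "K derived_set_of (range y) \<noteq> {}"
    using compact compact_space_imp_Bolzano_Weierstrass ran by blast
  then obtain k where k: "k \<in> K derived_set_of (range y)" by blast
  have "limitin K y k sequentially"
    unfolding limitin_sequentially
  proof (intro conjI allI impI)
    show "k \<in> topspace K" using k by (simp add: in_derived_set_of)
    fix U assume "openin K U \<and> k \<in> U"
    then obtain H where H: "openin K H" "k \<in> H" "H \<subseteq> U"
      and conv: "\<And>x y z. x \<in> H \<Longrightarrow> z \<in> H \<Longrightarrow> lt x y \<Longrightarrow> lt y z \<Longrightarrow> y \<in> H"
      using convex_base by meson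
    have "infinite (range y \<inter> H)"
      using k H t1 by (simp add: t1_space_derived_set_of_infinite_openin)
    then have fin: "\<exists>n\<ge>N. y n \<in> H" for N
    proof -
      have "\<not> range y \<inter> H \<subseteq> y ` {..<N}"
        using \<open>infinite (range y \<inter> H)\<close> finite_subset by blast
      then obtain n where "y n \<in> H" "y n \<notin> y ` {..<N}" by blast
      then show ?thesis by (intro exI[of _ n]) (auto simp: not_less[symmetric])
    qed
    then obtain N where "y N \<in> H" by blast
    have "y n \<in> H" if n: "n \<ge> N" for n
    proof -
      obtain m where "m \<ge> Suc n" "y m \<in> H" using fin by blast
      then show ?thesis using conv[of "y N" "y m" "y n"] \<open>y N \<in> H\<close> n inc by (metis Suc_le_lessD le_neq_implies_less)
    qed
    then show "\<exists>N. \<forall>n\<ge>N. y n \<in> U" using H by blast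
  qed
  then show ?thesis by blast
qed

text \<open>Either some nonempty part of \<open>S\<close> has no least element, which gives a
  decreasing sequence, or \<open>S\<close> is well-ordered by \<open>lt\<close>, which gives an
  increasing one. Both kinds converge.\<close>

lemma infinite_imp_convergent:
  assumes S: "infinite S" "S \<subseteq> topspace K"
  shows "\<exists>y :: nat \<Rightarrow> 'b. inj y \<and> range y \<subseteq> S \<and> (\<exists>k. limitin K y k sequentially)"
proof (cases "\<exists>C\<subseteq>S. C \<noteq> {} \<and> (\<forall>m\<in>C. \<exists>c\<in>C. lt c m)")
  case True
  then obtain C c0 where C: "C \<subseteq> S" "c0 \<in> C" "\<And>m. m \<in> C \<Longrightarrow> \<exists>c\<in>C. lt c m" by blast
  then obtain y where y: "\<And>n::nat. y n \<in> C" "\<And>n. lt (y (Suc n)) (y n)"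
    using dependent_nat_choice[of "\<lambda>_ x. x \<in> C" "\<lambda>_ x y. lt y x"] by (metis C)
  interpret D: compact_ordered_space K "\<lambda>x y. lt y x" by (rule dual)
  have dec: "lt (y n) (y m)" if "m < n" for m n
    using that
  proof (induction rule: less_Suc_induct)
    case (2 i j k)
    show ?case by (rule trans[OF 2(4,3)])
  qed (rule y)
  have "inj y" by (rule linorder_injI) (metis dec irrefl)
  then show ?thesis using D.increasing_convergent[of y] dec y C by blast
next
  case False
  have min: "\<exists>m\<in>C. \<forall>c\<in>C. \<not> lt c m" if "C \<subseteq> S" "C \<noteq> {}" for C
    using False[unfolded not_ex, THEN spec, of C] that by simp
  \<comment> \<open>The sequence keeps infinitely many points of \<open>S\<close> above its current
    term: passing to the least point of an infinite set gives up only that point.\<close>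
  have "\<exists>y :: nat \<Rightarrow> 'b. \<forall>n. (y n \<in> S \<and> infinite {s \<in> S. lt (y n) s}) \<and> lt (y n) (y (Suc n))"
  proof (rule dependent_nat_choice)
    have step: "\<exists>m\<in>C. infinite {s \<in> S. lt m s}" if C: "C \<subseteq> S" "infinite C" for C
    proof -
      obtain m where m: "m \<in> C" "\<forall>c\<in>C. \<not> lt c m" using min[of C] C by fastforce
      have "C \<subseteq> insert m {s \<in> S. lt m s}" using m C S total by blast
      then show ?thesis using m C by (meson finite.insertI finite_subset)
    qed
    show "\<exists>x. x \<in> S \<and> infinite {s \<in> S. lt x s}" using step[of S] S by blast
    show "\<exists>z. (z \<in> S \<and> infinite {s \<in> S. lt z s}) \<and> lt x z" if "x \<in> S \<and> infinite {s \<in> S. lt x s}" for x n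
      using step[of "{s \<in> S. lt x s}"] that by blast
  qed
  then obtain y :: "nat \<Rightarrow> 'b" where y: "\<And>n. y n \<in> S" "\<And>n. lt (y n) (y (Suc n))" by blast
  have inc: "lt (y m) (y n)" if "m < n" for m n
    using that
  proof (induction rule: less_Suc_induct)
    case (2 i j k)
    show ?case by (rule trans[OF 2(3,4)])
  qed (rule y)
  have "inj y" by (rule linorder_injI) (metis inc irrefl)
  then show ?thesis using increasing_convergent[of y] inc y by blast
qed

text \<open>Three pairwise disjoint convex sets meeting a convex set \<open>H\<close> but missing a point \<open>k \<in> H\<close>:
  two of them lie on the same side of \<open>k\<close>, and the nearer of these is trapped inside \<open>H\<close>.\<close>

lemma trapped_convex:
  assumes H: "k \<in> H" "\<And>x y z. x \<in> H \<Longrightarrow> z \<in> H \<Longrightarrow> lt x y \<Longrightarrow> lt y z \<Longrightarrow> y \<in> H"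
    and p: "p \<in> J \<inter> H" "q \<in> J' \<inter> H" "lt k p" "lt k q"
    and J: "k \<notin> J" "k \<notin> J'" "J \<inter> J' = {}" "J \<subseteq> topspace K" "J' \<subseteq> topspace K"
    and conv: "\<And>x y z. x \<in> J \<Longrightarrow> z \<in> J \<Longrightarrow> lt x y \<Longrightarrow> lt y z \<Longrightarrow> y \<in> J"
      "\<And>x y z. x \<in> J' \<Longrightarrow> z \<in> J' \<Longrightarrow> lt x y \<Longrightarrow> lt y z \<Longrightarrow> y \<in> J'"
  shows "J \<subseteq> H \<or> J' \<subseteq> H"
proof -
  have *: "A \<subseteq> H" if A: "a \<in> A" "lt k a" "lt a b" "b \<in> H" "b \<notin> A" "k \<notin> A" "A \<subseteq> topspace K"
    and cA: "\<And>x y z. x \<in> A \<Longrightarrow> z \<in> A \<Longrightarrow> lt x y \<Longrightarrow> lt y z \<Longrightarrow> y \<in> A" for a b A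
  proof
    fix x assume x: "x \<in> A"
    have xK: "x \<in> topspace K" using A x by blast
    have "k \<noteq> x" "x \<noteq> b" using x A by blast+
    then have "lt k x \<or> lt x k" "lt x b \<or> lt b x"
      using total[of k x] total[of x b] dom[OF A(2)] dom[OF A(3)] xK by blast+
    moreover have "\<not> lt x k" using cA[OF x A(1)] A by blast
    moreover have "\<not> lt b x" using cA[OF A(1) x A(3)] A by blast
    ultimately show "x \<in> H" using H(2)[OF H(1) A(4)] by blast
  qed
  have "p \<noteq> q" using p(1,2) J(3) by blast
  have pq: "p \<in> J" "p \<in> H" "q \<in> J'" "q \<in> H" "p \<notin> J'" "q \<notin> J"
    using p(1,2) J(3) by blast+
  from \<open>p \<noteq> q\<close> consider "lt p q" | "lt q p" using total[of p q] pq J(4,5) by blast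
  then show ?thesis
  proof cases
    case 1
    show ?thesis using *[OF pq(1) p(3) 1 pq(4,6) J(1,4) conv(1)] by simp
  next
    case 2
    show ?thesis using *[OF pq(3) p(4) 2 pq(2,5) J(2,5) conv(2)] by simp
  qed
qed

text \<open>Since \<open>k\<close> lies in the closure of the union but of no single
  \<open>L a\<close>, deleting the closures of finitely many pieces from a convex neighbourhood of
  \<open>k\<close> still leaves points of the union. So at least three pieces meet it, two of them
  on the same side of \<open>k\<close>, and \<open>trapped_convex\<close> applies.\<close>

lemma disjoint_convex_limit:
  assumes J: "\<And>a. a \<in> A \<Longrightarrow> J a \<subseteq> topspace K" "disjoint_family_on J A"
      "\<And>a x y z. a \<in> A \<Longrightarrow> x \<in> J a \<Longrightarrow> z \<in> J a \<Longrightarrow> lt x y \<Longrightarrow> lt y z \<Longrightarrow> y \<in> J a"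
    and L: "\<And>a. a \<in> A \<Longrightarrow> L a \<subseteq> J a"
    and k: "k \<in> K closure_of (\<Union>a\<in>A. L a)" "\<And>a. a \<in> A \<Longrightarrow> k \<notin> K closure_of (L a) \<and> k \<notin> J a"
    and U: "openin K U" "k \<in> U"
  shows "\<exists>a\<in>A. J a \<subseteq> U"
proof -
  obtain H where H: "openin K H" "k \<in> H" "H \<subseteq> U"
    and conv: "\<And>x y z. x \<in> H \<Longrightarrow> z \<in> H \<Longrightarrow> lt x y \<Longrightarrow> lt y z \<Longrightarrow> y \<in> H"
    using convex_base[OF U] by metis
  have HK: "H \<subseteq> topspace K" using H openin_subset by blast
  have meets: "\<exists>a\<in>A - F. \<exists>p\<in>L a. p \<in> H" if F: "finite F" "F \<subseteq> A" for F
  proof -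
    have "openin K (H - (\<Union>a\<in>F. K closure_of L a))"
      using H F by (intro openin_diff closedin_Union) auto
    moreover have "k \<in> H - (\<Union>a\<in>F. K closure_of L a)" using H k F by blast
    moreover have "\<forall>T. k \<in> T \<and> openin K T \<longrightarrow> (\<exists>p. p \<in> (\<Union>a\<in>A. L a) \<and> p \<in> T)"
      using k(1) unfolding in_closure_of by (rule conjunct2)
    ultimately obtain p where p: "p \<in> (\<Union>a\<in>A. L a)" "p \<in> H - (\<Union>a\<in>F. K closure_of L a)"
      by meson
    then obtain a where a: "a \<in> A" "p \<in> L a" by blast
    then have "p \<in> K closure_of L a"
      using closure_of_subset[OF subset_trans[OF L J(1)], of a] by blast
    then have "a \<notin> F" using p(2) by blast
    then show ?thesis using a p(2) by blast
  qed
  obtain a p where a: "a \<in> A" "p \<in> L a" "p \<in> H" using meets[of "{}"] by auto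
  obtain b q where b: "b \<in> A" "b \<noteq> a" "q \<in> L b" "q \<in> H" using meets[of "{a}"] a by auto
  obtain c s where c: "c \<in> A" "c \<noteq> a" "c \<noteq> b" "s \<in> L c" "s \<in> H" using meets[of "{a,b}"] a b by auto
  have side: "lt k x \<or> lt x k" if "d \<in> A" "x \<in> L d" for d x
  proof -
    have "x \<in> J d" using that L by blast
    moreover have "k \<notin> J d" using k(2) that by blast
    ultimately have "k \<noteq> x" "x \<in> topspace K" using J(1)[OF that(1)] by blast+
    then show ?thesis using total[of k x] HK H(2) by blast
  qed
  have two: "J d \<subseteq> H \<or> J e \<subseteq> H"
    if "d \<in> A" "e \<in> A" "d \<noteq> e" "x \<in> L d" "x \<in> H" "y \<in> L e" "y \<in> H" "lt k x \<and> lt k y \<or> lt x k \<and> lt y k" for d e x y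
  proof -
    have dis: "J d \<inter> J e = {}" using J(2) that(1-3) by (simp add: disjoint_family_on_def)
    have J': "x \<in> J d \<inter> H" "y \<in> J e \<inter> H" using that(1-7) L by blast+
    interpret D: compact_ordered_space K "\<lambda>x y. lt y x" by (rule dual)
    have kJ: "k \<notin> J d" "k \<notin> J e" using k(2) that(1,2) by blast+
    have conv': "y \<in> H" if "x \<in> H" "z \<in> H" "lt y x" "lt z y" for x y z
      using conv[OF that(2,1,4,3)] .
    have J3: "y \<in> J a" if "a \<in> A" "x \<in> J a" "z \<in> J a" "lt y x" "lt z y" for a x y z
      using J(3)[OF that(1,3,2,5,4)] .
    from that(8) show ?thesis
    proof
      assume "lt k x \<and> lt k y"
      then show ?thesis
        using trapped_convex[OF H(2) conv J' _ _ kJ dis J(1)[OF that(1)] J(1)[OF that(2)] J(3)[OF that(1)] J(3)[OF that(2)]]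
        by simp
    next
      assume "lt x k \<and> lt y k"
      then show ?thesis
        using D.trapped_convex[OF H(2) conv' J' _ _ kJ dis J(1)[OF that(1)] J(1)[OF that(2)] J3[OF that(1)] J3[OF that(2)]]
        by simp
    qed
  qed
  show ?thesis
  proof -
    have "J a \<subseteq> H \<or> J b \<subseteq> H \<or> J c \<subseteq> H"
      using two[OF a(1) b(1) b(2)[symmetric] a(2,3) b(3,4)] two[OF a(1) c(1) c(2)[symmetric] a(2,3) c(4,5)]
        two[OF b(1) c(1) c(3)[symmetric] b(3,4) c(4,5)] side[OF a(1,2)] side[OF b(1,3)] side[OF c(1,4)]
      by argo
    then show ?thesis using a(1) b(1) c(1) H(3) by blast
  qed
qed

end

text \<open>Subbasic sets are rays or the whole carrier and hence convex, convexity survives finite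
  intersections, and at a point of a union one member is enough. So induction on the generation of
  an open set yields convex neighbourhoods.\<close>

lemma interval_space_imp_compact_ordered:
  assumes "interval_space K" "compact_space K"
  shows "\<exists>lt. compact_ordered_space K lt"
proof -
  obtain r where lin: "linear_order_on (topspace K) r" and K: "K = order_topology_on (topspace K) r"
    using assms by (auto simp: interval_space_def)
  define A where "A = topspace K"
  define lt where "lt x y \<longleftrightarrow> x \<in> A \<and> y \<in> A \<and> (x, y) \<in> r \<and> x \<noteq> y" for x y
  let ?S = "insert A ((\<lambda>a. {x \<in> A. (x, a) \<in> r \<and> x \<noteq> a}) ` A \<union> (\<lambda>a. {x \<in> A. (a, x) \<in> r \<and> x \<noteq> a}) ` A)"
  have tr: "trans r" and an: "antisym r" and tot: "total_on A r"
    using lin by (auto simp: linear_order_on_def partial_order_on_def preorder_on_def A_def)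
  have op: "openin K U \<longleftrightarrow> generate_topology_on ?S U" for U
    by (subst K) (simp add: order_topology_on_def openin_topology_generated_by_iff A_def)
  have basis: "openin K U" if "U \<in> ?S" for U
    unfolding op using that by (rule generate_topology_on.Basis)
  have lt_trans: "lt x z" if "lt x y" "lt y z" for x y z
  proof -
    have "(x, z) \<in> r" using that transD[OF tr] by (auto simp: lt_def)
    moreover have "x \<noteq> z" using that antisymD[OF an] by (auto simp: lt_def)
    ultimately show ?thesis using that by (simp add: lt_def)
  qed
  have "compact_ordered_space K lt"
  proof
    show "openin K {x. lt x a}" for a
    proof (cases "a \<in> A")
      case True
      then have "{x. lt x a} = {x \<in> A. (x, a) \<in> r \<and> x \<noteq> a}" by (auto simp: lt_def)
      then show ?thesis using basis True by auto
    qed (simp add: lt_def)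
    show "openin K {x. lt a x}" for a
    proof (cases "a \<in> A")
      case True
      then have "{x. lt a x} = {x \<in> A. (a, x) \<in> r \<and> x \<noteq> a}" by (auto simp: lt_def)
      then show ?thesis using basis True by auto
    qed (simp add: lt_def)
    show "lt x z" if "lt x y" "lt y z" for x y z using that by (rule lt_trans)
    fix U k assume "openin K U" "k \<in> U"
    then have "generate_topology_on ?S U" by (simp add: op)
    then show "\<exists>H. openin K H \<and> k \<in> H \<and> H \<subseteq> U \<and> (\<forall>x y z. x \<in> H \<and> z \<in> H \<and> lt x y \<and> lt y z \<longrightarrow> y \<in> H)"
      using \<open>k \<in> U\<close>
    proof (induction U)
      case (Int a b)
      then obtain H H' where H: "openin K H \<and> k \<in> H \<and> H \<subseteq> a \<and> (\<forall>x y z. x \<in> H \<and> z \<in> H \<and> lt x y \<and> lt y z \<longrightarrow> y \<in> H)"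
        and H': "openin K H' \<and> k \<in> H' \<and> H' \<subseteq> b \<and> (\<forall>x y z. x \<in> H' \<and> z \<in> H' \<and> lt x y \<and> lt y z \<longrightarrow> y \<in> H')"
        by blast
      show ?case
      proof (intro exI[of _ "H \<inter> H'"] conjI)
        show "openin K (H \<inter> H')" using H H' openin_Int by blast
        show "\<forall>x y z. x \<in> H \<inter> H' \<and> z \<in> H \<inter> H' \<and> lt x y \<and> lt y z \<longrightarrow> y \<in> H \<inter> H'"
          using H H' by (meson IntD1 IntD2 IntI)
        show "k \<in> H \<inter> H'" using H H' by (meson IntI)
        show "H \<inter> H' \<subseteq> a \<inter> b" using H H' by (meson Int_mono)
      qed
    next
      case (UN C)
      then show ?case by (meson UnionE Union_upper subset_trans)
    next
      case (Basis s)
      have "\<forall>x y z. x \<in> s \<and> z \<in> s \<and> lt x y \<and> lt y z \<longrightarrow> y \<in> s"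
      proof (intro allI impI)
        fix x y z assume "x \<in> s \<and> z \<in> s \<and> lt x y \<and> lt y z"
        then have *: "x \<in> s" "z \<in> s" "lt x y" "lt y z" by simp_all
        have "s = A \<or> s \<in> (\<lambda>a. {x \<in> A. (x, a) \<in> r \<and> x \<noteq> a}) ` A \<or>
            s \<in> (\<lambda>a. {x \<in> A. (a, x) \<in> r \<and> x \<noteq> a}) ` A"
          using Basis(1) by (simp only: insert_iff Un_iff)
        then show "y \<in> s"
        proof (elim disjE imageE)
          assume "s = A"
          then show ?thesis using *(3) by (simp add: lt_def)
        next
          fix a assume s: "s = {x \<in> A. (x, a) \<in> r \<and> x \<noteq> a}" "a \<in> A"
          then have "lt z a" using *(2) by (simp add: lt_def)
          with *(4) have "lt y a" by (rule lt_trans)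
          then show ?thesis using s by (simp add: lt_def)
        next
          fix a assume s: "s = {x \<in> A. (a, x) \<in> r \<and> x \<noteq> a}" "a \<in> A"
          then have "lt a x" using *(1) by (simp add: lt_def eq_commute)
          then have "lt a y" using *(3) by (rule lt_trans)
          then show ?thesis using s by (simp add: lt_def eq_commute)
        qed
      qed
      then show ?case by (intro exI[of _ s] conjI basis[OF Basis(1)] Basis(2) subset_refl)
    qed simp
  qed (use assms tot in \<open>auto simp: lt_def A_def total_on_def\<close>)
  then show ?thesis by blast
qed

section \<open>Images of compact ordered spaces\<close>

definition set_ideal :: "'a set set \<Rightarrow> bool" where
  "set_ideal \<J> \<longleftrightarrow> {} \<in> \<J> \<and> (\<forall>S\<in>\<J>. \<forall>T\<subseteq>S. T \<in> \<J>) \<and> (\<forall>S\<in>\<J>. \<forall>T\<in>\<J>. S \<union> T \<in> \<J>)"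

lemma set_ideal_Union:
  assumes "set_ideal \<J>" "finite \<F>" "\<F> \<subseteq> \<J>"
  shows "\<Union>\<F> \<in> \<J>"
  using assms(2,3,1) by (induction \<F>) (auto simp: set_ideal_def)

text \<open>The operator \<open>M\<close> witnesses monotone normality. The last assumption is inherited from convexity
  in the linear order: limits of the pieces \<open>T' a\<close> outside the neighbourhoods \<open>Q a\<close> see whole pieces.\<close>

locale mn_space =
  fixes X :: "'a topology" and M :: "'a \<Rightarrow> 'a set \<Rightarrow> 'a set"
  assumes compact: "compact_space X" and Hausdorff: "Hausdorff_space X"
    and M_open: "openin X U \<Longrightarrow> x \<in> U \<Longrightarrow> openin X (M x U) \<and> x \<in> M x U \<and> M x U \<subseteq> U"
    and M_disjoint: "openin X U \<Longrightarrow> x \<in> U \<Longrightarrow> openin X V \<Longrightarrow> y \<in> V \<Longrightarrow> x \<notin> V \<Longrightarrow> y \<notin> U \<Longrightarrow> M x U \<inter> M y V = {}"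
    and convergent_sequence: "infinite S \<Longrightarrow> S \<subseteq> topspace X \<Longrightarrow>
      \<exists>y :: nat \<Rightarrow> 'a. inj y \<and> range y \<subseteq> S \<and> (\<exists>k. limitin X y k sequentially)"
    and positive_pieces: "set_ideal \<J> \<Longrightarrow> T \<subseteq> topspace X \<Longrightarrow> A \<subseteq> topspace X \<Longrightarrow>
      (\<And>a. a \<in> A \<Longrightarrow> openin X (Q a) \<and> a \<in> Q a) \<Longrightarrow> disjoint_family_on Q A \<Longrightarrow>
      (\<And>a U. a \<in> A \<Longrightarrow> openin X U \<Longrightarrow> a \<in> U \<Longrightarrow> U \<inter> T \<notin> \<J>) \<Longrightarrow>
      \<exists>T'. (\<forall>a\<in>A. T' a \<subseteq> T \<inter> Q a \<and> T' a \<notin> \<J>) \<and>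
        (\<forall>z P. openin X P \<and> z \<in> P \<and> z \<in> X closure_of (\<Union>a\<in>A. T' a) \<and>
          (\<forall>a\<in>A. z \<notin> X closure_of T' a \<and> z \<notin> Q a) \<longrightarrow> (\<exists>a\<in>A. T' a \<subseteq> P))"

context compact_ordered_space
begin

context
  fixes X :: "'a topology" and f :: "'b \<Rightarrow> 'a"
  assumes HX: "Hausdorff_space X" and f: "continuous_map K X f" and surj: "f ` topspace K = topspace X"
begin

lemma image_compact: "compact_space X"
proof -
  have "compactin X (f ` topspace K)"
    using image_compactin[OF _ f] compact by (simp add: compact_space_def)
  then show ?thesis by (simp add: surj compact_space_def)
qed

lemma image_closed_map: "closed_map K X f"
  using compact HX f continuous_imp_closed_map by blast

lemma preimage_open: "openin X U \<Longrightarrow> openin K {k \<in> topspace K. f k \<in> U}"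
  using f openin_continuous_map_preimage by blast

text \<open>A closed map transports the operator. The neighbourhoods upstairs of all points in the
  fibre of \<open>x\<close> are united to \<open>W x U\<close>, and \<open>M x U\<close> consists of
  the points of \<open>U\<close> whose whole fibre lies in this union. A common point of two such
  sets would have a preimage in two disjoint sets upstairs.\<close>

lemma image_monotone_normality:
  "\<exists>M. (\<forall>U x. openin X U \<and> x \<in> U \<longrightarrow> openin X (M x U) \<and> x \<in> M x U \<and> M x U \<subseteq> U) \<and>
     (\<forall>U V x y. openin X U \<and> x \<in> U \<and> openin X V \<and> y \<in> V \<and> x \<notin> V \<and> y \<notin> U \<longrightarrow> M x U \<inter> M y V = {})"
proof -
  obtain N where N: "\<And>U a. openin K U \<Longrightarrow> a \<in> U \<Longrightarrow> openin K (N a U) \<and> a \<in> N a U"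
    and Nd: "\<And>U V a b. openin K U \<Longrightarrow> a \<in> U \<Longrightarrow> openin K V \<Longrightarrow> b \<in> V \<Longrightarrow> a \<notin> V \<Longrightarrow> b \<notin> U \<Longrightarrow> N a U \<inter> N b V = {}"
    using monotone_normality by (elim exE conjE) blast
  define P where "P U = {k \<in> topspace K. f k \<in> U}" for U
  define W where "W x U = (\<Union>a\<in>{a \<in> topspace K. f a = x}. N a (P U))" for x U
  define M where "M x U = U \<inter> (topspace X - f ` (topspace K - W x U))" for x U
  have W: "openin K (W x U)" "{a \<in> topspace K. f a = x} \<subseteq> W x U" if "openin X U" "x \<in> U" for x U
  proof -
    have "openin K (N a (P U)) \<and> a \<in> N a (P U)" if "a \<in> topspace K" "f a = x" for a
      using N[of "P U" a] preimage_open[of U] that \<open>openin X U\<close> \<open>x \<in> U\<close> by (simp add: P_def)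
    then show "openin K (W x U)" "{a \<in> topspace K. f a = x} \<subseteq> W x U" unfolding W_def by blast+
  qed
  have 1: "openin X (M x U) \<and> x \<in> M x U \<and> M x U \<subseteq> U" if "openin X U" "x \<in> U" for x U
  proof -
    have "closedin X (f ` (topspace K - W x U))"
      using image_closed_map W(1)[OF that] by (simp add: closed_map_def closedin_def Diff_Diff_Int openin_Int)
    then have "openin X (M x U)" unfolding M_def using that by (simp add: openin_Int openin_diff)
    moreover have "x \<in> M x U" using W(2)[OF that] that openin_subset[of X U] by (auto simp: M_def)
    ultimately show ?thesis by (auto simp: M_def)
  qed
  have 2: "M x U \<inter> M y V = {}"
    if U: "openin X U" "x \<in> U" and V: "openin X V" "y \<in> V" and n: "x \<notin> V" "y \<notin> U" for U V x y
  proof (rule ccontr)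
    assume "M x U \<inter> M y V \<noteq> {}"
    then obtain z where z: "z \<in> M x U" "z \<in> M y V" by blast
    then have "z \<in> topspace X" by (simp add: M_def)
    then obtain k where k: "k \<in> topspace K" "f k = z" using surj by (metis imageE)
    then have "k \<in> W x U" "k \<in> W y V" using z by (auto simp: M_def)
    then obtain a b where a: "a \<in> topspace K" "f a = x" "k \<in> N a (P U)"
      and b: "b \<in> topspace K" "f b = y" "k \<in> N b (P V)" by (auto simp: W_def)
    have "N a (P U) \<inter> N b (P V) = {}"
      by (rule Nd) (use a b U V n preimage_open in \<open>auto simp: P_def\<close>)
    then show False using a b by blast
  qed
  show ?thesis by (intro exI[of _ M]) (use 1 2 in blast)
qed

lemma image_convergent_sequence:
  assumes S: "infinite S" "S \<subseteq> topspace X"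
  shows "\<exists>y :: nat \<Rightarrow> 'a. inj y \<and> range y \<subseteq> S \<and> (\<exists>k. limitin X y k sequentially)"
proof -
  define l where "l = inv_into (topspace K) f"
  have l: "l s \<in> topspace K" "f (l s) = s" if "s \<in> S" for s
    using that S surj unfolding l_def by (metis inv_into_into subsetD, metis f_inv_into_f subsetD)
  have inj: "inj_on l S" using l(2) by (metis inj_onI)
  then have "infinite (l ` S)" using S by (simp add: finite_image_iff)
  then obtain y k where y: "inj y" "range y \<subseteq> l ` S" "limitin K y k sequentially"
    using infinite_imp_convergent[of "l ` S"] l(1) by blast
  have ly: "f (y n) \<in> S \<and> l (f (y n)) = y n" for n :: nat using y(2) l(2) by (metis imageE rangeI subsetD)
  have "inj (f \<circ> y)" by (rule injI) (metis comp_apply injD ly y(1))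
  moreover have "range (f \<circ> y) \<subseteq> S" using ly by auto
  moreover have "limitin X (f \<circ> y) (f k) sequentially"
    using continuous_map_limit[OF f y(3)] by (simp add: comp_def)
  ultimately show ?thesis by blast
qed

text \<open>Every \<open>a\<close> lifts to a point of its fibre around which the lift of
  \<open>T\<close> is still outside the ideal. Convex neighbourhoods of these lifts cut the pieces
  out of \<open>T\<close>, so the claim on limits becomes \<open>disjoint_convex_limit\<close>
  upstairs.\<close>

lemma image_positive_pieces:
  assumes J: "set_ideal \<J>" and T: "T \<subseteq> topspace X" and A: "A \<subseteq> topspace X"
    and Q: "\<And>a. a \<in> A \<Longrightarrow> openin X (Q a) \<and> a \<in> Q a" "disjoint_family_on Q A"
    and pos: "\<And>a U. a \<in> A \<Longrightarrow> openin X U \<Longrightarrow> a \<in> U \<Longrightarrow> U \<inter> T \<notin> \<J>"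
  shows "\<exists>T'. (\<forall>a\<in>A. T' a \<subseteq> T \<inter> Q a \<and> T' a \<notin> \<J>) \<and>
        (\<forall>z P. openin X P \<and> z \<in> P \<and> z \<in> X closure_of (\<Union>a\<in>A. T' a) \<and>
          (\<forall>a\<in>A. z \<notin> X closure_of T' a \<and> z \<notin> Q a) \<longrightarrow> (\<exists>a\<in>A. T' a \<subseteq> P))"
proof -
  define l where "l = inv_into (topspace K) f"
  have l: "l s \<in> topspace K" "f (l s) = s" if "s \<in> topspace X" for s
    using that surj unfolding l_def by (metis inv_into_into, metis f_inv_into_f)
  \<comment> \<open>If each point of the fibre had a neighbourhood with trace in the ideal, finitely
    many of these would cover the fibre by compactness. As \<open>f\<close> is closed, they would
    contain the full preimage of a neighbourhood of \<open>a\<close>, whose trace would then lie in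
    the ideal.\<close>
  have lift: "\<exists>k\<in>topspace K. f k = a \<and> (\<forall>H. openin K H \<and> k \<in> H \<longrightarrow> {t \<in> T. l t \<in> H} \<notin> \<J>)" if a: "a \<in> A" for a
  proof (rule ccontr)
    assume neg: "\<not> ?thesis"
    define \<U> where "\<U> = {H. openin K H \<and> {t \<in> T. l t \<in> H} \<in> \<J>}"
    have "closedin K {k \<in> topspace K. f k \<in> {a}}"
      using closedin_Hausdorff_singleton[OF HX] a A by (intro closedin_continuous_map_preimage[OF f]) auto
    then have c1: "compactin K {k \<in> topspace K. f k \<in> {a}}"
      using compact closedin_compact_space by blast
    have c2: "{k \<in> topspace K. f k \<in> {a}} \<subseteq> \<Union>\<U>"
    proof
      fix k assume "k \<in> {k \<in> topspace K. f k \<in> {a}}"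
      then obtain H where "openin K H" "k \<in> H" "{t \<in> T. l t \<in> H} \<in> \<J>" using neg by blast
      then show "k \<in> \<Union>\<U>" unfolding \<U>_def by blast
    qed
    have c3: "openin K U" if "U \<in> \<U>" for U using that by (simp add: \<U>_def)
    have "\<exists>\<F>. finite \<F> \<and> \<F> \<subseteq> \<U> \<and> {k \<in> topspace K. f k \<in> {a}} \<subseteq> \<Union>\<F>"
      by (rule compactinD[OF c1 _ c2]) (rule c3)
    then obtain \<F> where F: "finite \<F>" "\<F> \<subseteq> \<U>" "{k \<in> topspace K. f k \<in> {a}} \<subseteq> \<Union>\<F>"
      by (elim exE conjE)
    let ?O = "topspace X - f ` (topspace K - \<Union>\<F>)"
    have "openin K (\<Union>\<F>)" using F by (auto simp: \<U>_def)
    then have "closedin X (f ` (topspace K - \<Union>\<F>))"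
      using image_closed_map by (simp add: closed_map_def closedin_diff)
    then have "openin X ?O" by (simp add: openin_diff)
    moreover have "a \<in> ?O" using F(3) a A by auto
    ultimately have "?O \<inter> T \<notin> \<J>" by (rule pos[OF a])
    moreover have "?O \<inter> T \<subseteq> \<Union>((\<lambda>H. {t \<in> T. l t \<in> H}) ` \<F>)"
    proof
      fix t assume t: "t \<in> ?O \<inter> T"
      then have "l t \<in> topspace K" "f (l t) = t" using l T by auto
      then have "l t \<in> \<Union>\<F>" using t by (metis DiffD2 DiffI IntD1 imageI)
      then show "t \<in> \<Union>((\<lambda>H. {t \<in> T. l t \<in> H}) ` \<F>)" using t by blast
    qed
    moreover have "\<Union>((\<lambda>H. {t \<in> T. l t \<in> H}) ` \<F>) \<in> \<J>"
      by (rule set_ideal_Union[OF J]) (use F in \<open>auto simp: \<U>_def\<close>)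
    ultimately show False using J by (simp add: set_ideal_def)
  qed
  define P where "P a H \<longleftrightarrow> openin K H \<and> f ` H \<subseteq> Q a \<and> {t \<in> T. l t \<in> H} \<notin> \<J> \<and>
      (\<forall>x y z. x \<in> H \<and> z \<in> H \<and> lt x y \<and> lt y z \<longrightarrow> y \<in> H)" for a H
  have exP: "\<exists>H. P a H" if a: "a \<in> A" for a
  proof -
    obtain k where k: "k \<in> topspace K" "f k = a" "\<And>H. openin K H \<Longrightarrow> k \<in> H \<Longrightarrow> {t \<in> T. l t \<in> H} \<notin> \<J>"
      using lift[OF a] by blast
    have "openin K {k \<in> topspace K. f k \<in> Q a}" "k \<in> {k \<in> topspace K. f k \<in> Q a}"
      using preimage_open[of "Q a"] Q(1)[OF a] k(1,2) by simp_all
    from convex_base[OF this] obtain H where H: "openin K H" "k \<in> H" "H \<subseteq> {k \<in> topspace K. f k \<in> Q a}"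
      "\<forall>x y z. x \<in> H \<and> z \<in> H \<and> lt x y \<and> lt y z \<longrightarrow> y \<in> H"
      by (elim exE conjE)
    have "f ` H \<subseteq> Q a" using H(3) by blast
    then show ?thesis unfolding P_def by (intro exI[of _ H] conjI H(1,4) k(3)[OF H(1,2)])
  qed
  define I where "I a = (SOME H. P a H)" for a
  have I: "P a (I a)" if "a \<in> A" for a unfolding I_def using exP[OF that] by (rule someI_ex)
  define T' where "T' a = {t \<in> T. l t \<in> I a}" for a
  have IQ: "f ` I a \<subseteq> Q a" if "a \<in> A" for a using I[OF that] unfolding P_def by (elim conjE)
  have "openin K (I a)" if "a \<in> A" for a using I[OF that] unfolding P_def by (elim conjE)
  then have IK: "I a \<subseteq> topspace K" if "a \<in> A" for a using that by (intro openin_subset)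
  have conv: "y \<in> I a" if "a \<in> A" "x \<in> I a" "z \<in> I a" "lt x y" "lt y z" for a x y z
  proof -
    have *: "\<forall>x y z. x \<in> I a \<and> z \<in> I a \<and> lt x y \<and> lt y z \<longrightarrow> y \<in> I a"
      using I[OF that(1)] unfolding P_def by (elim conjE)
    show ?thesis using *[THEN spec[of _ x], THEN spec[of _ y], THEN spec[of _ z]] that by simp
  qed
  have T'1: "T' a \<subseteq> T \<inter> Q a" if a: "a \<in> A" for a
  proof
    fix t assume "t \<in> T' a"
    then have t: "t \<in> T" "l t \<in> I a" by (simp_all add: T'_def)
    then have "f (l t) \<in> Q a" using IQ[OF a] by blast
    then show "t \<in> T \<inter> Q a" using t T l(2)[of t] by auto
  qed
  have T'2: "T' a \<notin> \<J>" if "a \<in> A" for a using I[OF that] unfolding T'_def P_def by (elim conjE)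
  have fl: "f ` l ` S = S" if "S \<subseteq> topspace X" for S
    using that l(2) by force
  have T'X: "T' a \<subseteq> topspace X" for a using T by (auto simp: T'_def)
  \<comment> \<open>Continuity gives one inclusion and closedness of \<open>f\<close> the other;
    thus a limit point downstairs has a lift that is a limit point of the lifted set.\<close>
  have cl: "X closure_of S = f ` (K closure_of (l ` S))" if "S \<subseteq> topspace X" for S
  proof -
    have "l ` S \<subseteq> topspace K" using that l(1) by blast
    then show ?thesis
      using closed_map_closure_of_image[of K X f] image_closed_map f fl[OF that]
        continuous_map_image_closure_subset[OF f, of "l ` S"]
      by (metis subset_antisym)
  qed
  have lim: "\<exists>a\<in>A. T' a \<subseteq> P"
    if P: "openin X P" "z \<in> P" and z: "z \<in> X closure_of (\<Union>a\<in>A. T' a)"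
      and nz: "\<And>a. a \<in> A \<Longrightarrow> z \<notin> X closure_of T' a \<and> z \<notin> Q a" for z P
  proof -
    have "(\<Union>a\<in>A. T' a) \<subseteq> topspace X" using T'X by blast
    then obtain k where k: "k \<in> K closure_of (l ` (\<Union>a\<in>A. T' a))" "f k = z" using z cl by auto
    have kK: "k \<in> topspace K" using k(1) closure_of_subset_topspace[of K] by blast
    have dis: "disjoint_family_on I A"
      unfolding disjoint_family_on_def
    proof (intro ballI impI)
      fix a b assume ab: "a \<in> A" "b \<in> A" "a \<noteq> b"
      then have "Q a \<inter> Q b = {}" using Q(2) by (simp add: disjoint_family_on_def)
      then show "I a \<inter> I b = {}" using IQ[OF ab(1)] IQ[OF ab(2)] by blast
    qed
    have kn: "k \<notin> K closure_of (l ` T' a) \<and> k \<notin> I a" if "a \<in> A" for a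
      using nz[OF that] cl[OF T'X, of a] k(2) IQ[OF that] by blast
    have LI: "l ` T' a \<subseteq> I a" for a by (auto simp: T'_def)
    have "\<exists>a\<in>A. I a \<subseteq> {k \<in> topspace K. f k \<in> P}"
    proof (rule disjoint_convex_limit[of A I "\<lambda>a. l ` T' a" k])
      show "y \<in> I a" if "a \<in> A" "x \<in> I a" "z \<in> I a" "lt x y" "lt y z" for a x y z
        using that by (rule conv)
      show "k \<in> K closure_of (\<Union>a\<in>A. l ` T' a)" using k(1) by (simp add: image_UN)
      show "k \<notin> K closure_of (l ` T' a) \<and> k \<notin> I a" if "a \<in> A" for a using that by (rule kn)
      show "k \<in> {k \<in> topspace K. f k \<in> P}" using kK k(2) P(2) by simp
    qed (rule IK dis LI preimage_open[OF P(1)], assumption?)+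
    then obtain a where a: "a \<in> A" "I a \<subseteq> {k \<in> topspace K. f k \<in> P}" by (elim bexE)
    have "T' a \<subseteq> P"
    proof
      fix t assume "t \<in> T' a"
      then have t: "t \<in> T" "l t \<in> I a" by (simp_all add: T'_def)
      then have "f (l t) \<in> P" "t \<in> topspace X" using a(2) T by blast+
      then show "t \<in> P" using l(2) by simp
    qed
    then show ?thesis using a(1) by blast
  qed
  show ?thesis
  proof (intro exI[of _ T'] conjI ballI allI impI T'1 T'2)
    fix z P assume *: "openin X P \<and> z \<in> P \<and> z \<in> X closure_of (\<Union>a\<in>A. T' a) \<and>
          (\<forall>a\<in>A. z \<notin> X closure_of T' a \<and> z \<notin> Q a)"
    then have nz: "z \<notin> X closure_of T' a \<and> z \<notin> Q a" if "a \<in> A" for a using that by simp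
    from * show "\<exists>a\<in>A. T' a \<subseteq> P" by (intro lim[of P z] nz) simp_all
  qed
qed

lemma image_mn_space: "\<exists>M. mn_space X M"
proof -
  obtain M where M: "\<forall>U x. openin X U \<and> x \<in> U \<longrightarrow> openin X (M x U) \<and> x \<in> M x U \<and> M x U \<subseteq> U"
    "\<forall>U V x y. openin X U \<and> x \<in> U \<and> openin X V \<and> y \<in> V \<and> x \<notin> V \<and> y \<notin> U \<longrightarrow> M x U \<inter> M y V = {}"
    using image_monotone_normality by (elim exE conjE)
  have "mn_space X M"
    by unfold_locales
      (use M image_compact HX image_convergent_sequence image_positive_pieces in \<open>simp_all\<close>)
  then show ?thesis by (intro exI[of _ M])
qed

end
end

section \<open>Colours of boundary points of the kernel\<close>

definition perfect_kernel :: "'a topology \<Rightarrow> 'a set" where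
  "perfect_kernel T = \<Union>{A. A \<subseteq> T derived_set_of A}"

primrec iter_derived :: "'a topology \<Rightarrow> nat \<Rightarrow> 'a set" where
  "iter_derived T 0 = topspace T"
| "iter_derived T (Suc n) = T derived_set_of (iter_derived T n)"

definition kernel_boundary :: "'a topology \<Rightarrow> 'a set" where
  "kernel_boundary T = perfect_kernel T \<inter> T closure_of (topspace T - perfect_kernel T)"

text \<open>The colour is the rank, within the scattered part, at which the scattered part accumulates. The
  sequence in the kernel is what makes a point recolourable.\<close>

definition coloured :: "nat \<Rightarrow> 'a topology \<Rightarrow> 'a set" where
  "coloured n T = {x \<in> kernel_boundary T. x \<notin> T derived_set_of kernel_boundary T \<and>
     x \<in> T closure_of (iter_derived T n - perfect_kernel T) \<and>
     x \<notin> T closure_of (iter_derived T (Suc n) - perfect_kernel T) \<and>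
     (\<exists>y :: nat \<Rightarrow> 'a. range y \<subseteq> perfect_kernel T - {x} \<and> limitin T y x sequentially)}"

section \<open>Kernel, derivatives and colours under open subspaces and homeomorphisms\<close>

lemma perfect_kernel_subset: "perfect_kernel T \<subseteq> topspace T"
  using derived_set_of_subset_topspace by (fastforce simp: perfect_kernel_def)

lemma perfect_kernel_maximal: "A \<subseteq> T derived_set_of A \<Longrightarrow> A \<subseteq> perfect_kernel T"
  by (auto simp: perfect_kernel_def)

lemma perfect_kernel_dense_in_itself: "perfect_kernel T \<subseteq> T derived_set_of perfect_kernel T"
proof
  fix x assume "x \<in> perfect_kernel T"
  then obtain A where "x \<in> A" "A \<subseteq> T derived_set_of A" by (auto simp: perfect_kernel_def)
  then show "x \<in> T derived_set_of perfect_kernel T"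
    using derived_set_of_mono[OF perfect_kernel_maximal] by blast
qed

lemma perfect_kernel_subset_iter_derived: "perfect_kernel T \<subseteq> iter_derived T n"
proof (induction n)
  case (Suc n)
  then show ?case using perfect_kernel_dense_in_itself derived_set_of_mono by (metis iter_derived.simps(2) subset_trans)
qed (simp add: perfect_kernel_subset)

lemma iter_derived_subset: "iter_derived T n \<subseteq> topspace T"
  by (cases n) (auto simp: derived_set_of_subset_topspace)

lemma closedin_perfect_kernel:
  assumes "t1_space T"
  shows "closedin T (perfect_kernel T)"
proof -
  let ?A = "T closure_of perfect_kernel T"
  have "?A \<subseteq> T derived_set_of perfect_kernel T"
    using perfect_kernel_dense_in_itself[of T] by (auto simp: closure_of)
  also have "\<dots> \<subseteq> T derived_set_of ?A"
    using perfect_kernel_subset by (intro derived_set_of_mono closure_of_subset)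
  finally have "?A \<subseteq> perfect_kernel T" by (rule perfect_kernel_maximal)
  then show ?thesis
    using closure_of_subset[OF perfect_kernel_subset] by (metis closedin_closure_of subset_antisym)
qed

lemma iter_derived_antimono:
  assumes "t1_space T" "m \<le> n"
  shows "iter_derived T n \<subseteq> iter_derived T m"
proof -
  have *: "iter_derived T (Suc n) \<subseteq> iter_derived T n" for n
  proof (induction n)
    case (Suc n)
    then show ?case by (simp add: derived_set_of_mono)
  qed (simp add: derived_set_of_subset_topspace)
  show ?thesis using assms(2) by (induction rule: dec_induct) (use * in blast)+
qed

text \<open>For m < n the derivative of order \<open>n\<close> is contained in that of order
  \<open>Suc m\<close>, so accumulation at rank \<open>n\<close> contradicts the upper bound on the
  rank that is part of colour \<open>m\<close>.\<close>

lemma coloured_disjoint: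
  assumes "t1_space T" "m \<noteq> n"
  shows "coloured m T \<inter> coloured n T = {}"
proof -
  have *: "coloured m T \<inter> coloured n T = {}" if "m < n" for m n
  proof -
    have "iter_derived T n - perfect_kernel T \<subseteq> iter_derived T (Suc m) - perfect_kernel T"
      using iter_derived_antimono[OF assms(1), of "Suc m" n] that by auto
    then show ?thesis using closure_of_mono by (fastforce simp: coloured_def)
  qed
  show ?thesis using *[of m n] *[of n m] assms(2) by (metis Int_commute linorder_neqE_nat)
qed

lemma openin_subtopology_derived:
  "openin T U \<Longrightarrow> (subtopology T U) derived_set_of (U \<inter> S) = U \<inter> T derived_set_of S"
  using openin_Int_derived_set_of_eq[of T U S] by (simp add: derived_set_of_subtopology)

lemma openin_subtopology_closure:
  "openin T U \<Longrightarrow> (subtopology T U) closure_of (U \<inter> S) = U \<inter> T closure_of S"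
  using openin_Int_closure_of_eq[of T U S] by (simp add: closure_of_subtopology)

lemma perfect_kernel_open_subtopology:
  assumes U: "openin T U"
  shows "perfect_kernel (subtopology T U) = U \<inter> perfect_kernel T"
proof
  have "A \<subseteq> U \<inter> T derived_set_of A" if "A \<subseteq> subtopology T U derived_set_of A" for A
    using that derived_set_of_subset_subtopology[of T U A] derived_set_of_subtopology[of T U A]
      derived_set_of_mono[of "U \<inter> A" A T] by auto
  then show "perfect_kernel (subtopology T U) \<subseteq> U \<inter> perfect_kernel T"
    unfolding perfect_kernel_def by blast
  have "U \<inter> perfect_kernel T \<subseteq> subtopology T U derived_set_of (U \<inter> perfect_kernel T)"
    using perfect_kernel_dense_in_itself[of T] by (auto simp: openin_subtopology_derived[OF U])
  then show "U \<inter> perfect_kernel T \<subseteq> perfect_kernel (subtopology T U)" by (rule perfect_kernel_maximal)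
qed

lemma iter_derived_open_subtopology:
  assumes U: "openin T U"
  shows "iter_derived (subtopology T U) n = U \<inter> iter_derived T n"
proof (induction n)
  case 0
  then show ?case by auto
next
  case (Suc n)
  then show ?case by (simp add: openin_subtopology_derived[OF U])
qed

lemma kernel_boundary_open_subtopology:
  assumes U: "openin T U"
  shows "kernel_boundary (subtopology T U) = U \<inter> kernel_boundary T"
proof -
  have "topspace (subtopology T U) - U \<inter> perfect_kernel T = U \<inter> (topspace T - perfect_kernel T)" by auto
  then show ?thesis
    by (auto simp: kernel_boundary_def perfect_kernel_open_subtopology[OF U] openin_subtopology_closure[OF U])
qed

text \<open>Every ingredient of a colour is local; in particular a sequence converging to a point of
  \<open>U\<close> may be replaced by a tail lying in \<open>U\<close>. Thus the colours computed
  inside an open copy are the colours of \<open>T\<close> itself.\<close>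

lemma coloured_open_subtopology:
  assumes U: "openin T U"
  shows "coloured n (subtopology T U) = U \<inter> coloured n T"
proof -
  have D: "U \<inter> A - U \<inter> B = U \<inter> (A - B)" for A B :: "'a set" by auto
  have seq: "(\<exists>y :: nat \<Rightarrow> 'a. range y \<subseteq> U \<inter> perfect_kernel T - {x} \<and> limitin (subtopology T U) y x sequentially) \<longleftrightarrow>
      (\<exists>y :: nat \<Rightarrow> 'a. range y \<subseteq> perfect_kernel T - {x} \<and> limitin T y x sequentially)" (is "?l = ?r") if x: "x \<in> U" for x
  proof
    assume ?l
    then show ?r by (auto simp: limitin_subtopology)
  next
    assume ?r
    then obtain y :: "nat \<Rightarrow> 'a" where y: "range y \<subseteq> perfect_kernel T - {x}" "limitin T y x sequentially" by blast
    have "\<exists>N. \<forall>n\<ge>N. y n \<in> U" using y(2) x U by (simp add: limitin_sequentially)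
    then obtain N where N: "\<And>n. N \<le> n \<Longrightarrow> y n \<in> U" by blast
    have "limitin T (\<lambda>i. y (i + N)) x sequentially" using y(2) by (rule limitin_sequentially_offset)
    then have "limitin (subtopology T U) (\<lambda>i. y (i + N)) x sequentially"
      using N x by (simp add: limitin_subtopology)
    moreover have "range (\<lambda>i. y (i + N)) \<subseteq> U \<inter> perfect_kernel T - {x}" using y(1) N by auto
    ultimately show ?l by blast
  qed
  show ?thesis
    unfolding coloured_def kernel_boundary_open_subtopology[OF U] perfect_kernel_open_subtopology[OF U]
      iter_derived_open_subtopology[OF U] D openin_subtopology_derived[OF U] openin_subtopology_closure[OF U]
    using seq by blast
qed

lemma homeomorphic_map_perfect_kernel:
  assumes h: "homeomorphic_map T T' h"
  shows "perfect_kernel T' = h ` perfect_kernel T"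
proof -
  have *: "h ` perfect_kernel T \<subseteq> perfect_kernel T'"
    if h: "homeomorphic_map T T' h" for T :: "'c topology" and T' :: "'d topology" and h
  proof (rule perfect_kernel_maximal)
    show "h ` perfect_kernel T \<subseteq> T' derived_set_of h ` perfect_kernel T"
      unfolding homeomorphic_map_derived_set_of[OF h perfect_kernel_subset]
      using perfect_kernel_dense_in_itself by (rule image_mono)
  qed
  obtain k where hk: "homeomorphic_maps T T' h k" using h by (auto simp: homeomorphic_map_maps)
  then have k: "homeomorphic_map T' T k" "\<And>y. y \<in> topspace T' \<Longrightarrow> h (k y) = y"
    by (auto simp: homeomorphic_maps_map homeomorphic_maps_sym)
  have "perfect_kernel T' \<subseteq> h ` perfect_kernel T"
  proof
    fix y assume "y \<in> perfect_kernel T'"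
    then have "k y \<in> perfect_kernel T" "y = h (k y)"
      using *[OF k(1)] k(2)[of y] perfect_kernel_subset[of T'] by auto
    then show "y \<in> h ` perfect_kernel T" by (rule rev_image_eqI)
  qed
  then show ?thesis using *[OF h] by blast
qed

lemma homeomorphic_map_iter_derived:
  assumes h: "homeomorphic_map T T' h"
  shows "iter_derived T' n = h ` iter_derived T n"
proof (induction n)
  case 0
  then show ?case using homeomorphic_imp_surjective_map[OF h] by simp
next
  case (Suc n)
  then show ?case by (simp add: homeomorphic_map_derived_set_of[OF h iter_derived_subset])
qed

lemma homeomorphic_map_kernel_boundary:
  assumes h: "homeomorphic_map T T' h"
  shows "kernel_boundary T' = h ` kernel_boundary T"
proof -
  have inj: "inj_on h (topspace T)" using h homeomorphic_imp_injective_map by blast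
  have "topspace T' - perfect_kernel T' = h ` (topspace T - perfect_kernel T)"
    using homeomorphic_imp_surjective_map[OF h] homeomorphic_map_perfect_kernel[OF h]
      inj_on_image_set_diff[OF inj, of "topspace T" "perfect_kernel T"] perfect_kernel_subset[of T] by auto
  then show ?thesis
    unfolding kernel_boundary_def homeomorphic_map_perfect_kernel[OF h]
    using inj_on_image_Int[OF inj perfect_kernel_subset closure_of_subset_topspace]
    by (simp add: homeomorphic_map_closure_of[OF h] flip: homeomorphic_map_perfect_kernel[OF h])
qed

lemma homeomorphic_map_coloured:
  assumes h: "homeomorphic_map T T' h"
  shows "coloured n T' = h ` coloured n T"
proof -
  have *: "h ` coloured n T \<subseteq> coloured n T'"
    if h: "homeomorphic_map T T' h" for T :: "'c topology" and T' :: "'d topology" and h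
  proof
    fix z assume "z \<in> h ` coloured n T"
    then obtain x where x: "x \<in> coloured n T" "z = h x" by blast
    have inj: "inj_on h (topspace T)" using h homeomorphic_imp_injective_map by blast
    have mem: "h x \<in> h ` A \<longleftrightarrow> x \<in> A" if "A \<subseteq> topspace T" for A
      using x(1) that perfect_kernel_subset[of T] inj_on_image_mem_iff[OF inj, of x A]
      by (auto simp: coloured_def kernel_boundary_def)
    have B: "kernel_boundary T \<subseteq> topspace T" using perfect_kernel_subset[of T] by (auto simp: kernel_boundary_def)
    have I: "iter_derived T' m - perfect_kernel T' = h ` (iter_derived T m - perfect_kernel T)" for m
      unfolding homeomorphic_map_perfect_kernel[OF h] homeomorphic_map_iter_derived[OF h]
      using inj_on_image_set_diff[OF inj, of "iter_derived T m" "perfect_kernel T"]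
        iter_derived_subset[of T m] perfect_kernel_subset[of T] by auto
    have S: "iter_derived T m - perfect_kernel T \<subseteq> topspace T" for m using iter_derived_subset[of T m] by blast
    obtain y :: "nat \<Rightarrow> 'c" where y: "range y \<subseteq> perfect_kernel T - {x}" "limitin T y x sequentially"
      using x(1) by (auto simp: coloured_def)
    have "limitin T' (h \<circ> y) (h x) sequentially"
      using continuous_map_limit[OF homeomorphic_imp_continuous_map[OF h] y(2)] .
    moreover have "range (h \<circ> y) \<subseteq> perfect_kernel T' - {h x}"
    proof -
      have "h (y m) \<in> h ` perfect_kernel T \<and> h (y m) \<noteq> h x" for m
        using y(1) mem[of "{y m}"] perfect_kernel_subset[of T] by fastforce
      then show ?thesis by (auto simp: homeomorphic_map_perfect_kernel[OF h])
    qed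
    moreover have "h x \<in> kernel_boundary T'" "h x \<notin> T' derived_set_of kernel_boundary T'"
      "h x \<in> T' closure_of (iter_derived T' n - perfect_kernel T')"
      "h x \<notin> T' closure_of (iter_derived T' (Suc n) - perfect_kernel T')"
      unfolding homeomorphic_map_kernel_boundary[OF h] I homeomorphic_map_derived_set_of[OF h B]
        homeomorphic_map_closure_of[OF h S]
      using x(1) mem[OF derived_set_of_subset_topspace] mem[OF closure_of_subset_topspace]
      by (auto simp: coloured_def simp del: iter_derived.simps)
    ultimately show "z \<in> coloured n T'" unfolding x(2) coloured_def by blast
  qed
  obtain k where hk: "homeomorphic_maps T T' h k" using h by (auto simp: homeomorphic_map_maps)
  then have k: "homeomorphic_map T' T k" "\<And>y. y \<in> topspace T' \<Longrightarrow> h (k y) = y"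
    by (auto simp: homeomorphic_maps_map homeomorphic_maps_sym)
  have "coloured n T' \<subseteq> h ` coloured n T"
  proof
    fix y assume "y \<in> coloured n T'"
    then have "k y \<in> coloured n T" "y = h (k y)"
      using *[OF k(1)] k(2)[of y] perfect_kernel_subset[of T'] by (auto simp: coloured_def kernel_boundary_def)
    then show "y \<in> h ` coloured n T" by (rule rev_image_eqI)
  qed
  then show ?thesis using *[OF h] by blast
qed

context mn_space
begin

section \<open>Consequences of monotone normality\<close>

lemma t1: "t1_space X"
  using Hausdorff Hausdorff_imp_t1_space by blast

lemma regular:
  assumes "openin X U" "x \<in> U"
  obtains V where "openin X V" "x \<in> V" "X closure_of V \<subseteq> U"
proof -
  have "regular_space X" using compact Hausdorff compact_Hausdorff_imp_regular_space by blast
  moreover have "closedin X (topspace X - U)" "x \<in> topspace X - (topspace X - U)"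
    using assms openin_subset by (auto simp: openin_closedin_eq)
  ultimately obtain V where "openin X V" "x \<in> V" "disjnt (topspace X - U) (X closure_of V)"
    unfolding regular_space by meson
  then show ?thesis
    using that[of V] closure_of_subset_topspace[of X V] by (auto simp: disjnt_def)
qed

lemma Hausdorff_nbhds:
  assumes "x \<in> topspace X" "y \<in> topspace X" "x \<noteq> y"
  obtains A B where "openin X A" "openin X B" "x \<in> A" "y \<in> B" "A \<inter> B = {}"
  using assms Hausdorff unfolding Hausdorff_space_def disjnt_def by meson

lemma infinite_imp_limit_point:
  assumes "infinite S" "S \<subseteq> topspace X"
  obtains z where "z \<in> topspace X" "\<And>U. openin X U \<Longrightarrow> z \<in> U \<Longrightarrow> infinite (S \<inter> U)"
proof -
  have "X derived_set_of S \<noteq> {}" using compact_space_imp_Bolzano_Weierstrass compact assms by blast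
  then show ?thesis using that t1 by (auto simp: t1_space_derived_set_of_infinite_openin)
qed

text \<open>\<open>U x\<close> isolates \<open>x\<close> within \<open>D\<close>, so of two distinct
  points neither lies in the open set of the other. Applying \<open>M\<close> once makes all these
  neighbourhoods disjoint simultaneously, whatever the size of \<open>D\<close>.\<close>

lemma separate:
  assumes "\<And>x. x \<in> D \<Longrightarrow> openin X (U x) \<and> x \<in> U x \<and> D \<inter> U x \<subseteq> {x}"
  obtains W where "\<And>x. x \<in> D \<Longrightarrow> openin X (W x) \<and> x \<in> W x \<and> W x \<subseteq> U x" "disjoint_family_on W D"
proof
  show "openin X (M x (U x)) \<and> x \<in> M x (U x) \<and> M x (U x) \<subseteq> U x" if "x \<in> D" for x
    using assms[OF that] M_open by blast
  show "disjoint_family_on (\<lambda>x. M x (U x)) D"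
    unfolding disjoint_family_on_def
  proof (intro ballI impI)
    fix x y assume "x \<in> D" "y \<in> D" "x \<noteq> y"
    then show "M x (U x) \<inter> M y (U y) = {}"
      using assms[of x] assms[of y] by (intro M_disjoint) auto
  qed
qed

text \<open>Apply the operator around \<open>z\<close> too: \<open>M z P\<close> meets some piece,
  hence some \<open>M x (W x)\<close>. As \<open>z\<close> is not in \<open>W x\<close>, this is
  possible only if \<open>x\<close> lies in \<open>P\<close>. So outside the sets \<open>W x\<close>
  the centres of the pieces accumulate wherever the pieces do.\<close>

lemma limit_of_pieces:
  assumes W: "\<And>x. x \<in> D \<Longrightarrow> openin X (W x) \<and> x \<in> W x"
    and F: "\<And>x. x \<in> D \<Longrightarrow> F x \<subseteq> M x (W x)"
    and z: "z \<in> X closure_of (\<Union>x\<in>D. F x)" "\<And>x. x \<in> D \<Longrightarrow> z \<notin> W x"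
    and P: "openin X P" "z \<in> P"
  shows "\<exists>x\<in>D. x \<in> P"
proof -
  obtain w where w: "w \<in> (\<Union>x\<in>D. F x)" "w \<in> M z P"
    using z(1) M_open[OF P] unfolding in_closure_of by meson
  then obtain x where x: "x \<in> D" "w \<in> M x (W x)" using F by blast
  have "x \<in> P"
  proof (rule ccontr)
    assume "x \<notin> P"
    then have "M x (W x) \<inter> M z P = {}" using W[OF x(1)] z(2)[OF x(1)] P by (intro M_disjoint) auto
    then show False using x w by blast
  qed
  then show ?thesis using x by blast
qed

text \<open>Applying \<open>M\<close> twice makes the sets converge to \<open>x\<close>. If
  infinitely many \<open>V k\<close> contained points \<open>w k\<close> outside a neighbourhood
  \<open>P\<close> of \<open>x\<close>, these would accumulate at some \<open>z\<close> different
  from \<open>x\<close>, which has a neighbourhood \<open>A\<close> missing almost all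
  \<open>y k\<close>. Since \<open>M z A\<close> meets infinitely many of the sets
  \<open>V k\<close>, the point \<open>z\<close> would lie in the corresponding sets
  \<open>W k\<close>, which are disjoint.\<close>

lemma shrinking_nbhds:
  fixes y :: "nat \<Rightarrow> 'a"
  assumes y: "inj y" "limitin X y x sequentially" "x \<notin> range y" and G: "openin X G" "range y \<subseteq> G"
  obtains V where "\<And>k. openin X (V k)" "\<And>k. y k \<in> V k" "\<And>k. V k \<subseteq> G" "\<And>k. x \<notin> V k" "disjoint_family V"
    "\<And>P. openin X P \<Longrightarrow> x \<in> P \<Longrightarrow> finite {k. \<not> V k \<subseteq> P}"
proof -
  have xX: "x \<in> topspace X" using y(2) limitin_topspace by fast
  have yX: "y k \<in> topspace X" for k using G openin_subset by blast
  have "\<exists>U. openin X U \<and> y k \<in> U \<and> U \<subseteq> G \<and> x \<notin> U \<and> range y \<inter> U \<subseteq> {y k}" for k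
  proof -
    obtain A B where AB: "openin X A" "openin X B" "y k \<in> A" "x \<in> B" "A \<inter> B = {}"
      using Hausdorff_nbhds[OF yX xX] y(3) by (metis rangeI)
    then have "\<exists>N. \<forall>n\<ge>N. y n \<in> B" using y(2) by (simp add: limitin_sequentially)
    then obtain N where N: "\<And>n. n \<ge> N \<Longrightarrow> y n \<in> B" by blast
    let ?C = "y ` {..<N} - {y k}"
    have "closedin X ?C" using Hausdorff yX by (intro closedin_Hausdorff_finite) auto
    then have "openin X (A \<inter> G - ?C)" using AB G by blast
    moreover have "range y \<inter> (A \<inter> G - ?C) \<subseteq> {y k}"
    proof
      fix w assume w: "w \<in> range y \<inter> (A \<inter> G - ?C)"
      then obtain n where n: "w = y n" by blast
      then have "n < N" using N[of n] w AB by (meson IntD1 IntD2 DiffD1 disjoint_iff not_le)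
      then show "w \<in> {y k}" using n w by blast
    qed
    moreover have "y k \<in> A \<inter> G - ?C" using AB G by blast
    ultimately show ?thesis using AB by blast
  qed
  then obtain U where U: "\<And>k. openin X (U k) \<and> y k \<in> U k \<and> U k \<subseteq> G \<and> x \<notin> U k \<and> range y \<inter> U k \<subseteq> {y k}" by metis
  define W where "W k = M (y k) (U k)" for k
  have W: "openin X (W k)" "y k \<in> W k" "W k \<subseteq> U k" for k
    using M_open U by (auto simp: W_def)
  have Wd: "W j \<inter> W k = {}" if "j \<noteq> k" for j k
  proof -
    have "y j \<notin> U k" "y k \<notin> U j" using U y(1) that by (auto dest: injD)
    then show ?thesis unfolding W_def using U by (intro M_disjoint) auto
  qed
  define V where "V k = M (y k) (W k)" for k
  have V: "openin X (V k)" "y k \<in> V k" "V k \<subseteq> W k" for k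
    using M_open W by (auto simp: V_def)
  have Vd: "V j \<inter> V k = {}" if "j \<noteq> k" for j k using Wd[OF that] V(3) by blast
  show ?thesis
  proof
    show "openin X (V k)" "y k \<in> V k" "V k \<subseteq> G" "x \<notin> V k" for k using V[of k] W[of k] U[of k] by auto
    show "disjoint_family V" using Vd by (simp add: disjoint_family_on_def)
    fix P assume P: "openin X P" "x \<in> P"
    show "finite {k. \<not> V k \<subseteq> P}"
    proof (rule ccontr)
      define I where "I = {k. \<not> V k \<subseteq> P}"
      assume "infinite {k. \<not> V k \<subseteq> P}"
      then have I: "infinite I" by (simp add: I_def)
      have "\<forall>k. \<exists>w. k \<in> I \<longrightarrow> w \<in> V k - P" by (auto simp: I_def)
      then obtain w where w: "\<And>k. k \<in> I \<Longrightarrow> w k \<in> V k - P" by metis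
      have inj: "inj_on w I"
      proof (rule inj_onI)
        fix j k assume "j \<in> I" "k \<in> I" "w j = w k"
        then have "w j \<in> V j \<inter> V k" using w[of j] w[of k] by auto
        then show "j = k" using Vd[of j k] by blast
      qed
      then have "infinite (w ` I)" using I by (simp add: finite_image_iff)
      moreover have "w ` I \<subseteq> topspace X" using w V(1) openin_subset by blast
      ultimately obtain z where z: "z \<in> topspace X" "\<And>U. openin X U \<Longrightarrow> z \<in> U \<Longrightarrow> infinite (w ` I \<inter> U)"
        using infinite_imp_limit_point by blast
      have "w ` I \<inter> P = {}" using w by blast
      then have "z \<notin> P" using z(2)[OF P(1)] by auto
      then have "z \<noteq> x" using P by blast
      then obtain A B where AB: "openin X A" "openin X B" "z \<in> A" "x \<in> B" "A \<inter> B = {}"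
        using Hausdorff_nbhds[OF z(1) xX] by metis
      then have "\<exists>N. \<forall>n\<ge>N. y n \<in> B" using y(2) by (simp add: limitin_sequentially)
      then obtain N where N: "\<And>n. n \<ge> N \<Longrightarrow> y n \<in> B" by blast
      let ?J = "{k \<in> I. w k \<in> M z A}"
      have "w ` I \<inter> M z A = w ` ?J" by blast
      then have "infinite ?J" using z(2)[of "M z A"] M_open[OF AB(1,3)] by (metis finite_imageI)
      then have Jn: "infinite (?J - {..<N})" by (simp add: Diff_infinite_finite)
      have zW: "z \<in> W k" if "k \<in> ?J - {..<N}" for k
      proof (rule ccontr)
        assume "z \<notin> W k"
        moreover have "y k \<notin> A" using N[of k] AB that by auto
        ultimately have "M (y k) (W k) \<inter> M z A = {}" using W AB by (intro M_disjoint) auto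
        then show False using that w[of k] by (auto simp: V_def)
      qed
      obtain j where j: "j \<in> ?J - {..<N}" using Jn by (metis ex_in_conv finite.emptyI)
      obtain k where k: "k \<in> ?J - {..<N} - {j}" using Jn by (metis ex_in_conv finite.emptyI finite_insert infinite_remove)
      have "z \<in> W j" "z \<in> W k" "j \<noteq> k" using zW j k by auto
      then show False using Wd by blast
    qed
  qed
qed

text \<open>A point other than \<open>x\<close> has a neighbourhood disjoint from a neighbourhood of
  \<open>x\<close>. The latter contains all but finitely many \<open>W k\<close>, so only a finite
  union of closed sets matters near the point.\<close>

lemma closedin_fan:
  fixes V W :: "nat \<Rightarrow> 'a set"
  assumes V: "\<And>P. openin X P \<Longrightarrow> x \<in> P \<Longrightarrow> finite {k. \<not> V k \<subseteq> P}"
    and x: "x \<in> topspace X" and W: "\<And>k. closedin X (W k)" "\<And>k. W k \<subseteq> V k"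
  shows "closedin X (insert x (\<Union>k. W k))"
proof -
  let ?F = "insert x (\<Union>k. W k)"
  have sub: "?F \<subseteq> topspace X" using x W(1) closedin_subset by blast
  have "X closure_of ?F \<subseteq> ?F"
  proof (rule ccontr)
    assume "\<not> ?thesis"
    then obtain z where z: "z \<in> X closure_of ?F" "z \<notin> ?F" by blast
    then have "z \<in> topspace X" "z \<noteq> x" using closure_of_subset_topspace[of X] by blast+
    then obtain A B where AB: "openin X A" "openin X B" "z \<in> A" "x \<in> B" "A \<inter> B = {}"
      using Hausdorff_nbhds[OF _ x] by metis
    let ?C = "\<Union>k\<in>{k. \<not> V k \<subseteq> B}. W k"
    have "closedin X ?C" using V[OF AB(2,4)] W(1) by (intro closedin_Union) auto
    then have "openin X (A - ?C)" using AB by blast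
    moreover have "z \<in> A - ?C" using AB z by blast
    ultimately obtain u where u: "u \<in> ?F" "u \<in> A - ?C" using z(1) unfolding in_closure_of by meson
    have "u \<noteq> x" using u AB by blast
    then obtain k where "u \<in> W k" using u by blast
    then have "V k \<subseteq> B" using u by blast
    then show False using \<open>u \<in> W k\<close> W(2) u AB by blast
  qed
  then show ?thesis using sub by (intro closure_of_subset_eq[THEN iffD1] conjI)
qed

section \<open>Pieces of prescribed rank and colour\<close>

lemma infinite_kernel_Int:
  assumes "openin X V" "V \<inter> perfect_kernel X \<noteq> {}"
  shows "infinite (V \<inter> perfect_kernel X)"
proof -
  obtain p where p: "p \<in> V" "p \<in> perfect_kernel X" using assms by blast
  then have "p \<in> X derived_set_of perfect_kernel X" using perfect_kernel_dense_in_itself[of X] by blast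
  then have "infinite (perfect_kernel X \<inter> V)"
    using p(1) assms(1) t1 by (auto simp: t1_space_derived_set_of_infinite_openin)
  then show ?thesis by (simp add: Int_commute)
qed

lemma kernel_sequence:
  assumes V: "openin X V" "V \<inter> perfect_kernel X \<noteq> {}"
  obtains x and y :: "nat \<Rightarrow> 'a" where "x \<in> V" "x \<in> perfect_kernel X" "inj y"
    "range y \<subseteq> V \<inter> perfect_kernel X" "x \<notin> range y" "limitin X y x sequentially"
proof -
  obtain p where p: "p \<in> V" "p \<in> perfect_kernel X" using V by blast
  obtain V' where V': "openin X V'" "p \<in> V'" "X closure_of V' \<subseteq> V" using regular[OF V(1) p(1)] .
  have "infinite (V' \<inter> perfect_kernel X)" using infinite_kernel_Int[OF V'(1)] V'(2) p(2) by blast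
  moreover have "V' \<inter> perfect_kernel X \<subseteq> topspace X" using V'(1) openin_subset by blast
  ultimately obtain y :: "nat \<Rightarrow> 'a" and x where y: "inj y" "range y \<subseteq> V' \<inter> perfect_kernel X" "limitin X y x sequentially"
    using convergent_sequence by metis
  have V'c: "V' \<subseteq> X closure_of V'" using V'(1) by (simp add: closure_of_subset openin_subset)
  have "closedin X (X closure_of V' \<inter> perfect_kernel X)" using closedin_perfect_kernel[OF t1] by (simp add: closedin_Int)
  moreover have "y n \<in> X closure_of V' \<inter> perfect_kernel X" for n using y(2) V'c by blast
  ultimately have x: "x \<in> X closure_of V' \<inter> perfect_kernel X"
    using limitin_closedin[OF y(3), of "X closure_of V' \<inter> perfect_kernel X"] by simp
  obtain N where N: "x \<notin> range (\<lambda>n. y (n + N))"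
  proof (cases "x \<in> range y")
    case True
    then obtain m where "x = y m" by blast
    then have "x \<notin> range (\<lambda>n. y (n + Suc m))" using inj_eq[OF y(1)] by auto
    then show ?thesis by (rule that)
  next
    case False
    then show ?thesis using that[of 0] by auto
  qed
  show ?thesis
  proof
    show "inj (\<lambda>n. y (n + N))" using inj_eq[OF y(1)] by (intro injI) simp
    show "limitin X (\<lambda>n. y (n + N)) x sequentially" using y(3) by (rule limitin_sequentially_offset)
    show "range (\<lambda>n. y (n + N)) \<subseteq> V \<inter> perfect_kernel X" using y(2) V'(3) V'c by blast
  qed (use x V'(3) N in auto)
qed

text \<open>The disjoint open sets \<open>V k\<close> cut out the pieces, so each piece is open in
  the fan, and local invariants of the fan can be computed piece by piece.\<close>

lemma fan_open_piece:
  assumes V: "\<And>k. openin X (V k)" "disjoint_family V" "\<And>k. x \<notin> V k" and W: "\<And>k. W k \<subseteq> V k"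
  shows "openin (subtopology X (insert x (\<Union>k. W k))) (W j)"
    "subtopology (subtopology X (insert x (\<Union>k. W k))) (W j) = subtopology X (W j)"
proof -
  have "insert x (\<Union>k. W k) \<inter> V j = W j"
  proof
    show "insert x (\<Union>k. W k) \<inter> V j \<subseteq> W j"
    proof
      fix u assume u: "u \<in> insert x (\<Union>k. W k) \<inter> V j"
      then obtain k where k: "u \<in> W k" using V(3) by blast
      then have "u \<in> V k \<inter> V j" using W u by blast
      then have "k = j" using V(2) by (auto simp: disjoint_family_on_def)
      then show "u \<in> W j" using k by simp
    qed
  qed (use W in blast)
  then show "openin (subtopology X (insert x (\<Union>k. W k))) (W j)"
    using V(1)[of j] by (metis openin_subtopology_Int2)
  show "subtopology (subtopology X (insert x (\<Union>k. W k))) (W j) = subtopology X (W j)"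
    by (simp add: subtopology_subtopology Int_absorb1 UN_upper subset_insertI2)
qed

text \<open>A single point has rank 0. For the step, pieces of rank \<open>n\<close> are placed
  around the terms of a sequence converging to a point \<open>x\<close>; in the resulting fan the
  derivative of order \<open>Suc n\<close> is exactly \<open>{x}\<close>. The terms are themselves
  kernel points, so the induction hypothesis applies inside their neighbourhoods.\<close>

lemma scattered_piece:
  "openin X V \<Longrightarrow> V \<inter> perfect_kernel X \<noteq> {} \<Longrightarrow>
    \<exists>W. closedin X W \<and> W \<subseteq> V \<and> iter_derived (subtopology X W) n \<noteq> {} \<and>
        iter_derived (subtopology X W) (Suc n) = {}"
proof (induction n arbitrary: V)
  case 0
  then obtain p where p: "p \<in> V" "p \<in> topspace X" using openin_subset by blast
  have "X derived_set_of {p} = {}" using t1 p(2) by (simp add: t1_space_derived_set_of_singleton)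
  then have "iter_derived (subtopology X {p}) (Suc 0) = {}"
    by (simp add: derived_set_of_subtopology p(2))
  moreover have "closedin X {p}" using closedin_Hausdorff_singleton[OF Hausdorff p(2)] .
  moreover have "iter_derived (subtopology X {p}) 0 = {p}" using p(2) by simp
  ultimately show ?case using p(1) by (intro exI[of _ "{p}"] conjI) (simp_all del: iter_derived.simps)
next
  case (Suc n)
  obtain x and y :: "nat \<Rightarrow> 'a" where x: "x \<in> V" "x \<in> perfect_kernel X" and y: "inj y"
    "range y \<subseteq> V \<inter> perfect_kernel X" "x \<notin> range y" "limitin X y x sequentially"
    using kernel_sequence[OF Suc.prems] .
  have "range y \<subseteq> V" using y(2) by blast
  then obtain U where U: "\<And>k. openin X (U k)" "\<And>k. y k \<in> U k" "\<And>k. U k \<subseteq> V" "\<And>k. x \<notin> U k" "disjoint_family U"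
    "\<And>P. openin X P \<Longrightarrow> x \<in> P \<Longrightarrow> finite {k. \<not> U k \<subseteq> P}"
    using shrinking_nbhds[OF y(1,4,3) Suc.prems(1)] by metis
  have "\<exists>W. closedin X W \<and> W \<subseteq> U k \<and> iter_derived (subtopology X W) n \<noteq> {} \<and>
        iter_derived (subtopology X W) (Suc n) = {}" for k
    using Suc.IH[OF U(1)[of k]] U(2)[of k] y(2) by blast
  then obtain W where W: "\<And>k. closedin X (W k)" "\<And>k. W k \<subseteq> U k" "\<And>k. iter_derived (subtopology X (W k)) n \<noteq> {}"
        "\<And>k. iter_derived (subtopology X (W k)) (Suc n) = {}" by metis
  define F where "F = insert x (\<Union>k. W k)"
  define T where "T = subtopology X F"
  have xX: "x \<in> topspace X" using x Suc.prems(1) openin_subset by blast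
  have F: "closedin X F" unfolding F_def using closedin_fan[OF U(6) xX W(1,2)] .
  have tT: "topspace T = F" using closedin_subset[OF F] by (auto simp: T_def)
  have piece: "openin T (W k)" "subtopology T (W k) = subtopology X (W k)" for k
    unfolding T_def F_def using fan_open_piece[of U x W k] U W(2) by auto
  have WI: "W k \<inter> iter_derived T m = iter_derived (subtopology X (W k)) m" for k m
    using iter_derived_open_subtopology[OF piece(1)[of k], of m] piece(2)[of k] by simp
  have T1: "t1_space T" unfolding T_def using t1 by (rule t1_space_subtopology)
  have sub: "iter_derived T (Suc n) \<subseteq> {x}"
  proof
    fix u assume u: "u \<in> iter_derived T (Suc n)"
    then have "u \<in> F" using iter_derived_subset[of T "Suc n"] tT by blast
    moreover have "u \<notin> W k" for k using WI[of k "Suc n"] W(4)[of k] u by blast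
    ultimately show "u \<in> {x}" by (simp add: F_def)
  qed
  have "x \<in> T derived_set_of (iter_derived T n)"
    unfolding in_derived_set_of
  proof (intro conjI allI impI)
    show "x \<in> topspace T" by (simp add: tT F_def)
    fix P assume "x \<in> P \<and> openin T P"
    then obtain Q where Q: "openin X Q" "P = F \<inter> Q" "x \<in> Q" by (auto simp: T_def openin_subtopology)
    have "{k. \<not> U k \<subseteq> Q} \<noteq> UNIV" using U(6)[OF Q(1,3)] by (metis infinite_UNIV_nat)
    then obtain k where "U k \<subseteq> Q" by blast
    obtain u where "u \<in> W k" "u \<in> iter_derived T n" using W(3)[of k] WI[of k n] by blast
    then have "u \<in> P" "u \<noteq> x" using \<open>U k \<subseteq> Q\<close> W(2)[of k] Q U(4)[of k] by (auto simp: F_def)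
    then show "\<exists>u. u \<noteq> x \<and> u \<in> iter_derived T n \<and> u \<in> P" using \<open>u \<in> iter_derived T n\<close> by blast
  qed
  then have "iter_derived T (Suc n) \<noteq> {}" by auto
  moreover have "iter_derived T (Suc (Suc n)) = {}"
    using derived_set_of_mono[OF sub, of T] T1 xX by (auto simp: t1_space_derived_set_of_singleton tT F_def)
  moreover have "F \<subseteq> V" using x W(2) U(3) by (auto simp: F_def)
  ultimately show ?case using F unfolding T_def by blast
qed

lemma closure_dense_in_itself:
  assumes "openin X V"
  shows "X closure_of (V \<inter> perfect_kernel X) \<subseteq> X derived_set_of (X closure_of (V \<inter> perfect_kernel X))"
proof -
  let ?A = "V \<inter> perfect_kernel X"
  have A: "?A \<subseteq> topspace X" using assms openin_subset by blast
  have "?A \<subseteq> X derived_set_of ?A"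
    using perfect_kernel_dense_in_itself[of X] openin_Int_derived_set_of_subset[OF assms, of "perfect_kernel X"] by blast
  then have "X closure_of ?A \<subseteq> X derived_set_of ?A" by (auto simp: closure_of)
  also have "\<dots> \<subseteq> X derived_set_of (X closure_of ?A)"
    by (rule derived_set_of_mono[OF closure_of_subset[OF A]])
  finally show ?thesis .
qed

text \<open>A point that is the limit of kernel points can be given any colour \<open>n\<close> in place: along the
  sequence, alternate perfect pieces with scattered pieces of Cantor--Bendixson rank exactly \<open>n\<close>.\<close>

lemma coloured_piece:
  fixes y :: "nat \<Rightarrow> 'a"
  assumes y: "range y \<subseteq> perfect_kernel X - {x}" "limitin X y x sequentially" and G: "openin X G" "x \<in> G"
  shows "\<exists>F. closedin X F \<and> x \<in> F \<and> F \<subseteq> G \<and>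
    (\<forall>m. coloured m (subtopology X F) = (if m = n then {x} else {}))"
proof -
  have xX: "x \<in> topspace X" using G openin_subset by blast
  \<comment> \<open>The given sequence may repeat values. Its range within \<open>G\<close> is
    infinite, since otherwise \<open>x\<close> would have a neighbourhood missing every term, and an
    injective sequence \<open>e\<close> of such values converges to \<open>x\<close> as
    well.\<close>
  have "infinite (range y \<inter> G)"
  proof
    assume fin: "finite (range y \<inter> G)"
    have "closedin X (range y \<inter> G)"
      using fin G openin_subset by (intro closedin_Hausdorff_finite[OF Hausdorff]) auto
    then have "openin X (G - range y \<inter> G)" using G by blast
    moreover have "x \<in> G - range y \<inter> G" using G y(1) by auto
    ultimately have "\<exists>N. \<forall>n\<ge>N. y n \<in> G - range y \<inter> G" using y(2) unfolding limitin_sequentially by blast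
    then show False by blast
  qed
  then obtain e :: "nat \<Rightarrow> 'a" where e: "inj e" "range e \<subseteq> range y \<inter> G"
    using infinite_countable_subset by blast
  have "limitin X e x sequentially"
    unfolding limitin_sequentially
  proof (intro conjI allI impI xX)
    fix U assume "openin X U \<and> x \<in> U"
    then have "\<exists>N. \<forall>n\<ge>N. y n \<in> U" using y(2) by (simp add: limitin_sequentially)
    then obtain N where N: "\<And>n. n \<ge> N \<Longrightarrow> y n \<in> U" by blast
    have "e ` {k. e k \<notin> U} \<subseteq> y ` {..<N}"
    proof
      fix u assume "u \<in> e ` {k. e k \<notin> U}"
      then obtain k where k: "u = e k" "e k \<notin> U" by blast
      then obtain m where "e k = y m" using e(2) by (metis IntD1 imageE rangeI subsetD)
      then have "u = y m" "y m \<notin> U" using k by simp_all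
      then show "u \<in> y ` {..<N}" using N[of m] by (metis imageI lessThan_iff not_le)
    qed
    then have "finite (e ` {k. e k \<notin> U})" using finite_subset by blast
    then have "finite {k. e k \<notin> U}"
      using e(1) by (metis (no_types, lifting) finite_imageD inj_on_subset subset_UNIV)
    then obtain m where "\<And>k. k \<in> {k. e k \<notin> U} \<Longrightarrow> k < m" by (auto simp: finite_nat_set_iff_bounded)
    then show "\<exists>N. \<forall>n\<ge>N. e n \<in> U" by (metis mem_Collect_eq not_le)
  qed
  moreover have "x \<notin> range e" "range e \<subseteq> G" using e(2) y(1) by blast+
  ultimately obtain U where U: "\<And>k. openin X (U k)" "\<And>k. e k \<in> U k" "\<And>k. U k \<subseteq> G" "\<And>k. x \<notin> U k" "disjoint_family U"
    "\<And>P. openin X P \<Longrightarrow> x \<in> P \<Longrightarrow> finite {k. \<not> U k \<subseteq> P}"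
    using shrinking_nbhds[OF e(1) _ _ G(1)] by metis
  have eU: "e k \<in> U k \<inter> perfect_kernel X" for k using U(2) e(2) y(1) by blast
  have "\<exists>W. closedin X W \<and> W \<subseteq> U k \<and> (if even k then e k \<in> W \<and> W \<subseteq> X derived_set_of W
      else iter_derived (subtopology X W) n \<noteq> {} \<and> iter_derived (subtopology X W) (Suc n) = {})" for k
  proof (cases "even k")
    case True
    obtain V where V: "openin X V" "e k \<in> V" "X closure_of V \<subseteq> U k" using regular[OF U(1,2)] .
    let ?W = "X closure_of (V \<inter> perfect_kernel X)"
    have "V \<inter> perfect_kernel X \<subseteq> ?W" using V(1) openin_subset by (intro closure_of_subset) blast
    then have "e k \<in> ?W" using V(2) eU[of k] by blast
    moreover have "?W \<subseteq> U k" using V(3) closure_of_mono[of "V \<inter> perfect_kernel X" V X] by auto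
    ultimately show ?thesis using True closure_dense_in_itself[OF V(1)] by (intro exI[of _ ?W]) simp
  next
    case False
    then show ?thesis using scattered_piece[OF U(1)[of k], of n] eU[of k] by auto
  qed
  then obtain W where W: "\<And>k. closedin X (W k)" "\<And>k. W k \<subseteq> U k"
    and We: "\<And>k. even k \<Longrightarrow> e k \<in> W k \<and> W k \<subseteq> X derived_set_of W k"
    and Wo: "\<And>k. odd k \<Longrightarrow> iter_derived (subtopology X (W k)) n \<noteq> {} \<and> iter_derived (subtopology X (W k)) (Suc n) = {}"
    by metis
  define F where "F = insert x (\<Union>k. W k)"
  define T where "T = subtopology X F"
  have F: "closedin X F" unfolding F_def using closedin_fan[OF U(6) xX W(1,2)] .
  have tT: "topspace T = F" using closedin_subset[OF F] by (auto simp: T_def)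
  have piece: "openin T (W k)" "subtopology T (W k) = subtopology X (W k)" for k
    unfolding T_def F_def using fan_open_piece[of U x W k] U W(2) by auto
  have WI: "W k \<inter> iter_derived T m = iter_derived (subtopology X (W k)) m" for k m
    using iter_derived_open_subtopology[OF piece(1)[of k], of m] piece(2)[of k] by simp
  have WK: "W k \<inter> perfect_kernel T = perfect_kernel (subtopology X (W k))" for k
    using perfect_kernel_open_subtopology[OF piece(1)[of k]] piece(2)[of k] by simp
  have T1: "t1_space T" unfolding T_def using t1 by (rule t1_space_subtopology)
  \<comment> \<open>The kernel lies in every derivative, and the derivative of order
    \<open>Suc n\<close> of an odd piece is empty.\<close>
  have KO: "W k \<inter> perfect_kernel T = {}" if "odd k" for k
    using WK[of k] perfect_kernel_subset_iter_derived[of "subtopology X (W k)" "Suc n"] Wo[OF that] by simp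
  have KE: "W k \<subseteq> perfect_kernel T" if "even k" for k
  proof -
    have "W k \<subseteq> subtopology X (W k) derived_set_of W k"
      using We[OF that] by (simp add: derived_set_of_subtopology)
    then have "W k \<subseteq> perfect_kernel (subtopology X (W k))" by (rule perfect_kernel_maximal)
    then show ?thesis using WK[of k] by blast
  qed
  have near: "\<exists>k. b = even k \<and> U k \<subseteq> Q" if "openin X Q" "x \<in> Q" for Q b
  proof -
    have fin: "finite {k. \<not> U k \<subseteq> Q}" using U(6) that by blast
    have "infinite {k::nat. b = even k}"
    proof (cases b)
      case True
      have "inj (\<lambda>k::nat. 2 * k)" by (simp add: inj_def)
      moreover have "range (\<lambda>k::nat. 2 * k) \<subseteq> {k. b = even k}" using True by auto
      ultimately show ?thesis using finite_subset range_inj_infinite by blast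
    next
      case False
      have "inj (\<lambda>k::nat. 2 * k + 1)" by (simp add: inj_def)
      moreover have "range (\<lambda>k::nat. 2 * k + 1) \<subseteq> {k. b = even k}" using False by auto
      ultimately show ?thesis using finite_subset range_inj_infinite by blast
    qed
    then have "\<not> {k. b = even k} \<subseteq> {k. \<not> U k \<subseteq> Q}" using fin finite_subset by blast
    then show ?thesis by blast
  qed
  have accum: "x \<in> T derived_set_of S" if S: "\<And>k. b = even k \<Longrightarrow> W k \<inter> S \<noteq> {}" for S b
    unfolding in_derived_set_of
  proof (intro conjI allI impI)
    show "x \<in> topspace T" by (simp add: tT F_def)
    fix P assume "x \<in> P \<and> openin T P"
    then obtain Q where Q: "openin X Q" "P = F \<inter> Q" "x \<in> Q" by (auto simp: T_def openin_subtopology)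
    then obtain k where k: "b = even k" "U k \<subseteq> Q" using near by blast
    obtain u where "u \<in> W k" "u \<in> S" using S[OF k(1)] by blast
    then have "u \<in> P" "u \<noteq> x" using \<open>U k \<subseteq> Q\<close> W(2)[of k] Q U(4)[of k] by (auto simp: F_def)
    then show "\<exists>u. u \<noteq> x \<and> u \<in> S \<and> u \<in> P" using \<open>u \<in> S\<close> by blast
  qed
  \<comment> \<open>The perfect pieces accumulate at \<open>x\<close>, so adding \<open>x\<close> to
    the kernel keeps it dense in itself.\<close>
  have xK: "x \<in> perfect_kernel T"
  proof -
    have "x \<in> T derived_set_of perfect_kernel T"
      by (rule accum[of True]) (use KE We in blast)
    then have "insert x (perfect_kernel T) \<subseteq> T derived_set_of insert x (perfect_kernel T)"
      using perfect_kernel_dense_in_itself[of T] derived_set_of_mono[of "perfect_kernel T" "insert x (perfect_kernel T)" T] by blast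
    then show ?thesis using perfect_kernel_maximal by blast
  qed
  have odd: "u \<in> F - perfect_kernel T \<Longrightarrow> \<exists>k. odd k \<and> u \<in> W k" for u
    using xK KE by (auto simp: F_def)
  have bd: "kernel_boundary T = {x}"
  proof
    show "kernel_boundary T \<subseteq> {x}"
    proof
      fix u assume u: "u \<in> kernel_boundary T"
      show "u \<in> {x}"
      proof (rule ccontr)
        assume "u \<notin> {x}"
        moreover have "u \<in> F" "u \<in> perfect_kernel T" using u perfect_kernel_subset[of T] tT by (auto simp: kernel_boundary_def)
        ultimately obtain k where k: "u \<in> W k" by (auto simp: F_def)
        then have "even k" using KO \<open>u \<in> perfect_kernel T\<close> by blast
        have "u \<in> T closure_of (topspace T - perfect_kernel T)" using u by (simp add: kernel_boundary_def)
        then obtain v where "v \<in> topspace T - perfect_kernel T" "v \<in> W k" using piece(1)[of k] k unfolding in_closure_of by meson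
        then show False using KE[OF \<open>even k\<close>] by blast
      qed
    qed
    have "x \<in> T derived_set_of (topspace T - perfect_kernel T)"
    proof (rule accum[of False])
      fix k :: nat assume "False = even k"
      then have k: "odd k" by simp
      have "W k \<noteq> {}" using Wo[OF k] WI[of k n] by auto
      moreover have "W k \<subseteq> topspace T - perfect_kernel T" using KO[OF k] by (auto simp: tT F_def)
      ultimately show "W k \<inter> (topspace T - perfect_kernel T) \<noteq> {}" by blast
    qed
    then show "{x} \<subseteq> kernel_boundary T"
      using xK derived_set_of_subset_closure_of[of T] by (auto simp: kernel_boundary_def)
  qed
  have rank1: "x \<in> T closure_of (iter_derived T n - perfect_kernel T)"
  proof -
    have "x \<in> T derived_set_of (iter_derived T n - perfect_kernel T)"
    proof (rule accum[of False])
      fix k :: nat assume "False = even k"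
      then have k: "odd k" by simp
      show "W k \<inter> (iter_derived T n - perfect_kernel T) \<noteq> {}" using Wo[OF k] WI[of k n] KO[OF k] by blast
    qed
    then show ?thesis using derived_set_of_subset_closure_of[of T] by blast
  qed
  have rank2: "iter_derived T (Suc n) - perfect_kernel T = {}"
  proof (rule ccontr)
    assume "\<not> ?thesis"
    then obtain u where u: "u \<in> iter_derived T (Suc n)" "u \<notin> perfect_kernel T" by blast
    then have "u \<in> F" using iter_derived_subset[of T "Suc n"] tT by blast
    then obtain k where "odd k" "u \<in> W k" using odd u by blast
    then show False using u WI[of k "Suc n"] Wo[of k] by blast
  qed
  have seq: "\<exists>y :: nat \<Rightarrow> 'a. range y \<subseteq> perfect_kernel T - {x} \<and> limitin T y x sequentially"
  proof (intro exI[of _ "\<lambda>k. e (2 * k)"] conjI)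
    have "e (2 * k) \<in> W (2 * k)" for k using We by simp
    then have "e (2 * k) \<in> perfect_kernel T" "e (2 * k) \<in> F" for k using KE[of "2 * k"] by (auto simp: F_def)
    moreover have "limitin X (\<lambda>k. e (2 * k)) x sequentially"
      using limitin_subsequence[of "\<lambda>k. 2 * k", OF _ \<open>limitin X e x sequentially\<close>] by (simp add: comp_def strict_mono_def)
    ultimately show "limitin T (\<lambda>k. e (2 * k)) x sequentially"
      by (simp add: T_def limitin_subtopology F_def)
    show "range (\<lambda>k. e (2 * k)) \<subseteq> perfect_kernel T - {x}"
      using \<open>\<And>k. e (2 * k) \<in> perfect_kernel T\<close> \<open>x \<notin> range e\<close> by auto
  qed
  have "x \<notin> T derived_set_of {x}" using T1 xK perfect_kernel_subset[of T] by (auto simp: t1_space_derived_set_of_singleton)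
  then have xc: "x \<in> coloured n T"
    unfolding coloured_def bd rank2 using rank1 seq by simp
  have sub: "coloured m T \<subseteq> {x}" for m unfolding coloured_def bd by blast
  have "coloured m T = (if m = n then {x} else {})" for m
    using coloured_disjoint[OF T1, of m n] xc sub[of m] sub[of n] by auto
  moreover have "F \<subseteq> G" using G(2) W(2) U(3) by (auto simp: F_def)
  ultimately show ?thesis using F unfolding T_def by (intro exI[of _ F]) (simp add: F_def)
qed

section \<open>Prescribing the colours of all coloured points at once\<close>

definition coloured_points :: "'a set" where
  "coloured_points = (\<Union>n. coloured n X)"

lemma coloured_points_subset: "coloured_points \<subseteq> kernel_boundary X" "coloured_points \<subseteq> topspace X"
  using perfect_kernel_subset[of X] by (auto simp: coloured_points_def coloured_def kernel_boundary_def)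

lemma coloured_points_isolated:
  assumes "x \<in> coloured_points"
  obtains U where "openin X U" "x \<in> U" "kernel_boundary X \<inter> U \<subseteq> {x}"
proof -
  have "x \<notin> X derived_set_of kernel_boundary X" "x \<in> topspace X"
    using assms coloured_points_subset by (auto simp: coloured_points_def coloured_def)
  then obtain U where "openin X U" "x \<in> U" "\<And>y. y \<noteq> x \<Longrightarrow> y \<in> kernel_boundary X \<Longrightarrow> y \<notin> U"
    unfolding in_derived_set_of by blast
  then show ?thesis using that by blast
qed

text \<open>Around each coloured point a piece with the wanted colour is placed inside
  \<open>M s (W s)\<close>, and \<open>F\<close> is the closure of their union. Within
  \<open>W s\<close> nothing is added by the closure, so the piece is open in \<open>F\<close> and
  determines the colour of \<open>s\<close> there.\<close>

lemma recolouring: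
  fixes c :: "'a \<Rightarrow> nat"
  obtains F where "closedin X F" "\<And>n. coloured n (subtopology X F) = {s \<in> coloured_points. c s = n}"
proof -
  let ?G = coloured_points
  have "\<forall>s. \<exists>U. s \<in> ?G \<longrightarrow> openin X U \<and> s \<in> U \<and> ?G \<inter> U \<subseteq> {s}"
    using coloured_points_isolated coloured_points_subset(1) by (metis Int_mono order_refl subset_trans)
  then obtain U0 where U0: "\<And>s. s \<in> ?G \<Longrightarrow> openin X (U0 s) \<and> s \<in> U0 s \<and> ?G \<inter> U0 s \<subseteq> {s}" by metis
  obtain W where W: "\<And>s. s \<in> ?G \<Longrightarrow> openin X (W s) \<and> s \<in> W s \<and> W s \<subseteq> U0 s" "disjoint_family_on W ?G"
    using separate[of ?G U0] U0 by metis
  have "\<exists>F. closedin X F \<and> s \<in> F \<and> F \<subseteq> M s (W s) \<and>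
    (\<forall>m. coloured m (subtopology X F) = (if m = c s then {s} else {}))" if "s \<in> ?G" for s
  proof -
    obtain y :: "nat \<Rightarrow> 'a" where "range y \<subseteq> perfect_kernel X - {s}" "limitin X y s sequentially"
      using \<open>s \<in> ?G\<close> by (auto simp: coloured_points_def coloured_def)
    then show ?thesis using coloured_piece[of y s "M s (W s)" "c s"] M_open[of "W s" s] W(1)[OF that] by blast
  qed
  then obtain P where P: "\<And>s. s \<in> ?G \<Longrightarrow> closedin X (P s) \<and> s \<in> P s \<and> P s \<subseteq> M s (W s) \<and>
    (\<forall>m. coloured m (subtopology X (P s)) = (if m = c s then {s} else {}))" by metis
  define F where "F = X closure_of (\<Union>s\<in>?G. P s)"
  define T where "T = subtopology X F"
  have tT: "topspace T = F" using closure_of_subset_topspace[of X] by (auto simp: T_def F_def)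
  have MW: "M s (W s) \<subseteq> W s" if "s \<in> ?G" for s using M_open W(1)[OF that] by blast
  have FW: "F \<inter> W s = P s" if s: "s \<in> ?G" for s
  proof
    show "P s \<subseteq> F \<inter> W s"
    proof -
      have "(\<Union>s\<in>?G. P s) \<subseteq> topspace X" using P closedin_subset by blast
      then have "P s \<subseteq> F" using s closure_of_subset unfolding F_def by blast
      then show ?thesis using P[OF s] MW[OF s] by blast
    qed
    show "F \<inter> W s \<subseteq> P s"
    proof (rule ccontr)
      assume "\<not> F \<inter> W s \<subseteq> P s"
      then obtain u where u: "u \<in> F" "u \<in> W s - P s" by blast
      have "openin X (W s - P s)" using W(1)[OF s] P[OF s] by blast
      then obtain v where v: "v \<in> (\<Union>s\<in>?G. P s)" "v \<in> W s - P s" using u unfolding F_def in_closure_of by meson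
      then obtain t where t: "t \<in> ?G" "v \<in> P t" by blast
      then have "v \<in> W t" "t \<noteq> s" using P MW v by blast+
      then show False using W(2) t s v by (auto simp: disjoint_family_on_def)
    qed
  qed
  have piece: "openin T (P s)" "subtopology T (P s) = subtopology X (P s)" if "s \<in> ?G" for s
  proof -
    show "openin T (P s)" unfolding T_def using FW[OF that] W(1)[OF that] by (metis openin_subtopology_Int2)
    show "subtopology T (P s) = subtopology X (P s)"
      using FW[OF that] by (auto simp: T_def subtopology_subtopology intro!: arg_cong[of _ _ "subtopology X"])
  qed
  have PC: "P s \<inter> coloured m T = (if m = c s then {s} else {})" if "s \<in> ?G" for s m
    using coloured_open_subtopology[OF piece(1)[OF that], of m] piece(2)[OF that] P[OF that] by simp
  have GB: "?G \<subseteq> kernel_boundary T"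
    using PC by (fastforce simp: coloured_def split: if_splits)
  \<comment> \<open>A point of \<open>F\<close> outside all pieces lies outside all
    \<open>W s\<close>, so by \<open>limit_of_pieces\<close> the original coloured points accumulate
    at it. These belong to the kernel boundary of \<open>T\<close>, whereas a coloured point must
    not be a limit of the kernel boundary. So no new coloured points arise.\<close>
  have rest: "u \<in> (\<Union>s\<in>?G. P s)" if u: "u \<in> coloured m T" for u m
  proof (rule ccontr)
    assume nu: "u \<notin> (\<Union>s\<in>?G. P s)"
    have uF: "u \<in> F" using u perfect_kernel_subset[of T] tT by (auto simp: coloured_def kernel_boundary_def)
    have uT: "u \<notin> T derived_set_of kernel_boundary T" using u by (simp add: coloured_def)
    have "u \<in> T derived_set_of kernel_boundary T"
      unfolding in_derived_set_of
    proof (intro conjI allI impI)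
      show "u \<in> topspace T" using uF tT by simp
      fix S assume "u \<in> S \<and> openin T S"
      then obtain Q where Q: "openin X Q" "S = F \<inter> Q" "u \<in> Q" by (auto simp: T_def openin_subtopology)
      have "\<exists>s\<in>?G. s \<in> Q"
      proof (rule limit_of_pieces[of ?G W P u])
        show "u \<in> X closure_of (\<Union>s\<in>?G. P s)" using uF by (simp add: F_def)
        show "u \<notin> W s" if "s \<in> ?G" for s using FW[OF that] uF nu that by blast
      qed (use W(1) P Q in auto)
      then obtain s where s: "s \<in> ?G" "s \<in> Q" by blast
      then have "s \<in> F" "s \<noteq> u" using P[OF s(1)] FW[OF s(1)] nu by blast+
      then show "\<exists>v. v \<noteq> u \<and> v \<in> kernel_boundary T \<and> v \<in> S" using GB s Q by blast
    qed
    then show False using uT by blast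
  qed
  have "coloured n T = {s \<in> ?G. c s = n}" for n
  proof
    show "coloured n T \<subseteq> {s \<in> ?G. c s = n}"
    proof
      fix u assume u: "u \<in> coloured n T"
      then obtain s where s: "s \<in> ?G" "u \<in> P s" using rest by blast
      then show "u \<in> {s \<in> ?G. c s = n}" using PC[OF s(1), of n] u by (auto split: if_splits)
    qed
    show "{s \<in> ?G. c s = n} \<subseteq> coloured n T" using PC by (force split: if_splits)
  qed
  moreover have "closedin X F" by (simp add: F_def)
  ultimately show ?thesis using that unfolding T_def by blast
qed

end

unbundle cardinal_syntax

lemma set_ideal_empty: "set_ideal \<J> \<Longrightarrow> {} \<in> \<J>"
  unfolding set_ideal_def by (elim conjE)

lemma set_ideal_mono: "set_ideal \<J> \<Longrightarrow> S \<in> \<J> \<Longrightarrow> T \<subseteq> S \<Longrightarrow> T \<in> \<J>"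
  unfolding set_ideal_def by blast

lemma set_ideal_Un: "set_ideal \<J> \<Longrightarrow> S \<in> \<J> \<Longrightarrow> T \<in> \<J> \<Longrightarrow> S \<union> T \<in> \<J>"
  unfolding set_ideal_def by blast

section \<open>Colourings and classes of germs\<close>

text \<open>This is all that is retained of kernels and ranks: a discrete set with one colouring
  that contains a copy of every other colouring \<open>c\<close> in an open set. As \<open>h\<close>
  maps onto the whole part of the closure inside \<open>U\<close>, it identifies the germ at
  \<open>x\<close> with the germ at \<open>h x\<close>.\<close>

locale recolourable = mn_space +
  fixes G :: "'a set" and g :: "'a \<Rightarrow> nat"
  assumes G_subset: "G \<subseteq> topspace X" and G_nonempty: "G \<noteq> {}"
    and G_isolated: "s \<in> G \<Longrightarrow> \<exists>U. openin X U \<and> s \<in> U \<and> G \<inter> U \<subseteq> {s}"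
    and recolour: "\<exists>U h k. openin X U \<and>
      homeomorphic_maps (subtopology X (X closure_of G)) (subtopology X (X closure_of G \<inter> U)) h k \<and>
      (\<forall>x \<in> X closure_of G. h x \<in> G \<longleftrightarrow> x \<in> G) \<and> (\<forall>s\<in>G. g (h s) = c s)"
begin

section \<open>Local isomorphisms of colourings\<close>

abbreviation cl :: "'a set \<Rightarrow> 'a set" where "cl S \<equiv> X closure_of S"

definition val :: "('a \<Rightarrow> nat) \<Rightarrow> 'a \<Rightarrow> nat" where "val c x = (if x \<in> G then c x else 0)"

definition supp :: "('a \<Rightarrow> nat) \<Rightarrow> 'a set" where "supp c = {x. val c x \<noteq> 0}"

lemma supp_subset: "supp c \<subseteq> G" "supp c \<subseteq> topspace X"
  using G_subset by (auto simp: supp_def val_def)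

lemma supp_in_cl: "supp c \<subseteq> cl (supp c)"
  using supp_subset by (simp add: closure_of_subset)

lemma cl_subset: "cl S \<subseteq> topspace X"
  by (rule closure_of_subset_topspace)

text \<open>Only the closures of the supports are identified, not neighbourhoods in
  \<open>X\<close>: the copies in \<open>recolour\<close> control nothing beyond the closure of
  \<open>G\<close>.\<close>

definition local_iso :: "('a \<Rightarrow> nat) \<Rightarrow> ('a \<Rightarrow> nat) \<Rightarrow> 'a set \<Rightarrow> 'a set \<Rightarrow> ('a \<Rightarrow> 'a) \<Rightarrow> ('a \<Rightarrow> 'a) \<Rightarrow> bool" where
  "local_iso c c' V V' h k \<longleftrightarrow> openin X V \<and> openin X V' \<and>
     homeomorphic_maps (subtopology X (cl (supp c) \<inter> V)) (subtopology X (cl (supp c') \<inter> V')) h k \<and>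
     (\<forall>x \<in> cl (supp c) \<inter> V. val c' (h x) = val c x)"

lemma topspace_cl_Int: "topspace (subtopology X (cl S \<inter> V)) = cl S \<inter> V"
  using cl_subset by auto

lemma local_isoD:
  assumes "local_iso c c' V V' h k" "x \<in> cl (supp c)" "x \<in> V"
  shows "h x \<in> cl (supp c')" "h x \<in> V'" "k (h x) = x" "val c' (h x) = val c x"
  using assms unfolding local_iso_def homeomorphic_maps_def continuous_map_def topspace_cl_Int by auto

lemma local_iso_sym:
  assumes "local_iso c c' V V' h k"
  shows "local_iso c' c V' V k h"
proof -
  have hm: "homeomorphic_maps (subtopology X (cl (supp c) \<inter> V)) (subtopology X (cl (supp c') \<inter> V')) h k"
    using assms by (simp add: local_iso_def)
  have "val c (k y) = val c' y" if "y \<in> cl (supp c') \<inter> V'" for y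
  proof -
    have "k y \<in> cl (supp c) \<inter> V" "h (k y) = y"
      using hm that unfolding homeomorphic_maps_def continuous_map_def topspace_cl_Int by auto
    then show ?thesis using local_isoD(4)[OF assms, of "k y"] by simp
  qed
  moreover have "homeomorphic_maps (subtopology X (cl (supp c') \<inter> V')) (subtopology X (cl (supp c) \<inter> V)) k h"
    using hm by (rule homeomorphic_maps_sym[THEN iffD1])
  ultimately show ?thesis using assms by (simp add: local_iso_def)
qed

lemma local_iso_nbhd:
  assumes iso: "local_iso c c' V V' h k" and x: "x \<in> cl (supp c)" "x \<in> V" and U: "openin X U" "x \<in> U"
  obtains U' where "openin X U'" "h x \<in> U'" "U' \<subseteq> V'" "\<And>y. y \<in> U' \<Longrightarrow> y \<in> cl (supp c') \<Longrightarrow> k y \<in> U"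
proof -
  let ?B = "cl (supp c') \<inter> V'"
  have "continuous_map (subtopology X ?B) X k"
    using iso by (auto simp: local_iso_def homeomorphic_maps_def continuous_map_in_subtopology)
  then have "openin (subtopology X ?B) {y \<in> topspace (subtopology X ?B). k y \<in> U}"
    using U(1) by (rule openin_continuous_map_preimage)
  then obtain W where W: "openin X W" "{y \<in> topspace (subtopology X ?B). k y \<in> U} = W \<inter> ?B"
    by (auto simp: openin_subtopology)
  have "h x \<in> {y \<in> topspace (subtopology X ?B). k y \<in> U}"
    unfolding topspace_cl_Int using local_isoD[OF iso x] U(2) by simp
  then have "h x \<in> W \<inter> ?B" unfolding W(2) .
  moreover have "k y \<in> U" if "y \<in> W \<inter> V'" "y \<in> cl (supp c')" for y
  proof -
    have "y \<in> W \<inter> ?B" using that by blast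
    then show ?thesis unfolding W(2)[symmetric] by blast
  qed
  moreover have "openin X (W \<inter> V')" using W(1) iso by (simp add: local_iso_def openin_Int)
  ultimately show ?thesis using that[of "W \<inter> V'"] by blast
qed

lemma supp_comp:
  assumes "f 0 = 0"
  shows "supp (f \<circ> c) \<subseteq> supp c"
proof
  fix x assume "x \<in> supp (f \<circ> c)"
  then show "x \<in> supp c" using assms by (cases "c x = 0") (auto simp: supp_def val_def split: if_splits)
qed

text \<open>Composition with a map fixing 0 can only shrink the support, and the new values are
  determined by the old ones. So the same maps restrict to the closures of the smaller supports.
  This makes it possible to store several colourings in one and read them off again.\<close>

lemma local_iso_comp:
  assumes iso: "local_iso c c' V V' h k" and f: "f 0 = 0"
  shows "local_iso (f \<circ> c) (f \<circ> c') V V' h k"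
proof -
  have val: "val (f \<circ> c) x = f (val c x)" for c x using f by (simp add: val_def)
  have sub: "cl (supp (f \<circ> c)) \<subseteq> cl (supp c)" for c
    by (rule closure_of_mono[OF supp_comp[where f = f, OF f]])
  have maps: "h x \<in> cl (supp (f \<circ> c'))"
    if iso: "local_iso c c' V V' h k" and x: "x \<in> cl (supp (f \<circ> c))" "x \<in> V" for c c' V V' h k x
    unfolding in_closure_of
  proof (intro conjI allI impI)
    have x': "x \<in> cl (supp c)" using x sub by blast
    note hx = local_isoD[OF iso x' x(2)]
    show "h x \<in> topspace X" using hx(1) cl_subset by blast
    fix U assume U: "h x \<in> U \<and> openin X U"
    obtain U' where U': "openin X U'" "k (h x) \<in> U'" "U' \<subseteq> V" "\<And>y. y \<in> U' \<Longrightarrow> y \<in> cl (supp c) \<Longrightarrow> h y \<in> U"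
      using local_iso_nbhd[OF local_iso_sym[OF iso] hx(1,2)] U by blast
    then obtain s where s: "s \<in> supp (f \<circ> c)" "s \<in> U'" using x(1) hx(3) unfolding in_closure_of by metis
    have sc: "s \<in> cl (supp c)" using s(1) sub supp_in_cl by blast
    have "val (f \<circ> c') (h s) = val (f \<circ> c) s" using local_isoD(4)[OF iso sc] U'(3) s(2) by (auto simp: val)
    then have "h s \<in> supp (f \<circ> c')" using s(1) by (simp add: supp_def)
    then show "\<exists>y. y \<in> supp (f \<circ> c') \<and> y \<in> U" using U'(4)[OF s(2) sc] by blast
  qed
  have "homeomorphic_maps (subtopology (subtopology X (cl (supp c) \<inter> V)) (cl (supp (f \<circ> c))))
      (subtopology (subtopology X (cl (supp c') \<inter> V')) (cl (supp (f \<circ> c')))) h k"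
  proof (rule homeomorphic_maps_subtopologies_alt)
    show "homeomorphic_maps (subtopology X (cl (supp c) \<inter> V)) (subtopology X (cl (supp c') \<inter> V')) h k"
      using iso by (simp add: local_iso_def)
    show "h ` (topspace (subtopology X (cl (supp c) \<inter> V)) \<inter> cl (supp (f \<circ> c))) \<subseteq> cl (supp (f \<circ> c'))"
      unfolding topspace_cl_Int using maps[OF iso] by blast
    show "k ` (topspace (subtopology X (cl (supp c') \<inter> V')) \<inter> cl (supp (f \<circ> c'))) \<subseteq> cl (supp (f \<circ> c))"
      unfolding topspace_cl_Int using maps[OF local_iso_sym[OF iso]] by blast
  qed
  moreover have "(cl (supp c) \<inter> V) \<inter> cl (supp (f \<circ> c)) = cl (supp (f \<circ> c)) \<inter> V" for c V using sub by blast
  ultimately have "homeomorphic_maps (subtopology X (cl (supp (f \<circ> c)) \<inter> V)) (subtopology X (cl (supp (f \<circ> c')) \<inter> V')) h k"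
    by (simp add: subtopology_subtopology)
  moreover have "val (f \<circ> c') (h x) = val (f \<circ> c) x" if "x \<in> cl (supp (f \<circ> c)) \<inter> V" for x
  proof -
    have "x \<in> cl (supp c)" "x \<in> V" using that sub by blast+
    then show ?thesis using local_isoD(4)[OF iso] by (simp add: val)
  qed
  ultimately show ?thesis using iso by (simp add: local_iso_def)
qed

text \<open>A class of germs assigns to each colouring \<open>c\<close> (colour \<open>0\<close> meaning uncoloured) the set of
  points of the closure of its support at which the colouring has a certain local behaviour.\<close>

definition germ_class :: "(('a \<Rightarrow> nat) \<Rightarrow> 'a set) \<Rightarrow> bool" where
  "germ_class \<Gamma> \<longleftrightarrow> (\<forall>c. \<Gamma> c \<subseteq> cl (supp c)) \<and>
     (\<forall>c c' V V' h k x. local_iso c c' V V' h k \<and> x \<in> V \<and> x \<in> \<Gamma> c \<longrightarrow> h x \<in> \<Gamma> c')"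

lemma germ_class_subset: "germ_class \<Gamma> \<Longrightarrow> \<Gamma> c \<subseteq> cl (supp c)"
  unfolding germ_class_def by blast

lemma germ_class_iso: "germ_class \<Gamma> \<Longrightarrow> local_iso c c' V V' h k \<Longrightarrow> x \<in> V \<Longrightarrow> x \<in> \<Gamma> c \<Longrightarrow> h x \<in> \<Gamma> c'"
  unfolding germ_class_def by blast

lemma germ_classI:
  assumes "\<And>c. \<Gamma> c \<subseteq> cl (supp c)"
    and "\<And>c c' V V' h k x. local_iso c c' V V' h k \<Longrightarrow> x \<in> cl (supp c) \<Longrightarrow> x \<in> V \<Longrightarrow> x \<in> \<Gamma> c \<Longrightarrow> h x \<in> \<Gamma> c'"
  shows "germ_class \<Gamma>"
  unfolding germ_class_def using assms by blast

lemma local_iso_id: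
  assumes V: "openin X V" and eq: "\<And>x. x \<in> V \<Longrightarrow> val c x = val c' x"
  shows "local_iso c c' V V id id"
proof -
  have "V \<inter> supp c = V \<inter> supp c'" using eq by (auto simp: supp_def)
  then have "cl (supp c) \<inter> V = cl (supp c') \<inter> V"
    using openin_Int_closure_of_eq[OF V, of "supp c"] openin_Int_closure_of_eq[OF V, of "supp c'"]
    by (simp add: Int_commute)
  then show ?thesis using V eq by (simp add: local_iso_def homeomorphic_maps_id)
qed

lemma germ_class_local:
  assumes "germ_class \<Gamma>" "openin X V" "\<And>x. x \<in> V \<Longrightarrow> val c x = val c' x"
  shows "\<Gamma> c \<inter> V = \<Gamma> c' \<inter> V"
proof -
  have *: "\<Gamma> c \<inter> V \<subseteq> \<Gamma> c'" if "\<And>x. x \<in> V \<Longrightarrow> val c x = val c' x" for c c'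
    using germ_class_iso[OF assms(1) local_iso_id[OF assms(2) that]] by auto
  show ?thesis using *[OF assms(3)] *[OF assms(3)[symmetric]] by blast
qed

lemma germ_class_supp: "germ_class (\<lambda>c. cl (supp c))"
  by (rule germ_classI) (rule subset_refl, rule local_isoD(1))

lemma germ_class_comp:
  assumes \<Gamma>: "germ_class \<Gamma>" and f: "f 0 = 0"
  shows "germ_class (\<lambda>c. \<Gamma> (f \<circ> c))"
proof (rule germ_classI)
  fix c
  have "supp (f \<circ> c) \<subseteq> supp c" using f by (rule supp_comp)
  then show "\<Gamma> (f \<circ> c) \<subseteq> cl (supp c)" using germ_class_subset[OF \<Gamma>, of "f \<circ> c"] closure_of_mono by blast
next
  fix c c' V V' h k x
  assume iso: "local_iso c c' V V' h k" and x: "x \<in> V" "x \<in> \<Gamma> (f \<circ> c)"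
  show "h x \<in> \<Gamma> (f \<circ> c')" by (rule germ_class_iso[OF \<Gamma> local_iso_comp[where f = f, OF iso f] x])
qed

lemma germ_class_Int: "germ_class \<Gamma> \<Longrightarrow> germ_class \<Delta> \<Longrightarrow> germ_class (\<lambda>c. \<Gamma> c \<inter> \<Delta> c)"
  using germ_class_subset germ_class_iso by (intro germ_classI) (blast, simp)

text \<open>The inverse \<open>k\<close> embeds the trace of the support near \<open>h x\<close>
  into that near \<open>x\<close>, and pulls points of any class back into the same class. This
  comparison is what makes the neighbourhood conditions below invariant.\<close>

lemma local_iso_traces:
  assumes iso: "local_iso c c' V V' h k" and x: "x \<in> cl (supp c)" "x \<in> V" and U: "openin X U" "x \<in> U"
  shows "\<exists>U'. openin X U' \<and> h x \<in> U' \<and> |U' \<inter> supp c'| \<le>o |U \<inter> supp c| \<and>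
    (\<forall>\<Gamma>. germ_class \<Gamma> \<longrightarrow> U' \<inter> \<Gamma> c' \<noteq> {} \<longrightarrow> U \<inter> \<Gamma> c \<noteq> {})"
proof -
  obtain U' where U': "openin X U'" "h x \<in> U'" "U' \<subseteq> V'" "\<And>y. y \<in> U' \<Longrightarrow> y \<in> cl (supp c') \<Longrightarrow> k y \<in> U"
    using local_iso_nbhd[OF iso x U] by blast
  note D = local_isoD[OF local_iso_sym[OF iso]]
  have "k ` (U' \<inter> supp c') \<subseteq> U \<inter> supp c"
  proof
    fix z assume "z \<in> k ` (U' \<inter> supp c')"
    then obtain y where y: "z = k y" "y \<in> U'" "y \<in> supp c'" by blast
    then have "y \<in> cl (supp c')" using supp_in_cl by blast
    then show "z \<in> U \<inter> supp c" using y U' D(4)[of y] by (auto simp: supp_def)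
  qed
  moreover have "inj_on k (U' \<inter> supp c')"
  proof (rule inj_onI)
    fix y z assume yz: "y \<in> U' \<inter> supp c'" "z \<in> U' \<inter> supp c'" "k y = k z"
    then have "h (k y) = y" "h (k z) = z" using D(3) U'(3) supp_in_cl[of c'] by blast+
    then show "y = z" using yz(3) by metis
  qed
  ultimately have "|U' \<inter> supp c'| \<le>o |U \<inter> supp c|" by (intro card_of_ordLeq[THEN iffD1] exI[of _ k] conjI)
  moreover have "U \<inter> \<Gamma> c \<noteq> {}" if \<Gamma>: "germ_class \<Gamma>" and ne: "U' \<inter> \<Gamma> c' \<noteq> {}" for \<Gamma>
  proof -
    obtain y where y: "y \<in> U'" "y \<in> \<Gamma> c'" using ne by blast
    then have "k y \<in> U" using U'(4) germ_class_subset[OF \<Gamma>] by blast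
    moreover have "k y \<in> \<Gamma> c" using germ_class_iso[OF \<Gamma> local_iso_sym[OF iso]] y U'(3) by blast
    ultimately show ?thesis by blast
  qed
  ultimately show ?thesis using U'(1,2) by (intro exI[of _ U'] conjI allI impI)
qed

lemma local_iso_traces':
  assumes iso: "local_iso c c' V V' h k" and x: "x \<in> cl (supp c)" "x \<in> V" and U': "openin X U'" "h x \<in> U'"
  shows "\<exists>U. openin X U \<and> x \<in> U \<and> |U \<inter> supp c| \<le>o |U' \<inter> supp c'| \<and>
    (\<forall>\<Gamma>. germ_class \<Gamma> \<longrightarrow> U \<inter> \<Gamma> c \<noteq> {} \<longrightarrow> U' \<inter> \<Gamma> c' \<noteq> {})"
  using local_iso_traces[OF local_iso_sym[OF iso] local_isoD(1,2)[OF iso x] U'] local_isoD(3)[OF iso x] by simp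

lemma germ_class_closure:
  assumes \<Gamma>: "germ_class \<Gamma>"
  shows "germ_class (\<lambda>c. cl (\<Gamma> c))"
proof (rule germ_classI)
  show "cl (\<Gamma> c) \<subseteq> cl (supp c)" for c
    using germ_class_subset[OF \<Gamma>] by (simp add: closure_of_minimal)
  fix c c' V V' h k x
  assume iso: "local_iso c c' V V' h k" and x: "x \<in> cl (supp c)" "x \<in> V" "x \<in> cl (\<Gamma> c)"
  show "h x \<in> cl (\<Gamma> c')"
    unfolding in_closure_of
  proof (intro conjI allI impI)
    show "h x \<in> topspace X" using local_isoD(1)[OF iso x(1,2)] cl_subset by blast
    fix U' assume "h x \<in> U' \<and> openin X U'"
    then have "openin X U'" "h x \<in> U'" by simp_all
    from local_iso_traces'[OF iso x(1,2) this] obtain U where U: "openin X U" "x \<in> U"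
      "\<forall>\<Gamma>. germ_class \<Gamma> \<longrightarrow> U \<inter> \<Gamma> c \<noteq> {} \<longrightarrow> U' \<inter> \<Gamma> c' \<noteq> {}"
      by (elim exE conjE)
    have "U \<inter> \<Gamma> c \<noteq> {}" using x(3) U(1,2) unfolding in_closure_of by blast
    then have "U' \<inter> \<Gamma> c' \<noteq> {}" using U(3) \<Gamma> by simp
    then show "\<exists>y. y \<in> \<Gamma> c' \<and> y \<in> U'" by blast
  qed
qed

lemma germ_class_size: "germ_class (\<lambda>c. {x \<in> cl (supp c). \<exists>U. openin X U \<and> x \<in> U \<and> |U \<inter> supp c| \<le>o r})"
proof (rule germ_classI)
  fix c c' V V' h k x
  assume iso: "local_iso c c' V V' h k" and x: "x \<in> cl (supp c)" "x \<in> V"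
    "x \<in> {x \<in> cl (supp c). \<exists>U. openin X U \<and> x \<in> U \<and> |U \<inter> supp c| \<le>o r}"
  then obtain U where U: "openin X U" "x \<in> U" "|U \<inter> supp c| \<le>o r" by blast
  from local_iso_traces[OF iso x(1,2) U(1,2)]
  obtain U' where "openin X U'" "h x \<in> U'" "|U' \<inter> supp c'| \<le>o |U \<inter> supp c|"
    by (elim exE conjE)
  then show "h x \<in> {x \<in> cl (supp c'). \<exists>U. openin X U \<and> x \<in> U \<and> |U \<inter> supp c'| \<le>o r}"
    using local_isoD(1)[OF iso x(1,2)] U(3) ordLeq_transitive by blast
qed blast

text \<open>Neighbourhoods of \<open>h x\<close> and of \<open>x\<close> are compared only by
  inclusion of the sets of classes they meet. So a property required of all neighbourhoods has to
  pass to larger index sets, and one required of some neighbourhood, as in the next lemma, to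
  smaller ones.\<close>

lemma germ_class_all_nbhds:
  assumes \<Gamma>: "\<And>i. i \<in> I \<Longrightarrow> germ_class (\<Gamma> i)" and Q: "\<And>A B. A \<subseteq> B \<Longrightarrow> B \<subseteq> I \<Longrightarrow> Q A \<Longrightarrow> Q B"
  shows "germ_class (\<lambda>c. {x \<in> cl (supp c). \<forall>U. openin X U \<and> x \<in> U \<longrightarrow> Q {i \<in> I. U \<inter> \<Gamma> i c \<noteq> {}}})"
proof (rule germ_classI)
  fix c c' V V' h k x
  assume iso: "local_iso c c' V V' h k" and x: "x \<in> cl (supp c)" "x \<in> V"
    "x \<in> {x \<in> cl (supp c). \<forall>U. openin X U \<and> x \<in> U \<longrightarrow> Q {i \<in> I. U \<inter> \<Gamma> i c \<noteq> {}}}"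
  have "Q {i \<in> I. U' \<inter> \<Gamma> i c' \<noteq> {}}" if U': "openin X U'" "h x \<in> U'" for U'
  proof -
    from local_iso_traces'[OF iso x(1,2) U']
    obtain U where U: "openin X U" "x \<in> U"
      "\<forall>\<Gamma>. germ_class \<Gamma> \<longrightarrow> U \<inter> \<Gamma> c \<noteq> {} \<longrightarrow> U' \<inter> \<Gamma> c' \<noteq> {}"
      by (elim exE conjE)
    have QU: "Q {i \<in> I. U \<inter> \<Gamma> i c \<noteq> {}}" using x(3) U(1,2) by simp
    have sub: "{i \<in> I. U \<inter> \<Gamma> i c \<noteq> {}} \<subseteq> {i \<in> I. U' \<inter> \<Gamma> i c' \<noteq> {}}"
      using U(3)[rule_format, OF \<Gamma>] by blast
    show ?thesis by (rule Q[OF sub _ QU]) auto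
  qed
  then show "h x \<in> {x \<in> cl (supp c'). \<forall>U. openin X U \<and> x \<in> U \<longrightarrow> Q {i \<in> I. U \<inter> \<Gamma> i c' \<noteq> {}}}"
    using local_isoD(1)[OF iso x(1,2)] by blast
qed blast

lemma germ_class_some_nbhd:
  assumes \<Gamma>: "\<And>i. i \<in> I \<Longrightarrow> germ_class (\<Gamma> i)" and Q: "\<And>A B. A \<subseteq> B \<Longrightarrow> B \<subseteq> I \<Longrightarrow> Q B \<Longrightarrow> Q A"
  shows "germ_class (\<lambda>c. {x \<in> cl (supp c). \<exists>U. openin X U \<and> x \<in> U \<and> Q {i \<in> I. U \<inter> \<Gamma> i c \<noteq> {}}})"
proof (rule germ_classI)
  fix c c' V V' h k x
  assume iso: "local_iso c c' V V' h k" and x: "x \<in> cl (supp c)" "x \<in> V"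
    "x \<in> {x \<in> cl (supp c). \<exists>U. openin X U \<and> x \<in> U \<and> Q {i \<in> I. U \<inter> \<Gamma> i c \<noteq> {}}}"
  then obtain U where U: "openin X U" "x \<in> U" "Q {i \<in> I. U \<inter> \<Gamma> i c \<noteq> {}}" by blast
  from local_iso_traces[OF iso x(1,2) U(1,2)]
  obtain U' where U': "openin X U'" "h x \<in> U'"
    "\<forall>\<Gamma>. germ_class \<Gamma> \<longrightarrow> U' \<inter> \<Gamma> c' \<noteq> {} \<longrightarrow> U \<inter> \<Gamma> c \<noteq> {}"
    by (elim exE conjE)
  have "{i \<in> I. U' \<inter> \<Gamma> i c' \<noteq> {}} \<subseteq> {i \<in> I. U \<inter> \<Gamma> i c \<noteq> {}}"
    using U'(3)[rule_format, OF \<Gamma>] by blast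
  then have "Q {i \<in> I. U' \<inter> \<Gamma> i c' \<noteq> {}}" by (rule Q[OF _ _ U(3)]) auto
  then show "h x \<in> {x \<in> cl (supp c'). \<exists>U. openin X U \<and> x \<in> U \<and> Q {i \<in> I. U \<inter> \<Gamma> i c' \<noteq> {}}}"
    using local_isoD(1)[OF iso x(1,2)] U' by blast
qed blast

lemma germ_class_val:
  assumes "n \<noteq> 0"
  shows "germ_class (\<lambda>c. {x. val c x = n})"
proof (rule germ_classI)
  show "{x. val c x = n} \<subseteq> cl (supp c)" for c
    using assms supp_in_cl[of c] by (auto simp: supp_def)
qed (simp add: local_isoD(4))

section \<open>Invariant ideals and positive points\<close>

definition similar :: "'a set \<Rightarrow> 'a set \<Rightarrow> bool" where
  "similar S S' \<longleftrightarrow> (\<exists>h k. homeomorphic_maps (subtopology X (cl S)) (subtopology X (cl S')) h k \<and> h ` S = S')"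

definition invariant_ideal :: "'a set set \<Rightarrow> bool" where
  "invariant_ideal \<I> \<longleftrightarrow> set_ideal \<I> \<and> \<I> \<subseteq> Pow G \<and> G \<notin> \<I> \<and>
     (\<forall>S\<in>\<I>. \<forall>S'. S' \<subseteq> G \<and> similar S S' \<longrightarrow> S' \<in> \<I>)"

lemma invariant_idealD:
  assumes "invariant_ideal \<I>"
  shows "set_ideal \<I>" "\<I> \<subseteq> Pow G" "G \<notin> \<I>" "S \<in> \<I> \<Longrightarrow> S' \<subseteq> G \<Longrightarrow> similar S S' \<Longrightarrow> S' \<in> \<I>"
  using assms unfolding invariant_ideal_def by blast+

text \<open>Zorn's lemma, with \<open>{{}}\<close> as an initial ideal. Properness survives unions
  of chains because it only says that \<open>G\<close> is not a member.\<close>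

lemma maximal_invariant_ideal:
  "\<exists>\<I>. invariant_ideal \<I> \<and> (\<forall>\<J>. invariant_ideal \<J> \<and> \<I> \<subseteq> \<J> \<longrightarrow> \<J> = \<I>)"
proof -
  have "invariant_ideal {{}}"
    using G_nonempty by (auto simp: invariant_ideal_def set_ideal_def similar_def)
  moreover have "invariant_ideal (\<Union>\<C>)"
    if C: "\<C> \<noteq> {}" "subset.chain {\<J>. invariant_ideal \<J>} \<C>" for \<C>
  proof -
    have inv: "invariant_ideal \<J>" if "\<J> \<in> \<C>" for \<J> using C(2) that by (auto simp: subset.chain_def)
    note D = invariant_idealD[OF inv]
    have "set_ideal (\<Union>\<C>)"
      unfolding set_ideal_def
    proof (intro conjI ballI allI impI)
      obtain \<J> where J: "\<J> \<in> \<C>" using C(1) by blast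
      show "{} \<in> \<Union>\<C>" by (rule UnionI[OF J set_ideal_empty[OF D(1)[OF J]]])
    next
      fix S T assume "S \<in> \<Union>\<C>" and T: "T \<subseteq> S"
      then obtain \<J> where J: "\<J> \<in> \<C>" "S \<in> \<J>" by blast
      show "T \<in> \<Union>\<C>" by (rule UnionI[OF J(1) set_ideal_mono[OF D(1)[OF J(1)] J(2) T]])
    next
      fix S T assume "S \<in> \<Union>\<C>" "T \<in> \<Union>\<C>"
      then obtain \<J> \<K> where JK: "S \<in> \<J>" "T \<in> \<K>" "\<J> \<in> \<C>" "\<K> \<in> \<C>" by blast
      then have "\<J> \<subseteq> \<K> \<or> \<K> \<subseteq> \<J>" using C(2) unfolding subset.chain_def by blast
      then obtain \<L> where L: "S \<in> \<L>" "T \<in> \<L>" "\<L> \<in> \<C>" using JK by blast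
      show "S \<union> T \<in> \<Union>\<C>" by (rule UnionI[OF L(3) set_ideal_Un[OF D(1)[OF L(3)] L(1,2)]])
    qed
    moreover have "\<Union>\<C> \<subseteq> Pow G" "G \<notin> \<Union>\<C>" using D(2,3) by blast+
    moreover have "S' \<in> \<Union>\<C>" if S: "S \<in> \<Union>\<C>" "S' \<subseteq> G" "similar S S'" for S S'
    proof -
      obtain \<J> where J: "\<J> \<in> \<C>" "S \<in> \<J>" using S(1) by blast
      show ?thesis by (rule UnionI[OF J(1) D(4)[OF J S(2,3)]])
    qed
    ultimately show ?thesis unfolding invariant_ideal_def by blast
  qed
  ultimately obtain \<I> where "\<I> \<in> {\<J>. invariant_ideal \<J>}" "\<forall>\<J>\<in>{\<J>. invariant_ideal \<J>}. \<I> \<subseteq> \<J> \<longrightarrow> \<J> = \<I>"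
    using subset_Zorn_nonempty[of "{\<J>. invariant_ideal \<J>}"] by (metis empty_iff mem_Collect_eq)
  then show ?thesis by blast
qed

text \<open>The closed support of \<open>T\<close> modulo the ideal: the points at which
  \<open>T\<close> is not locally negligible.\<close>

definition positive_points :: "'a set set \<Rightarrow> 'a set \<Rightarrow> 'a set" where
  "positive_points \<I> T = {x \<in> topspace X. \<forall>U. openin X U \<and> x \<in> U \<longrightarrow> U \<inter> T \<notin> \<I>}"

lemma positive_points_subset:
  assumes "set_ideal \<I>"
  shows "positive_points \<I> T \<subseteq> cl T"
proof
  fix x assume x: "x \<in> positive_points \<I> T"
  have "U \<inter> T \<noteq> {}" if "openin X U" "x \<in> U" for U
    using x that set_ideal_empty[OF assms] unfolding positive_points_def by auto
  then show "x \<in> cl T" using x unfolding in_closure_of positive_points_def by blast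
qed

lemma positive_points_Un:
  assumes "set_ideal \<I>"
  shows "positive_points \<I> (S \<union> T) = positive_points \<I> S \<union> positive_points \<I> T"
proof
  have "x \<in> positive_points \<I> S \<union> positive_points \<I> T" if x: "x \<in> positive_points \<I> (S \<union> T)" for x
  proof (rule ccontr)
    assume "\<not> ?thesis"
    then obtain U V where UV: "openin X U" "x \<in> U" "U \<inter> S \<in> \<I>" "openin X V" "x \<in> V" "V \<inter> T \<in> \<I>"
      using x unfolding positive_points_def by blast
    have "(U \<inter> S) \<union> (V \<inter> T) \<in> \<I>" by (rule set_ideal_Un[OF assms UV(3,6)])
    moreover have "(U \<inter> V) \<inter> (S \<union> T) \<subseteq> (U \<inter> S) \<union> (V \<inter> T)" by blast
    ultimately have "(U \<inter> V) \<inter> (S \<union> T) \<in> \<I>" by (rule set_ideal_mono[OF assms])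
    moreover have "openin X (U \<inter> V)" "x \<in> U \<inter> V" using UV by blast+
    ultimately show False using x unfolding positive_points_def by blast
  qed
  then show "positive_points \<I> (S \<union> T) \<subseteq> positive_points \<I> S \<union> positive_points \<I> T" by blast
  have mono: "U \<inter> S \<in> \<I>" if "U \<inter> T \<in> \<I>" "S \<subseteq> T" for U S T
    by (rule set_ideal_mono[OF assms that(1)]) (use that(2) in blast)
  show "positive_points \<I> S \<union> positive_points \<I> T \<subseteq> positive_points \<I> (S \<union> T)"
    unfolding positive_points_def using mono[of _ "S \<union> T" S] mono[of _ "S \<union> T" T] by blast
qed

text \<open>Otherwise every point has a neighbourhood with trace in the ideal; by compactness
  finitely many of these cover \<open>T\<close>, which would put \<open>T\<close> into the
  ideal.\<close>

lemma positive_points_nonempty: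
  assumes I: "set_ideal \<I>" and T: "T \<subseteq> topspace X" "T \<notin> \<I>"
  shows "positive_points \<I> T \<noteq> {}"
proof
  assume "positive_points \<I> T = {}"
  let ?U = "{U. openin X U \<and> U \<inter> T \<in> \<I>}"
  have "topspace X \<subseteq> \<Union>?U" using \<open>positive_points \<I> T = {}\<close> by (auto simp: positive_points_def)
  moreover have "compactin X (topspace X)" using compact by (simp add: compact_space_def)
  ultimately have "\<exists>\<F>. finite \<F> \<and> \<F> \<subseteq> ?U \<and> topspace X \<subseteq> \<Union>\<F>"
    by (intro compactinD[where \<U> = ?U]) auto
  then obtain \<F> where F: "finite \<F>" "\<F> \<subseteq> ?U" "topspace X \<subseteq> \<Union>\<F>" by (elim exE conjE)
  have "\<Union>((\<lambda>U. U \<inter> T) ` \<F>) \<in> \<I>" using F(1,2) by (intro set_ideal_Union[OF I]) auto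
  moreover have "T \<subseteq> \<Union>((\<lambda>U. U \<inter> T) ` \<F>)" using F(3) T(1) by blast
  ultimately have "T \<in> \<I>" by (rule set_ideal_mono[OF I])
  then show False using T(2) by blast
qed

text \<open>Invariance of the ideal speaks of homeomorphisms between full closures, while a local
  isomorphism lives on an open part only. So the trace at \<open>x\<close> is shrunk by regularity
  to a set \<open>A\<close> whose closure lies inside the domain. The image of this compact closure
  is closed and therefore equals the closure of the image, so \<open>A\<close> is similar to a
  subset of the trace at \<open>h x\<close>.\<close>

lemma positive_points_local_iso:
  assumes I: "invariant_ideal \<I>" and iso: "local_iso c c' V V' h k"
    and x: "x \<in> positive_points \<I> (supp c)" "x \<in> V"
  shows "h x \<in> positive_points \<I> (supp c')"
proof -
  have si: "set_ideal \<I>" using I by (simp add: invariant_ideal_def)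
  have xc: "x \<in> cl (supp c)" using x(1) positive_points_subset[OF si] by blast
  note hx = local_isoD[OF iso xc x(2)]
  have "U' \<inter> supp c' \<notin> \<I>" if U': "openin X U'" "h x \<in> U'" for U'
  proof
    assume U'I: "U' \<inter> supp c' \<in> \<I>"
    obtain U where U: "openin X U" "k (h x) \<in> U" "U \<subseteq> V" "\<And>y. y \<in> U \<Longrightarrow> y \<in> cl (supp c) \<Longrightarrow> h y \<in> U'"
      using local_iso_nbhd[OF local_iso_sym[OF iso] hx(1,2) U'] by blast
    have "x \<in> U" using U(2) hx(3) by simp
    then obtain W where W: "openin X W" "x \<in> W" "cl W \<subseteq> U" using regular[OF U(1)] by blast
    define A where "A = W \<inter> supp c"
    have A: "A \<notin> \<I>" using x(1) W(1,2) unfolding positive_points_def A_def by blast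
    have AX: "A \<subseteq> topspace X" using supp_subset by (auto simp: A_def)
    have clA: "cl A \<subseteq> cl (supp c) \<inter> V"
      using closure_of_mono[of A "supp c" X] closure_of_mono[of A W X] W(3) U(3) unfolding A_def by blast
    have AclA: "A \<subseteq> cl A" using AX by (rule closure_of_subset)
    have hA: "h ` A \<subseteq> U' \<inter> supp c'"
    proof
      fix y assume "y \<in> h ` A"
      then obtain s where s: "s \<in> A" "y = h s" by blast
      then have "s \<in> cl (supp c)" "s \<in> V" using clA AclA by blast+
      moreover have "s \<in> U" using s W(3) closure_of_subset[of W X] openin_subset[OF W(1)] unfolding A_def by blast
      ultimately show "y \<in> U' \<inter> supp c'"
        using s U(4)[of s] local_isoD(4)[OF iso, of s] by (simp add: A_def supp_def)
    qed
    then have hAI: "h ` A \<in> \<I>" by (rule set_ideal_mono[OF si U'I])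
    have hm: "homeomorphic_maps (subtopology X (cl A)) (subtopology X (h ` cl A)) h k"
    proof -
      have hm0: "homeomorphic_maps (subtopology X (cl (supp c) \<inter> V)) (subtopology X (cl (supp c') \<inter> V')) h k"
        using iso by (simp add: local_iso_def)
      have "h ` cl A \<subseteq> cl (supp c') \<inter> V'" using local_isoD(1,2)[OF iso] clA by blast
      then have "h ` (topspace (subtopology X (cl (supp c) \<inter> V)) \<inter> cl A) = topspace (subtopology X (cl (supp c') \<inter> V')) \<inter> h ` cl A"
        using clA unfolding topspace_cl_Int by (metis Int_absorb1)
      then have "homeomorphic_maps (subtopology (subtopology X (cl (supp c) \<inter> V)) (cl A))
          (subtopology (subtopology X (cl (supp c') \<inter> V')) (h ` cl A)) h k"
        by (rule homeomorphic_maps_subtopologies[OF hm0])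
      then show ?thesis
        using clA \<open>h ` cl A \<subseteq> cl (supp c') \<inter> V'\<close> by (simp add: subtopology_subtopology Int_absorb1)
    qed
    have "compactin X (h ` cl A)"
    proof -
      have "compactin (subtopology X (cl A)) (cl A)"
        using compact closedin_compact_space[of X "cl A"] by (simp add: compactin_subtopology)
      moreover have "continuous_map (subtopology X (cl A)) X h"
        using hm by (auto simp: homeomorphic_maps_def continuous_map_in_subtopology)
      ultimately show ?thesis by (rule image_compactin)
    qed
    then have cls: "closedin X (h ` cl A)" by (rule compactin_imp_closedin[OF Hausdorff])
    have "cl (h ` A) = h ` cl A"
    proof
      show "cl (h ` A) \<subseteq> h ` cl A" by (rule closure_of_minimal[OF image_mono[OF AclA] cls])
      have "continuous_map (subtopology X (cl A)) X h"
        using hm by (auto simp: homeomorphic_maps_def continuous_map_in_subtopology)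
      then have "h ` (subtopology X (cl A) closure_of A) \<subseteq> cl (h ` A)"
        by (rule continuous_map_image_closure_subset)
      then show "h ` cl A \<subseteq> cl (h ` A)" using AclA by (simp add: closure_of_subtopology Int_absorb1)
    qed
    then have "homeomorphic_maps (subtopology X (cl (h ` A))) (subtopology X (cl A)) k h"
      using homeomorphic_maps_sym[THEN iffD1, OF hm] by simp
    moreover have "k ` h ` A = A"
    proof -
      have "k (h s) = s" if "s \<in> A" for s using local_isoD(3)[OF iso, of s] that clA AclA by blast
      then show ?thesis by (simp add: image_image)
    qed
    ultimately have "similar (h ` A) A" unfolding similar_def by blast
    moreover have "A \<subseteq> G" using supp_subset by (auto simp: A_def)
    ultimately show False using invariant_idealD(4)[OF I hAI] A by blast
  qed
  moreover have "h x \<in> topspace X" using hx(1) cl_subset by blast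
  ultimately show ?thesis unfolding positive_points_def by blast
qed

end

lemma not_card_leq_iff: "\<not> |A| \<le>o |B| \<longleftrightarrow> |B| <o |A|"
  by (rule not_ordLeq_iff_ordLess[OF card_of_Well_order card_of_Well_order])

lemma card_of_Un_less: "infinite Z \<Longrightarrow> |A| <o |Z| \<Longrightarrow> |B| <o |Z| \<Longrightarrow> |A \<union> B| <o |Z|"
  by (rule card_of_Un_ordLess_infinite)

lemma card_of_Un_geq: "infinite Z \<Longrightarrow> |Z| \<le>o |A \<union> B| \<Longrightarrow> |Z| \<le>o |A| \<or> |Z| \<le>o |B|"
  using card_of_Un_less[of Z A B] not_card_leq_iff[of Z A] not_card_leq_iff[of Z B]
    not_card_leq_iff[of Z "A \<union> B"] by blast

section \<open>Discrete sets of positive points\<close>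

text \<open>Maximality makes the ideal insensitive to location: what the positive points of \<open>G\<close> contain, in
  cardinality, those of every set outside the ideal contain as well.\<close>

locale maximal_ideal = recolourable +
  fixes \<I> :: "'a set set"
  assumes ideal: "invariant_ideal \<I>"
    and maximal: "invariant_ideal \<J> \<Longrightarrow> \<I> \<subseteq> \<J> \<Longrightarrow> \<J> = \<I>"
begin

lemmas set_ideal = invariant_idealD(1)[OF ideal]

abbreviation "\<E> \<equiv> positive_points \<I>"

lemma posI: "T \<notin> \<I> \<Longrightarrow> T \<subseteq> S \<Longrightarrow> S \<notin> \<I>"
  using set_ideal_mono[OF set_ideal] by blast

lemma \<E>_mono: "S \<subseteq> T \<Longrightarrow> \<E> S \<subseteq> \<E> T"
  using positive_points_Un[OF set_ideal, of S T] Un_absorb1[of S T] by auto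

text \<open>Discrete in the relative topology and not necessarily closed, so that it may be infinite
  although the space is compact.\<close>

definition discrete :: "'a set \<Rightarrow> bool" where
  "discrete D \<longleftrightarrow> (\<forall>x\<in>D. \<exists>U. openin X U \<and> x \<in> U \<and> D \<inter> U \<subseteq> {x})"

lemma discrete_subset: "discrete D \<Longrightarrow> D' \<subseteq> D \<Longrightarrow> discrete D'"
  unfolding discrete_def
proof
  fix x assume D: "\<forall>x\<in>D. \<exists>U. openin X U \<and> x \<in> U \<and> D \<inter> U \<subseteq> {x}" "D' \<subseteq> D" "x \<in> D'"
  then obtain U where U: "openin X U" "x \<in> U" "D \<inter> U \<subseteq> {x}" by (meson subsetD)
  moreover have "D' \<inter> U \<subseteq> {x}" using U(3) D(2) by blast
  ultimately show "\<exists>U. openin X U \<and> x \<in> U \<and> D' \<inter> U \<subseteq> {x}" by (intro exI[of _ U] conjI)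
qed

definition has_discrete :: "'a set \<Rightarrow> 'z set \<Rightarrow> bool" where
  "has_discrete T Z \<longleftrightarrow> (\<exists>D. D \<subseteq> \<E> T \<and> discrete D \<and> |Z| \<le>o |D| )"

text \<open>The indicator functions of \<open>S\<close> and \<open>S'\<close>, read as colourings,
  turn similarity into a local isomorphism on the whole space, and
  \<open>positive_points_local_iso\<close> carries the positive points over.\<close>

lemma has_discrete_similar:
  assumes sim: "similar S S'" and S: "S \<subseteq> G" "S' \<subseteq> G" and d: "has_discrete S' Z"
  shows "has_discrete S Z"
proof -
  obtain h k where hk: "homeomorphic_maps (subtopology X (cl S)) (subtopology X (cl S')) h k" "h ` S = S'"
    using sim unfolding similar_def by blast
  obtain D where D: "D \<subseteq> \<E> S'" "discrete D" "|Z| \<le>o |D|" using d unfolding has_discrete_def by blast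
  define i where "i S x = (if x \<in> S then 1 else 0 :: nat)" for S :: "'a set" and x
  have val: "val (i S) x = i S x" if "S \<subseteq> G" for S x using that by (auto simp: val_def i_def)
  have supp: "supp (i S) = S" if "S \<subseteq> G" for S using val[OF that] by (auto simp: supp_def i_def)
  have inv: "k (h x) = x" if "x \<in> cl S" for x
    using hk(1) that cl_subset[of S] unfolding homeomorphic_maps_def by auto
  have ScS: "S \<subseteq> cl S" using S(1) G_subset by (simp add: closure_of_subset)
  have "local_iso (i S) (i S') (topspace X) (topspace X) h k"
    unfolding local_iso_def supp[OF S(1)] supp[OF S(2)]
  proof (intro conjI ballI)
    show "homeomorphic_maps (subtopology X (cl S \<inter> topspace X)) (subtopology X (cl S' \<inter> topspace X)) h k"
      using hk(1) by (simp add: Int_absorb2 cl_subset)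
    fix x assume x: "x \<in> cl S \<inter> topspace X"
    have "h x \<in> S' \<longleftrightarrow> x \<in> S"
    proof
      assume "h x \<in> S'"
      then obtain s where s: "s \<in> S" "h x = h s" using hk(2) by blast
      then have "k (h x) = k (h s)" by simp
      then show "x \<in> S" using inv[of x] inv[of s] x s ScS by auto
    qed (use hk(2) in blast)
    then show "val (i S') (h x) = val (i S) x" by (simp add: val S i_def)
  qed simp_all
  then have iso: "local_iso (i S') (i S) (topspace X) (topspace X) k h" by (rule local_iso_sym)
  have Dcl: "D \<subseteq> cl S'" using D(1) positive_points_subset[OF set_ideal] by blast
  then have DX: "D \<subseteq> topspace X" using cl_subset by blast
  note I = local_isoD[OF iso, unfolded supp[OF S(2)] supp[OF S(1)]]
  have kE: "k ` D \<subseteq> \<E> S"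
    using positive_points_local_iso[OF ideal iso] D(1) DX unfolding supp[OF S(1)] supp[OF S(2)] by blast
  have hk': "h (k d) = d" if "d \<in> D" for d using I(3) that Dcl DX by blast
  have "inj_on k D" using hk' by (metis inj_onI)
  then have "|D| \<le>o |k ` D|" by (intro card_of_ordLeq[THEN iffD1] exI[of _ k]) simp
  moreover have "discrete (k ` D)"
    unfolding discrete_def
  proof
    fix y assume "y \<in> k ` D"
    then obtain d where d: "d \<in> D" "y = k d" by blast
    then obtain U where U: "openin X U" "d \<in> U" "D \<inter> U \<subseteq> {d}" using D(2) unfolding discrete_def by blast
    have dd: "d \<in> cl (supp (i S'))" "d \<in> topspace X" using d Dcl DX supp[OF S(2)] by auto
    have "\<exists>U'. openin X U' \<and> k d \<in> U' \<and> (\<forall>y\<in>U'. y \<in> cl S \<longrightarrow> h y \<in> U)"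
      by (rule local_iso_nbhd[OF iso dd U(1,2)]) (use supp[OF S(1)] in metis)
    then obtain U' where U': "openin X U'" "k d \<in> U'" "\<forall>y\<in>U'. y \<in> cl S \<longrightarrow> h y \<in> U"
      by (elim exE conjE)
    have "k ` D \<inter> U' \<subseteq> {y}"
    proof
      fix u assume "u \<in> k ` D \<inter> U'"
      then obtain e where e: "e \<in> D" "u = k e" "u \<in> U'" by blast
      then have "u \<in> cl S" using I(1)[of e] Dcl DX by blast
      then have "h u \<in> U" using U'(3) e by simp
      then have "e \<in> U" using hk'[OF e(1)] e(2) by simp
      then show "u \<in> {y}" using U(3) e d by blast
    qed
    then show "\<exists>U. openin X U \<and> y \<in> U \<and> k ` D \<inter> U \<subseteq> {y}" using U'(1,2) d by blast
  qed
  ultimately show ?thesis using kE D(3) ordLeq_transitive unfolding has_discrete_def by blast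
qed

text \<open>The subsets of \<open>G\<close> without a discrete set of size \<open>Z\<close> form a
  proper invariant ideal: a positive point of a union is positive for one of the two parts, and an
  infinite cardinal is not the sum of two smaller ones. Members of \<open>\<I>\<close> have no
  positive points at all, so the new ideal contains \<open>\<I>\<close> and equals it by
  maximality.\<close>

lemma has_discrete_positive:
  assumes Z: "infinite Z" "has_discrete G Z" and T: "T \<subseteq> G" "T \<notin> \<I>"
  shows "has_discrete T Z"
proof (rule ccontr)
  assume neg: "\<not> has_discrete T Z"
  define \<J> where "\<J> = {S. S \<subseteq> G \<and> \<not> has_discrete S Z}"
  have empty: "\<not> has_discrete S Z" if "\<E> S = {}" for S
  proof
    assume "has_discrete S Z"
    then have "|Z| \<le>o |{} :: 'a set|" using that unfolding has_discrete_def by auto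
    then show False using card_of_ordLeq_infinite Z(1) by blast
  qed
  have "invariant_ideal \<J>"
    unfolding invariant_ideal_def set_ideal_def
  proof (intro conjI ballI allI impI)
    have "\<E> {} = {}" using positive_points_subset[OF set_ideal, of "{}"] by simp
    then show "{} \<in> \<J>" using empty by (simp add: \<J>_def)
  next
    fix S S' assume S: "S \<in> \<J>" "S' \<subseteq> S"
    have "has_discrete S Z" if "has_discrete S' Z"
      using that \<E>_mono[OF S(2)] unfolding has_discrete_def by blast
    then show "S' \<in> \<J>" using S by (auto simp: \<J>_def)
  next
    fix S S' assume S: "S \<in> \<J>" "S' \<in> \<J>"
    have "\<not> has_discrete (S \<union> S') Z"
    proof
      assume "has_discrete (S \<union> S') Z"
      then obtain D where D: "D \<subseteq> \<E> S \<union> \<E> S'" "discrete D" "|Z| \<le>o |D|"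
        unfolding has_discrete_def positive_points_Un[OF set_ideal] by blast
      have "D = (D \<inter> \<E> S) \<union> (D \<inter> \<E> S')" using D(1) by blast
      then have "|Z| \<le>o |D \<inter> \<E> S| \<or> |Z| \<le>o |D \<inter> \<E> S'|" using card_of_Un_geq[OF Z(1)] D(3) by metis
      moreover have "discrete (D \<inter> \<E> S)" "discrete (D \<inter> \<E> S')" using discrete_subset[OF D(2)] by blast+
      ultimately have "has_discrete S Z \<or> has_discrete S' Z" unfolding has_discrete_def by blast
      then show False using S by (auto simp: \<J>_def)
    qed
    then show "S \<union> S' \<in> \<J>" using S by (auto simp: \<J>_def)
  next
    show "\<J> \<subseteq> Pow G" by (auto simp: \<J>_def)
    show "G \<notin> \<J>" using Z(2) by (simp add: \<J>_def)
  next
    fix S S' assume S: "S \<in> \<J>" "S' \<subseteq> G \<and> similar S S'"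
    then have "\<not> has_discrete S' Z" using has_discrete_similar[of S S' Z] by (auto simp: \<J>_def)
    then show "S' \<in> \<J>" using S by (simp add: \<J>_def)
  qed
  moreover have "\<I> \<subseteq> \<J>"
  proof
    fix S assume S: "S \<in> \<I>"
    then have SG: "S \<subseteq> G" using invariant_idealD(2)[OF ideal] by blast
    have "\<E> S = {}"
    proof (rule ccontr)
      assume "\<E> S \<noteq> {}"
      then obtain x where "x \<in> topspace X" "\<And>U. openin X U \<Longrightarrow> x \<in> U \<Longrightarrow> U \<inter> S \<notin> \<I>"
        unfolding positive_points_def by blast
      then have "topspace X \<inter> S \<notin> \<I>" by blast
      then show False using S SG G_subset by (metis Int_absorb1 subset_trans)
    qed
    then show "S \<in> \<J>" using empty SG by (simp add: \<J>_def)
  qed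
  ultimately have "\<J> = \<I>" by (rule maximal)
  moreover have "T \<in> \<J>" using T neg by (simp add: \<J>_def)
  ultimately show False using T by simp
qed

text \<open>A colouring that shows class \<open>i\<close> and no other class of the family is copied
  into an open set by \<open>recolour\<close>; the copy of a point of class \<open>i\<close> then
  has a neighbourhood in which \<open>g\<close> shows no other class. The points obtained for the
  various \<open>i\<close> are all judged by the single colouring \<open>g\<close>, so they are
  distinct and isolated from each other.\<close>

lemma has_discrete_of_classes:
  fixes A :: "'i set"
  assumes \<Gamma>: "\<And>i. i \<in> A \<Longrightarrow> germ_class (\<Gamma> i)"
    and c: "\<And>i. i \<in> A \<Longrightarrow> \<exists>c. \<Gamma> i c \<inter> \<E> G \<noteq> {} \<and> (\<forall>j\<in>A - {i}. \<Gamma> j c = {})"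
  shows "has_discrete G A"
proof -
  have "\<exists>y U. openin X U \<and> y \<in> U \<and> y \<in> \<Gamma> i g \<and> y \<in> \<E> G \<and> (\<forall>j\<in>A - {i}. U \<inter> \<Gamma> j g = {})" if i: "i \<in> A" for i
  proof -
    obtain c x where x: "x \<in> \<Gamma> i c" "x \<in> \<E> G" and e: "\<And>j. j \<in> A - {i} \<Longrightarrow> \<Gamma> j c = {}" using c[OF i] by blast
    obtain U h k where U: "openin X U"
      and hm: "homeomorphic_maps (subtopology X (cl G)) (subtopology X (cl G \<inter> U)) h k"
      and hG: "\<And>x. x \<in> cl G \<Longrightarrow> h x \<in> G \<longleftrightarrow> x \<in> G" and hg: "\<And>s. s \<in> G \<Longrightarrow> g (h s) = c s"
      using recolour[of c] by blast
    \<comment> \<open>Shifting all colours by one makes the support equal to \<open>G\<close>. So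
      the closure of \<open>G\<close> becomes the domain of the isomorphism and positivity with
      respect to \<open>G\<close> is preserved; \<open>f\<close> then undoes the shift.\<close>
    have suppG: "supp (Suc \<circ> c) = G" for c by (auto simp: supp_def val_def)
    have iso1: "local_iso (Suc \<circ> c) (Suc \<circ> g) (topspace X) U h k"
      unfolding local_iso_def suppG
    proof (intro conjI ballI)
      show "homeomorphic_maps (subtopology X (cl G \<inter> topspace X)) (subtopology X (cl G \<inter> U)) h k"
        using hm by (simp add: Int_absorb2 cl_subset)
      show "val (Suc \<circ> g) (h x) = val (Suc \<circ> c) x" if "x \<in> cl G \<inter> topspace X" for x
        using that hG[of x] hg[of x] by (simp add: val_def)
    qed (use U in simp_all)
    define f :: "nat \<Rightarrow> nat" where "f n = n - 1" for n
    have f0: "f 0 = 0" by (simp add: f_def)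
    have fS: "f \<circ> (Suc \<circ> c) = c" for c :: "'a \<Rightarrow> nat" by (auto simp: f_def)
    have iso: "local_iso c g (topspace X) U h k"
      using local_iso_comp[where f = f, OF iso1 f0] unfolding fS .
    have xX: "x \<in> topspace X" using x(2) unfolding positive_points_def by blast
    have "x \<in> cl (supp c)" using x(1) germ_class_subset[OF \<Gamma>[OF i]] by blast
    then have "h x \<in> U" using local_isoD(2)[OF iso] xX by blast
    moreover have "h x \<in> \<Gamma> i g" by (rule germ_class_iso[OF \<Gamma>[OF i] iso xX x(1)])
    moreover have "h x \<in> \<E> G"
      using positive_points_local_iso[OF ideal iso1, unfolded suppG] x(2) xX by blast
    moreover have "U \<inter> \<Gamma> j g = {}" if j: "j \<in> A - {i}" for j
    proof (rule ccontr)
      assume "U \<inter> \<Gamma> j g \<noteq> {}"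
      then obtain y where "y \<in> U" "y \<in> \<Gamma> j g" by blast
      then have "k y \<in> \<Gamma> j c" using germ_class_iso[OF \<Gamma> local_iso_sym[OF iso]] j by blast
      then show False using e[OF j] by blast
    qed
    ultimately show ?thesis using U by blast
  qed
  then obtain y U where yU: "\<And>i. i \<in> A \<Longrightarrow> openin X (U i) \<and> y i \<in> U i \<and> y i \<in> \<Gamma> i g \<and> y i \<in> \<E> G \<and>
      (\<forall>j\<in>A - {i}. U i \<inter> \<Gamma> j g = {})" by metis
  have sep: "i = j" if "i \<in> A" "j \<in> A" "y j \<in> U i" for i j
    using yU[OF that(1)] yU[OF that(2)] that by blast
  have "inj_on y A"
  proof (rule inj_onI)
    fix i j assume "i \<in> A" "j \<in> A" "y i = y j"
    then show "i = j" using sep[of i j] yU[of i] by simp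
  qed
  then have "|A| \<le>o |y ` A|" by (intro card_of_ordLeq[THEN iffD1] exI[of _ y]) simp
  moreover have "discrete (y ` A)"
    unfolding discrete_def
  proof
    fix u assume "u \<in> y ` A"
    then obtain i where i: "i \<in> A" "u = y i" by blast
    have "y ` A \<inter> U i \<subseteq> {u}" using sep[OF i(1)] i(2) by blast
    then show "\<exists>U. openin X U \<and> u \<in> U \<and> y ` A \<inter> U \<subseteq> {u}" using yU[OF i(1)] i(2) by blast
  qed
  moreover have "y ` A \<subseteq> \<E> G" using yU by blast
  ultimately show ?thesis unfolding has_discrete_def by blast
qed

text \<open>Start of the recursion on sizes: class \<open>n\<close> is the closure of the set of
  points with colour \<open>Suc n\<close>, and a constant colouring shows only one of these
  classes.\<close>

lemma has_discrete_nat: "has_discrete G (UNIV :: nat set)"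
proof (rule has_discrete_of_classes[where \<Gamma> = "\<lambda>n c. cl {x. val c x = Suc n}"])
  show "germ_class (\<lambda>c. cl {x. val c x = Suc n})" for n
    by (rule germ_class_closure[OF germ_class_val]) simp
  fix n
  have "{x. val (\<lambda>_. Suc n) x = Suc n} = G" by (auto simp: val_def)
  moreover have "{x. val (\<lambda>_. Suc n) x = Suc m} = {}" if "m \<noteq> n" for m
    using that by (auto simp: val_def)
  moreover have "\<E> G \<noteq> {}"
    using positive_points_nonempty[OF set_ideal G_subset] invariant_idealD(3)[OF ideal] by blast
  moreover have "\<E> G \<subseteq> cl G" by (rule positive_points_subset[OF set_ideal])
  ultimately show "\<exists>c. cl {x. val c x = Suc n} \<inter> \<E> G \<noteq> {} \<and> (\<forall>j\<in>UNIV - {n}. cl {x. val c x = Suc j} = {})"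
    by (intro exI[of _ "\<lambda>_. Suc n"]) auto
qed

text \<open>Separate the discrete positive points by disjoint open sets \<open>W\<close> and apply
  \<open>positive_pieces\<close> inside smaller neighbourhoods whose closures stay in
  \<open>W\<close>. The conclusion speaks of closures because the points of a class lie in the
  closure of the support; shrinking \<open>P\<close> by regularity passes from an included piece to
  its closure.\<close>

lemma positive_family:
  fixes A :: "'i set"
  assumes T: "T \<subseteq> G" and d: "has_discrete T Z" and A: "|A| \<le>o |Z|"
  obtains T' W where "\<And>a. a \<in> A \<Longrightarrow> openin X (W a) \<and> T' a \<subseteq> T \<and> T' a \<notin> \<I> \<and> cl (T' a) \<subseteq> W a"
    "disjoint_family_on W A"
    "\<And>z P. openin X P \<Longrightarrow> z \<in> P \<Longrightarrow> z \<in> cl (\<Union>a\<in>A. T' a) \<Longrightarrow> (\<And>a. a \<in> A \<Longrightarrow> z \<notin> W a) \<Longrightarrow> \<exists>a\<in>A. cl (T' a) \<subseteq> P"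
proof -
  obtain D where D: "D \<subseteq> \<E> T" "discrete D" "|Z| \<le>o |D|" using d unfolding has_discrete_def by blast
  have "|A| \<le>o |D|" using A D(3) by (rule ordLeq_transitive)
  then have "\<exists>f. inj_on f A \<and> f ` A \<subseteq> D" by (rule card_of_ordLeq[THEN iffD2])
  then obtain p where p: "inj_on p A" "p ` A \<subseteq> D" by blast
  have DX: "D \<subseteq> topspace X" using D(1) unfolding positive_points_def by blast
  have "\<forall>x. \<exists>U. x \<in> D \<longrightarrow> openin X U \<and> x \<in> U \<and> D \<inter> U \<subseteq> {x}" using D(2) unfolding discrete_def by blast
  then obtain U where U: "\<And>x. x \<in> D \<Longrightarrow> openin X (U x) \<and> x \<in> U x \<and> D \<inter> U x \<subseteq> {x}" by metis
  obtain W where W: "\<And>x. x \<in> D \<Longrightarrow> openin X (W x) \<and> x \<in> W x \<and> W x \<subseteq> U x" "disjoint_family_on W D"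
    using separate[OF U] by blast
  have "\<exists>V. openin X V \<and> x \<in> V \<and> cl V \<subseteq> W x" if "x \<in> D" for x
  proof -
    have "openin X (W x)" "x \<in> W x" using W(1)[OF that] by simp_all
    then show ?thesis by (rule regular) blast
  qed
  then obtain V where V: "\<And>x. x \<in> D \<Longrightarrow> openin X (V x) \<and> x \<in> V x \<and> cl (V x) \<subseteq> W x" by metis
  have VW: "V x \<subseteq> W x" if "x \<in> D" for x
  proof -
    have "V x \<subseteq> cl (V x)" using V[OF that] by (intro closure_of_subset openin_subset) simp
    then show ?thesis using V[OF that] by blast
  qed
  have "\<exists>T'. (\<forall>a\<in>p ` A. T' a \<subseteq> T \<inter> V a \<and> T' a \<notin> \<I>) \<and>
        (\<forall>z P. openin X P \<and> z \<in> P \<and> z \<in> X closure_of (\<Union>a\<in>p ` A. T' a) \<and>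
          (\<forall>a\<in>p ` A. z \<notin> X closure_of T' a \<and> z \<notin> V a) \<longrightarrow> (\<exists>a\<in>p ` A. T' a \<subseteq> P))"
  proof (rule positive_pieces[OF set_ideal])
    show "T \<subseteq> topspace X" using T G_subset by blast
    show "p ` A \<subseteq> topspace X" using p DX by blast
    show "openin X (V a) \<and> a \<in> V a" if "a \<in> p ` A" for a using V that p by blast
    show "disjoint_family_on V (p ` A)"
      unfolding disjoint_family_on_def
    proof (intro ballI impI)
      fix a b assume "a \<in> p ` A" "b \<in> p ` A" "a \<noteq> b"
      then have ab: "a \<in> D" "b \<in> D" "a \<noteq> b" using p by blast+
      then have "W a \<inter> W b = {}" using W(2) by (simp add: disjoint_family_on_def)
      then show "V a \<inter> V b = {}" using VW[OF ab(1)] VW[OF ab(2)] by blast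
    qed
    show "U \<inter> T \<notin> \<I>" if "a \<in> p ` A" "openin X U" "a \<in> U" for a U
    proof -
      have "a \<in> \<E> T" using D(1) that(1) p(2) by blast
      then show ?thesis using that(2,3) by (simp add: positive_points_def)
    qed
  qed
  then obtain S where S0: "\<forall>a\<in>p ` A. S a \<subseteq> T \<inter> V a \<and> S a \<notin> \<I>"
    and lim: "\<forall>z P. openin X P \<and> z \<in> P \<and> z \<in> X closure_of (\<Union>a\<in>p ` A. S a) \<and>
          (\<forall>a\<in>p ` A. z \<notin> X closure_of S a \<and> z \<notin> V a) \<longrightarrow> (\<exists>a\<in>p ` A. S a \<subseteq> P)"
    by (elim exE conjE)
  have S: "S a \<subseteq> T \<inter> V a \<and> S a \<notin> \<I>" if "a \<in> p ` A" for a using S0 that by (rule bspec)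
  have clS: "cl (S a) \<subseteq> W a" if "a \<in> p ` A" for a
  proof -
    have "cl (S a) \<subseteq> cl (V a)" using S[OF that] by (intro closure_of_mono) simp
    moreover have "a \<in> D" using that p by blast
    ultimately show ?thesis using V[of a] subset_trans by metis
  qed
  show ?thesis
  proof (rule that[of "W \<circ> p" "S \<circ> p"])
    show "openin X ((W \<circ> p) a) \<and> (S \<circ> p) a \<subseteq> T \<and> (S \<circ> p) a \<notin> \<I> \<and> cl ((S \<circ> p) a) \<subseteq> (W \<circ> p) a" if "a \<in> A" for a
    proof -
      have "p a \<in> p ` A" "p a \<in> D" using that p by blast+
      then show ?thesis using S[of "p a"] clS[of "p a"] W(1)[of "p a"] by simp
    qed
    show "disjoint_family_on (W \<circ> p) A"
      unfolding disjoint_family_on_def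
    proof (intro ballI impI)
      fix a b assume "a \<in> A" "b \<in> A" "a \<noteq> b"
      then have "p a \<noteq> p b" "p a \<in> D" "p b \<in> D" using p by (auto dest: inj_onD)
      then show "(W \<circ> p) a \<inter> (W \<circ> p) b = {}" using W(2) by (simp add: disjoint_family_on_def)
    qed
    fix z P assume P: "openin X P" "z \<in> P" and z: "z \<in> cl (\<Union>a\<in>A. (S \<circ> p) a)" and nz: "\<And>a. a \<in> A \<Longrightarrow> z \<notin> (W \<circ> p) a"
    obtain P' where P': "openin X P'" "z \<in> P'" "cl P' \<subseteq> P" by (rule regular[OF P])
    have "z \<notin> cl (S a) \<and> z \<notin> V a" if a: "a \<in> p ` A" for a
    proof -
      obtain i where "i \<in> A" "a = p i" using a by blast
      then have "z \<notin> W a" "a \<in> D" using nz p by auto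
      then show ?thesis using clS[OF a] VW[of a] by blast
    qed
    moreover have "z \<in> cl (\<Union>a\<in>p ` A. S a)" using z by (simp add: image_image)
    ultimately have "openin X P' \<and> z \<in> P' \<and> z \<in> cl (\<Union>a\<in>p ` A. S a) \<and>
        (\<forall>a\<in>p ` A. z \<notin> cl (S a) \<and> z \<notin> V a)" using P'(1,2) by blast
    from lim[THEN spec[of _ z], THEN spec[of _ P'], THEN mp, OF this]
    have "\<exists>a\<in>p ` A. S a \<subseteq> P'" .
    then obtain a where a: "a \<in> p ` A" "S a \<subseteq> P'" by (elim bexE)
    have "cl (S a) \<subseteq> P" by (rule subset_trans[OF closure_of_mono[OF a(2)] P'(3)])
    then show "\<exists>a\<in>A. cl ((S \<circ> p) a) \<subseteq> P" using a(1) by auto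
  qed
qed

lemma glue_colourings:
  fixes c :: "'i \<Rightarrow> 'a \<Rightarrow> nat"
  assumes W: "disjoint_family_on W A" and T: "\<And>a. a \<in> A \<Longrightarrow> T a \<subseteq> W a"
    and c: "\<And>a. a \<in> A \<Longrightarrow> supp (c a) \<subseteq> T a"
  obtains C where "\<And>a x. a \<in> A \<Longrightarrow> x \<in> W a \<Longrightarrow> val C x = val (c a) x" "supp C = (\<Union>a\<in>A. supp (c a))"
proof -
  define C where "C x = (if \<exists>a\<in>A. x \<in> W a then c (SOME a. a \<in> A \<and> x \<in> W a) x else 0)" for x
  have eq: "C x = c a x" if "a \<in> A" "x \<in> W a" for a x
  proof -
    have "(SOME a. a \<in> A \<and> x \<in> W a) = a"
    proof (rule some_equality)
      fix b assume "b \<in> A \<and> x \<in> W b"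
      then show "b = a" using W that unfolding disjoint_family_on_def by blast
    qed (use that in simp)
    then show ?thesis using that by (auto simp: C_def)
  qed
  have val: "val C x = val (c a) x" if "a \<in> A" "x \<in> W a" for a x
    using eq[OF that] by (simp add: val_def)
  moreover have "supp C = (\<Union>a\<in>A. supp (c a))"
  proof
    show "supp C \<subseteq> (\<Union>a\<in>A. supp (c a))"
    proof
      fix x assume x: "x \<in> supp C"
      then have "C x \<noteq> 0" by (auto simp: supp_def val_def split: if_splits)
      then obtain a where a: "a \<in> A" "x \<in> W a" unfolding C_def by metis
      then show "x \<in> (\<Union>a\<in>A. supp (c a))" using x val[OF a] by (auto simp: supp_def)
    qed
    show "(\<Union>a\<in>A. supp (c a)) \<subseteq> supp C"
    proof
      fix x assume "x \<in> (\<Union>a\<in>A. supp (c a))"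
      then obtain a where a: "a \<in> A" "x \<in> supp (c a)" by blast
      then have "x \<in> W a" using c[of a] T[of a] by blast
      then show "x \<in> supp C" using val[OF a(1)] a(2) by (simp add: supp_def)
    qed
  qed
  ultimately show ?thesis using that by blast
qed

end

section \<open>Almost disjoint families\<close>

lemma card_of_inj: "inj_on f A \<Longrightarrow> f ` A \<subseteq> B \<Longrightarrow> |A| \<le>o |B|"
  by (intro card_of_ordLeq[THEN iffD1] exI[of _ f] conjI)

lemma card_of_finite_less: "finite A \<Longrightarrow> infinite B \<Longrightarrow> |A| <o |B|"
  using card_of_ordLeq_infinite not_card_leq_iff by blast

text \<open>The sets are graphs of functions from \<open>I\<close> to \<open>I\<close>, coded into
  \<open>I\<close> by an injection \<open>b\<close>. The functions are defined by recursion along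
  \<open>r\<close>: at \<xi>, the function \<open>g \<alpha>\<close> avoids the values of those
  earlier \<open>g \<beta>\<close> whose number \<open>e \<alpha> \<beta>\<close> is below \<xi>.
  Fewer than |I| values are forbidden each time, and two functions agree only at arguments up to
  that number, of which there are fewer than |I|. In this way \<open>L\<close> may have more than
  |I| elements.\<close>

lemma almost_disjoint_family:
  fixes I :: "'j set" and L :: "'i set" and r :: "'i rel"
  assumes I: "infinite I" and r: "well_order_on UNIV r"
    and L: "\<And>\<alpha>. \<alpha> \<in> L \<Longrightarrow> |underS r \<alpha>| \<le>o |I|"
  obtains B where "\<And>\<alpha>. \<alpha> \<in> L \<Longrightarrow> B \<alpha> \<subseteq> I \<and> |I| \<le>o |B \<alpha>|"
    "\<And>\<alpha> \<beta>. \<alpha> \<in> L \<Longrightarrow> \<beta> \<in> L \<Longrightarrow> \<alpha> \<noteq> \<beta> \<Longrightarrow> |B \<alpha> \<inter> B \<beta>| <o |I|"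
proof -
  have "|I \<times> I| \<le>o |I|" using card_of_Times_same_infinite[OF I] by (rule ordIso_imp_ordLeq)
  then have "\<exists>b. inj_on b (I \<times> I) \<and> b ` (I \<times> I) \<subseteq> I" by (rule card_of_ordLeq[THEN iffD2])
  then obtain b where b: "inj_on b (I \<times> I)" "b ` (I \<times> I) \<subseteq> I" by (elim exE conjE)
  have "\<exists>e. inj_on e (underS r \<alpha>) \<and> e ` underS r \<alpha> \<subseteq> I" if "\<alpha> \<in> L" for \<alpha>
    using L[OF that] by (rule card_of_ordLeq[THEN iffD2])
  then obtain e where e: "\<And>\<alpha>. \<alpha> \<in> L \<Longrightarrow> inj_on (e \<alpha>) (underS r \<alpha>) \<and> e \<alpha> ` underS r \<alpha> \<subseteq> I" by metis
  define q where "q = |I|"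
  have q: "Card_order q" unfolding q_def by (rule card_of_Card_order)
  have Fq: "Field q = I" unfolding q_def by (rule Field_card_of)
  have small: "|underS q \<xi>| <o |I|" if "\<xi> \<in> I" for \<xi>
    using card_of_underS[OF q, of \<xi>] that Fq unfolding q_def by simp
  have wf: "wf (r - Id)" using r by (simp add: well_order_on_def)
  define F where "F f \<alpha> \<xi> = (SOME y. y \<in> I \<and> y \<notin> (\<lambda>\<beta>. f \<beta> \<xi>) ` {\<beta> \<in> underS r \<alpha>. e \<alpha> \<beta> \<in> underS q \<xi>})"
    for f :: "'i \<Rightarrow> 'j \<Rightarrow> 'j" and \<alpha> \<xi>
  define g where "g = wfrec (r - Id) F"
  have g: "g \<alpha> \<xi> = (SOME y. y \<in> I \<and> y \<notin> (\<lambda>\<beta>. g \<beta> \<xi>) ` {\<beta> \<in> underS r \<alpha>. e \<alpha> \<beta> \<in> underS q \<xi>})" for \<alpha> \<xi>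
  proof -
    have "g \<alpha> \<xi> = F (cut g (r - Id) \<alpha>) \<alpha> \<xi>" unfolding g_def by (subst wfrec[OF wf]) simp
    also have "\<dots> = F g \<alpha> \<xi>"
    proof -
      have "(\<lambda>\<beta>. cut g (r - Id) \<alpha> \<beta> \<xi>) ` {\<beta> \<in> underS r \<alpha>. e \<alpha> \<beta> \<in> underS q \<xi>} =
          (\<lambda>\<beta>. g \<beta> \<xi>) ` {\<beta> \<in> underS r \<alpha>. e \<alpha> \<beta> \<in> underS q \<xi>}"
        by (rule image_cong) (auto simp: underS_def cut_apply)
      then show ?thesis by (simp add: F_def)
    qed
    finally show ?thesis by (simp add: F_def)
  qed
  have gI: "g \<alpha> \<xi> \<in> I \<and> g \<alpha> \<xi> \<notin> (\<lambda>\<beta>. g \<beta> \<xi>) ` {\<beta> \<in> underS r \<alpha>. e \<alpha> \<beta> \<in> underS q \<xi>}"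
    if \<alpha>: "\<alpha> \<in> L" and \<xi>: "\<xi> \<in> I" for \<alpha> \<xi>
  proof -
    let ?S = "{\<beta> \<in> underS r \<alpha>. e \<alpha> \<beta> \<in> underS q \<xi>}"
    have "|?S| \<le>o |underS q \<xi>|"
      using e[OF \<alpha>] by (intro card_of_inj[of "e \<alpha>"]) (auto intro: inj_on_subset)
    then have "|(\<lambda>\<beta>. g \<beta> \<xi>) ` ?S| <o |I|"
      by (rule ordLeq_ordLess_trans[OF ordLeq_transitive[OF card_of_image] small[OF \<xi>]])
    then have "\<not> |I| \<le>o |(\<lambda>\<beta>. g \<beta> \<xi>) ` ?S|" by (rule not_card_leq_iff[THEN iffD2])
    then have "\<not> I \<subseteq> (\<lambda>\<beta>. g \<beta> \<xi>) ` ?S" by (rule contrapos_nn) (rule card_of_mono1)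
    then have "\<exists>y. y \<in> I \<and> y \<notin> (\<lambda>\<beta>. g \<beta> \<xi>) ` ?S" by blast
    then show ?thesis unfolding g[of \<alpha> \<xi>] by (rule someI_ex)
  qed
  define B where "B \<alpha> = (\<lambda>\<xi>. b (\<xi>, g \<alpha> \<xi>)) ` I" for \<alpha>
  have B1: "B \<alpha> \<subseteq> I \<and> |I| \<le>o |B \<alpha>|" if \<alpha>: "\<alpha> \<in> L" for \<alpha>
  proof
    show "B \<alpha> \<subseteq> I" unfolding B_def using gI[OF \<alpha>] b(2) by (auto intro!: subsetD[OF b(2)])
    have "inj_on (\<lambda>\<xi>. b (\<xi>, g \<alpha> \<xi>)) I"
    proof (rule inj_onI)
      fix \<xi> \<zeta> assume *: "\<xi> \<in> I" "\<zeta> \<in> I" "b (\<xi>, g \<alpha> \<xi>) = b (\<zeta>, g \<alpha> \<zeta>)"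
      have "(\<xi>, g \<alpha> \<xi>) = (\<zeta>, g \<alpha> \<zeta>)"
        by (rule inj_onD[OF b(1) *(3)]) (use *(1,2) gI[OF \<alpha> *(1)] gI[OF \<alpha> *(2)] in simp_all)
      then show "\<xi> = \<zeta>" by simp
    qed
    then show "|I| \<le>o |B \<alpha>|" unfolding B_def by (rule card_of_inj) simp
  qed
  have B2: "|B \<alpha> \<inter> B \<beta>| <o |I|" if \<alpha>: "\<alpha> \<in> L" and \<beta>: "\<beta> \<in> L" and lt: "\<beta> \<in> underS r \<alpha>" for \<alpha> \<beta>
  proof -
    define \<eta> where "\<eta> = e \<alpha> \<beta>"
    have \<eta>: "\<eta> \<in> I" using e[OF \<alpha>] lt by (auto simp: \<eta>_def)
    have tot: "total_on I q"
      using q unfolding card_order_on_def well_order_on_def linear_order_on_def Fq by (elim conjE)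
    have "B \<alpha> \<inter> B \<beta> \<subseteq> (\<lambda>\<xi>. b (\<xi>, g \<alpha> \<xi>)) ` ({\<eta>} \<union> underS q \<eta>)"
    proof
      fix y assume "y \<in> B \<alpha> \<inter> B \<beta>"
      then obtain \<xi> \<zeta> where *: "\<xi> \<in> I" "\<zeta> \<in> I" "y = b (\<xi>, g \<alpha> \<xi>)" "y = b (\<zeta>, g \<beta> \<zeta>)" by (auto simp: B_def)
      have "b (\<xi>, g \<alpha> \<xi>) = b (\<zeta>, g \<beta> \<zeta>)" using *(3,4) by (rule trans[OF sym])
      then have "(\<xi>, g \<alpha> \<xi>) = (\<zeta>, g \<beta> \<zeta>)"
        by (rule inj_onD[OF b(1)]) (use *(1,2) gI[OF \<alpha> *(1)] gI[OF \<beta> *(2)] in simp_all)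
      then have eq: "g \<alpha> \<xi> = g \<beta> \<xi>" by (elim Pair_inject) (metis (full_types))
      have "\<eta> \<notin> underS q \<xi>"
      proof
        assume "\<eta> \<in> underS q \<xi>"
        then have "g \<beta> \<xi> \<in> (\<lambda>\<beta>. g \<beta> \<xi>) ` {\<beta> \<in> underS r \<alpha>. e \<alpha> \<beta> \<in> underS q \<xi>}"
          using lt by (auto simp: \<eta>_def)
        then show False unfolding eq[symmetric] using gI[OF \<alpha> *(1)] by (elim conjE) (rule notE)
      qed
      then have "\<xi> \<in> {\<eta>} \<union> underS q \<eta>" using tot \<eta> *(1) unfolding underS_def total_on_def by blast
      then show "y \<in> (\<lambda>\<xi>. b (\<xi>, g \<alpha> \<xi>)) ` ({\<eta>} \<union> underS q \<eta>)" using *(3) by (rule rev_image_eqI)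
    qed
    then have "|B \<alpha> \<inter> B \<beta>| \<le>o |{\<eta>} \<union> underS q \<eta>|"
      by (rule ordLeq_transitive[OF card_of_mono1 card_of_image])
    moreover have "|{\<eta>} \<union> underS q \<eta>| <o |I|"
      by (rule card_of_Un_less[OF I card_of_finite_less[OF _ I] small[OF \<eta>]]) simp
    ultimately show ?thesis by (rule ordLeq_ordLess_trans)
  qed
  have "|B \<alpha> \<inter> B \<beta>| <o |I|" if \<alpha>: "\<alpha> \<in> L" and \<beta>: "\<beta> \<in> L" and ne: "\<alpha> \<noteq> \<beta>" for \<alpha> \<beta>
  proof -
    have "total_on UNIV r" using r by (auto simp: well_order_on_def linear_order_on_def)
    then have "\<beta> \<in> underS r \<alpha> \<or> \<alpha> \<in> underS r \<beta>" using ne by (auto simp: underS_def total_on_def)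
    then show ?thesis using B2[OF \<alpha> \<beta>] B2[OF \<beta> \<alpha>] by (auto simp: Int_commute)
  qed
  then show ?thesis using that B1 by blast
qed

context maximal_ideal
begin

section \<open>Families of classes of every size\<close>

text \<open>The set \<open>T\<close> is arbitrary outside the ideal, so that different classes can
  be realised side by side on disjoint pieces; the bound on the support is used to compare
  cardinals.\<close>

definition realised :: "'i set \<Rightarrow> ('i \<Rightarrow> ('a \<Rightarrow> nat) \<Rightarrow> 'a set) \<Rightarrow> 'z set \<Rightarrow> bool" where
  "realised I D Z \<longleftrightarrow> (\<forall>i\<in>I. germ_class (D i)) \<and>
     (\<forall>T i. T \<subseteq> G \<and> T \<notin> \<I> \<and> i \<in> I \<longrightarrow>
        (\<exists>c. supp c \<subseteq> T \<and> |supp c| \<le>o |Z| \<and> D i c \<noteq> {} \<and> (\<forall>j\<in>I - {i}. D j c = {})))"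

definition separated :: "'i set \<Rightarrow> ('i \<Rightarrow> ('a \<Rightarrow> nat) \<Rightarrow> 'a set) \<Rightarrow> bool" where
  "separated I D \<longleftrightarrow> (\<forall>c i x. i \<in> I \<and> x \<in> D i c \<longrightarrow> (\<exists>U. openin X U \<and> x \<in> U \<and> (\<forall>j\<in>I - {i}. U \<inter> D j c = {})))"

text \<open>For the colourings supplied by \<open>realised\<close> this makes |Z| the exact local
  size of the support at points of the classes.\<close>

definition locally_large :: "'i set \<Rightarrow> ('i \<Rightarrow> ('a \<Rightarrow> nat) \<Rightarrow> 'a set) \<Rightarrow> 'z set \<Rightarrow> bool" where
  "locally_large I D Z \<longleftrightarrow> (\<forall>c i x U. i \<in> I \<and> x \<in> D i c \<and> openin X U \<and> x \<in> U \<longrightarrow> |Z| \<le>o |U \<inter> supp c| )"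

lemma realised_germ_class: "realised I D Z \<Longrightarrow> i \<in> I \<Longrightarrow> germ_class (D i)"
  unfolding realised_def by blast

lemma realisedD:
  "realised I D Z \<Longrightarrow> T \<subseteq> G \<Longrightarrow> T \<notin> \<I> \<Longrightarrow> i \<in> I \<Longrightarrow>
    \<exists>c. supp c \<subseteq> T \<and> |supp c| \<le>o |Z| \<and> D i c \<noteq> {} \<and> (\<forall>j\<in>I - {i}. D j c = {})"
  unfolding realised_def by simp

lemma separatedD:
  "separated I D \<Longrightarrow> i \<in> I \<Longrightarrow> x \<in> D i c \<Longrightarrow> \<exists>U. openin X U \<and> x \<in> U \<and> (\<forall>j\<in>I - {i}. U \<inter> D j c = {})"
  unfolding separated_def by simp

lemma locally_largeD:
  "locally_large I D Z \<Longrightarrow> i \<in> I \<Longrightarrow> x \<in> D i c \<Longrightarrow> openin X U \<Longrightarrow> x \<in> U \<Longrightarrow> |Z| \<le>o |U \<inter> supp c|"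
  unfolding locally_large_def by simp

text \<open>Keep from class \<open>i\<close> only the points with a neighbourhood that meets no
  other class. The realising colourings lose nothing, since they show no other class
  anywhere.\<close>

lemma realised_imp_separated:
  fixes D :: "'i \<Rightarrow> ('a \<Rightarrow> nat) \<Rightarrow> 'a set"
  assumes D: "realised I D Z"
  obtains D' where "realised I D' Z" "separated I D'"
proof -
  define D' where "D' i c = D i c \<inter> {x \<in> cl (supp c). \<exists>U. openin X U \<and> x \<in> U \<and> {j \<in> I. U \<inter> D j c \<noteq> {}} \<subseteq> {i}}" for i c
  have sub: "D' i c \<subseteq> D i c" for i c by (auto simp: D'_def)
  have gc: "germ_class (D' i)" if i: "i \<in> I" for i
    unfolding D'_def
    by (rule germ_class_Int[OF realised_germ_class[OF D i] germ_class_some_nbhd])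
      (use realised_germ_class[OF D] in \<open>simp, blast\<close>)
  have "realised I D' Z"
    unfolding realised_def
  proof (intro conjI allI impI ballI gc)
    fix T i assume "T \<subseteq> G \<and> T \<notin> \<I> \<and> i \<in> I"
    then have T: "T \<subseteq> G" "T \<notin> \<I>" "i \<in> I" by simp_all
    from realisedD[OF D T] obtain c where c: "supp c \<subseteq> T" "|supp c| \<le>o |Z|" "D i c \<noteq> {}" "\<forall>j\<in>I - {i}. D j c = {}"
      by (elim exE conjE)
    obtain x where x: "x \<in> D i c" using c(3) by blast
    then have xc: "x \<in> cl (supp c)" using germ_class_subset[OF realised_germ_class[OF D T(3)]] by blast
    then have "x \<in> topspace X" using cl_subset by blast
    moreover have "{j \<in> I. topspace X \<inter> D j c \<noteq> {}} \<subseteq> {i}" using c(4) by blast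
    ultimately have "x \<in> D' i c" using x xc unfolding D'_def by blast
    moreover have "\<forall>j\<in>I - {i}. D' j c = {}" using c(4) sub by blast
    ultimately show "\<exists>c. supp c \<subseteq> T \<and> |supp c| \<le>o |Z| \<and> D' i c \<noteq> {} \<and> (\<forall>j\<in>I - {i}. D' j c = {})"
      using c(1,2) by blast
  qed
  moreover have "separated I D'"
    unfolding separated_def
  proof (intro allI impI)
    fix c i x assume "i \<in> I \<and> x \<in> D' i c"
    then obtain U where U: "openin X U" "x \<in> U" "{j \<in> I. U \<inter> D j c \<noteq> {}} \<subseteq> {i}" unfolding D'_def by blast
    have "\<forall>j\<in>I - {i}. U \<inter> D' j c = {}" using U(3) sub by blast
    then show "\<exists>U. openin X U \<and> x \<in> U \<and> (\<forall>j\<in>I - {i}. U \<inter> D' j c = {})" using U(1,2) by blast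
  qed
  ultimately show ?thesis by (rule that)
qed

text \<open>Finitely many open sets, each containing fewer than |A| of the indexed points, cannot
  cover the compact space, because \<open>A\<close> is infinite.\<close>

lemma complete_accumulation:
  fixes A :: "'i set"
  assumes A: "infinite A" and x: "x ` A \<subseteq> topspace X"
  obtains z where "z \<in> topspace X" "\<And>U. openin X U \<Longrightarrow> z \<in> U \<Longrightarrow> |A| \<le>o |{i \<in> A. x i \<in> U}|"
proof -
  define \<U> where "\<U> = {U. openin X U \<and> |{i \<in> A. x i \<in> U}| <o |A| }"
  have "\<not> topspace X \<subseteq> \<Union>\<U>"
  proof
    assume cov: "topspace X \<subseteq> \<Union>\<U>"
    have "compactin X (topspace X)" using compact by (simp add: compact_space_def)
    then have "\<exists>\<F>. finite \<F> \<and> \<F> \<subseteq> \<U> \<and> topspace X \<subseteq> \<Union>\<F>"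
      by (rule compactinD[OF _ _ cov]) (simp add: \<U>_def)
    then obtain \<F> where F: "finite \<F>" "\<F> \<subseteq> \<U>" "topspace X \<subseteq> \<Union>\<F>" by (elim exE conjE)
    from F(1,2) have "|{i \<in> A. x i \<in> \<Union>\<F>}| <o |A|"
    proof (induction \<F>)
      case empty
      then show ?case using card_of_finite_less[OF _ A, of "{} :: 'i set"] by simp
    next
      case (insert U \<F>)
      then have "|{i \<in> A. x i \<in> U} \<union> {i \<in> A. x i \<in> \<Union>\<F>}| <o |A|"
        by (intro card_of_Un_less[OF A]) (simp_all add: \<U>_def)
      moreover have "{i \<in> A. x i \<in> U} \<union> {i \<in> A. x i \<in> \<Union>\<F>} = {i \<in> A. x i \<in> \<Union>(insert U \<F>)}" by blast
      ultimately show ?case by simp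
    qed
    moreover have "{i \<in> A. x i \<in> \<Union>\<F>} = A" using x F(3) by blast
    ultimately have "|A| <o |A|" by simp
    then show False using not_card_leq_iff card_of_mono1[of A A] by blast
  qed
  then obtain z where z: "z \<in> topspace X" "z \<notin> \<Union>\<U>" by blast
  have "|A| \<le>o |{i \<in> A. x i \<in> U}|" if "openin X U" "z \<in> U" for U
    using z(2) that not_card_leq_iff unfolding \<U>_def by blast
  then show ?thesis using z(1) that by blast
qed

text \<open>A point belongs to \<open>\<Gamma> \<alpha>\<close> if every neighbourhood meets at least \<open>|I|\<close> of the given classes, but
  some neighbourhood meets fewer than \<open>|I|\<close> of those with index outside \<open>B \<alpha>\<close>.\<close>

lemma level_step:
  fixes I :: "'j set" and L :: "'i set" and Z :: "'z set" and D :: "'j \<Rightarrow> ('a \<Rightarrow> nat) \<Rightarrow> 'a set"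
  assumes realised: "realised I D Z" and sep: "separated I D" and Z: "infinite Z"
    and IZ: "|I| \<le>o |Z|" "|Z| \<le>o |I|"
    and disc: "\<And>T. T \<subseteq> G \<Longrightarrow> T \<notin> \<I> \<Longrightarrow> has_discrete T Z"
    and B1: "\<And>\<alpha>. \<alpha> \<in> L \<Longrightarrow> B \<alpha> \<subseteq> I \<and> |I| \<le>o |B \<alpha>|"
    and B2: "\<And>\<alpha> \<beta>. \<alpha> \<in> L \<Longrightarrow> \<beta> \<in> L \<Longrightarrow> \<alpha> \<noteq> \<beta> \<Longrightarrow> |B \<alpha> \<inter> B \<beta>| <o |I|"
  obtains \<Gamma> where "realised L \<Gamma> Z" "separated L \<Gamma>" "locally_large L \<Gamma> Z"
proof -
  have I: "infinite I" using card_of_ordLeq_infinite[OF IZ(2) Z] .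
  have gD: "germ_class (D i)" if "i \<in> I" for i using realised_germ_class[OF realised that] .
  define J where "J c U = {i \<in> I. U \<inter> D i c \<noteq> {}}" for c U
  have J_mono: "J c U \<subseteq> J c U'" if "U \<subseteq> U'" for c U U' using that by (auto simp: J_def)
  define \<Gamma> where "\<Gamma> \<alpha> c = {x \<in> cl (supp c). \<forall>U. openin X U \<and> x \<in> U \<longrightarrow> |I| \<le>o |J c U| } \<inter>
      {x \<in> cl (supp c). \<exists>U. openin X U \<and> x \<in> U \<and> |J c U - B \<alpha>| <o |I| }" for \<alpha> c
  have large: "|I| \<le>o |J c U|" if "x \<in> \<Gamma> \<alpha> c" "openin X U" "x \<in> U" for \<alpha> c x U
    using that unfolding \<Gamma>_def by simp
  have few: "\<exists>U. openin X U \<and> x \<in> U \<and> |J c U - B \<alpha>| <o |I|" if "x \<in> \<Gamma> \<alpha> c" for \<alpha> c x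
    using that unfolding \<Gamma>_def by simp
  have not_small: "\<not> |I| \<le>o |S|" if "S \<subseteq> P \<union> Q" "|P| <o |I|" "|Q| <o |I|" for S P Q :: "'j set"
    using ordLeq_ordLess_trans[OF card_of_mono1[OF that(1)] card_of_Un_less[OF I that(2,3)]] not_card_leq_iff by blast
  have g\<Gamma>: "germ_class (\<Gamma> \<alpha>)" for \<alpha>
    unfolding \<Gamma>_def J_def
  proof (rule germ_class_Int[OF germ_class_all_nbhds germ_class_some_nbhd])
    show "|I| \<le>o |B'|" if "A \<subseteq> B'" "|I| \<le>o |A|" for A B' :: "'j set"
      using ordLeq_transitive[OF that(2) card_of_mono1[OF that(1)]] .
    show "|A - B \<alpha>| <o |I|" if "A \<subseteq> B'" "|B' - B \<alpha>| <o |I|" for A B' :: "'j set"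
      by (rule ordLeq_ordLess_trans[OF card_of_mono1 that(2)]) (use that(1) in blast)
  qed (erule gD)+
  have ll: "locally_large L \<Gamma> Z"
    unfolding locally_large_def
  proof (intro allI impI)
    fix c \<alpha> x U assume *: "\<alpha> \<in> L \<and> x \<in> \<Gamma> \<alpha> c \<and> openin X U \<and> x \<in> U"
    then have U: "openin X U" "x \<in> U" and xg: "x \<in> \<Gamma> \<alpha> c" by simp_all
    have IJ: "|I| \<le>o |J c U|" by (rule large[OF xg U])
    \<comment> \<open>One point is taken from every class met by \<open>U\<close>. Separation makes
      these points discrete, \<open>separate\<close> gives them disjoint neighbourhoods, and each of
      these contains a point of the support in \<open>U\<close>. So the support has at least as many
      points in \<open>U\<close> as there are classes met.\<close>
    have "\<forall>i. \<exists>p. i \<in> J c U \<longrightarrow> p \<in> U \<and> p \<in> D i c" unfolding J_def by blast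
    then obtain p where p: "\<And>i. i \<in> J c U \<Longrightarrow> p i \<in> U \<and> p i \<in> D i c" by metis
    have JI: "J c U \<subseteq> I" by (auto simp: J_def)
    have "\<exists>V. openin X V \<and> p i \<in> V \<and> (\<forall>j\<in>I - {i}. V \<inter> D j c = {})" if "i \<in> J c U" for i
      using separatedD[OF sep, of i "p i" c] p[OF that] JI that by blast
    then obtain V where V: "\<And>i. i \<in> J c U \<Longrightarrow> openin X (V i) \<and> p i \<in> V i \<and> (\<forall>j\<in>I - {i}. V i \<inter> D j c = {})" by metis
    have pV: "j = i" if "i \<in> J c U" "j \<in> J c U" "p j \<in> V i" for i j
    proof (rule ccontr)
      assume "j \<noteq> i"
      then have "V i \<inter> D j c = {}" using V[OF that(1)] that(2) JI by blast
      then show False using p[OF that(2)] that(3) by blast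
    qed
    have inj: "inj_on p (J c U)"
    proof (rule inj_onI)
      fix i j assume "i \<in> J c U" "j \<in> J c U" "p i = p j"
      then show "i = j" using pV[of j i] V[of j] by simp
    qed
    define q where "q = inv_into (J c U) p"
    have qp: "q (p i) = i" if "i \<in> J c U" for i using inv_into_f_f[OF inj that] by (simp add: q_def)
    have "openin X (V (q y)) \<and> y \<in> V (q y) \<and> p ` J c U \<inter> V (q y) \<subseteq> {y}" if y: "y \<in> p ` J c U" for y
    proof -
      obtain i where i: "i \<in> J c U" "y = p i" using y by blast
      have "p ` J c U \<inter> V i \<subseteq> {p i}" using pV[OF i(1)] by blast
      then show ?thesis using V[OF i(1)] i qp by simp
    qed
    then obtain W where W: "\<And>y. y \<in> p ` J c U \<Longrightarrow> openin X (W y) \<and> y \<in> W y \<and> W y \<subseteq> V (q y)" "disjoint_family_on W (p ` J c U)"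
      by (rule separate) (assumption | rule that)+
    have "\<exists>s. s \<in> supp c \<and> s \<in> U \<inter> W (p i)" if i: "i \<in> J c U" for i
    proof -
      have "p i \<in> cl (supp c)" using germ_class_subset[OF gD] p[OF i] JI i by blast
      moreover have "openin X (U \<inter> W (p i))" using W(1)[of "p i"] i U(1) by (simp add: openin_Int)
      moreover have "p i \<in> U \<inter> W (p i)" using W(1)[of "p i"] p[OF i] i by blast
      ultimately show ?thesis unfolding in_closure_of by meson
    qed
    then obtain s where s: "\<And>i. i \<in> J c U \<Longrightarrow> s i \<in> supp c \<and> s i \<in> U \<inter> W (p i)" by metis
    have "inj_on s (J c U)"
    proof (rule inj_onI)
      fix i j assume ij: "i \<in> J c U" "j \<in> J c U" "s i = s j"
      then have "s i \<in> W (p i) \<inter> W (p j)" using s[of i] s[of j] by simp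
      then have "p i = p j" using disjoint_family_onD[OF W(2), of "p i" "p j"] ij(1,2) by blast
      then show "i = j" using inj ij by (simp add: inj_on_eq_iff)
    qed
    moreover have "s ` J c U \<subseteq> U \<inter> supp c"
    proof (rule image_subsetI)
      fix i assume "i \<in> J c U"
      from s[OF this] show "s i \<in> U \<inter> supp c" by simp
    qed
    ultimately have "|J c U| \<le>o |U \<inter> supp c|" by (rule card_of_inj)
    then show "|Z| \<le>o |U \<inter> supp c|" by (rule ordLeq_transitive[OF ordLeq_transitive[OF IZ(2) IJ]])
  qed
  have sep\<Gamma>: "separated L \<Gamma>"
    unfolding separated_def
  proof (intro allI impI)
    fix c \<alpha> x assume *: "\<alpha> \<in> L \<and> x \<in> \<Gamma> \<alpha> c"
    then obtain U where U: "openin X U" "x \<in> U" "|J c U - B \<alpha>| <o |I|" using few by blast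
    have "U \<inter> \<Gamma> \<beta> c = {}" if \<beta>: "\<beta> \<in> L - {\<alpha>}" for \<beta>
    proof (rule ccontr)
      assume "U \<inter> \<Gamma> \<beta> c \<noteq> {}"
      then obtain w where w: "w \<in> U" "w \<in> \<Gamma> \<beta> c" by blast
      obtain U' where U': "openin X U'" "w \<in> U'" "|J c U' - B \<beta>| <o |I|" using few[OF w(2)] by blast
      have "openin X (U \<inter> U')" "w \<in> U \<inter> U'" using U(1) U'(1,2) w(1) by blast+
      then have l: "|I| \<le>o |J c (U \<inter> U')|" by (rule large[OF w(2)])
      \<comment> \<open>Near a point of class \<beta> in \<open>U\<close> at least |I| classes are
        met, but all except fewer than |I| of them have their index in both
        \<open>B \<alpha>\<close> and \<open>B \<beta>\<close>, whose intersection is too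
        small.\<close>
      have "J c (U \<inter> U') \<subseteq> (J c U - B \<alpha>) \<union> ((J c U' - B \<beta>) \<union> (B \<alpha> \<inter> B \<beta>))"
        using J_mono[of "U \<inter> U'" U c] J_mono[of "U \<inter> U'" U' c] by blast
      moreover have "|(J c U' - B \<beta>) \<union> (B \<alpha> \<inter> B \<beta>)| <o |I|"
        by (rule card_of_Un_less[OF I U'(3) B2]) (use * \<beta> in auto)
      ultimately show False using not_small[OF _ U(3)] l by blast
    qed
    then show "\<exists>U. openin X U \<and> x \<in> U \<and> (\<forall>\<beta>\<in>L - {\<alpha>}. U \<inter> \<Gamma> \<beta> c = {})" using U(1,2) by blast
  qed
  have "realised L \<Gamma> Z"
    unfolding realised_def
  proof (intro conjI allI impI ballI g\<Gamma>)
    fix T \<alpha> assume "T \<subseteq> G \<and> T \<notin> \<I> \<and> \<alpha> \<in> L"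
    then have T: "T \<subseteq> G" "T \<notin> \<I>" and \<alpha>: "\<alpha> \<in> L" by simp_all
    have BI: "B \<alpha> \<subseteq> I" and IB: "|I| \<le>o |B \<alpha>|" using B1[OF \<alpha>] by simp_all
    have Binf: "infinite (B \<alpha>)" using card_of_ordLeq_infinite[OF IB I] .
    have BZ: "|B \<alpha>| \<le>o |Z|" using ordLeq_transitive[OF card_of_mono1[OF BI] IZ(1)] .
    obtain T' W where TW: "\<And>a. a \<in> B \<alpha> \<Longrightarrow> openin X (W a) \<and> T' a \<subseteq> T \<and> T' a \<notin> \<I> \<and> cl (T' a) \<subseteq> W a"
      and Wd: "disjoint_family_on W (B \<alpha>)"
      and lim: "\<And>z P. openin X P \<Longrightarrow> z \<in> P \<Longrightarrow> z \<in> cl (\<Union>a\<in>B \<alpha>. T' a) \<Longrightarrow> (\<And>a. a \<in> B \<alpha> \<Longrightarrow> z \<notin> W a) \<Longrightarrow>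
          \<exists>a\<in>B \<alpha>. cl (T' a) \<subseteq> P"
      using positive_family[OF T(1) disc[OF T] BZ] by metis
    have "\<exists>c. supp c \<subseteq> T' i \<and> |supp c| \<le>o |Z| \<and> D i c \<noteq> {} \<and> (\<forall>j\<in>I - {i}. D j c = {})" if "i \<in> B \<alpha>" for i
      by (rule realisedD[OF realised]) (use TW[OF that] T BI that in auto)
    then obtain c where c: "\<And>i. i \<in> B \<alpha> \<Longrightarrow> supp (c i) \<subseteq> T' i \<and> |supp (c i)| \<le>o |Z| \<and> D i (c i) \<noteq> {} \<and> (\<forall>j\<in>I - {i}. D j (c i) = {})"
      by metis
    have "\<exists>y. i \<in> B \<alpha> \<longrightarrow> y \<in> D i (c i)" for i using c[of i] by blast
    then obtain x where x: "\<And>i. i \<in> B \<alpha> \<Longrightarrow> x i \<in> D i (c i)" by metis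
    have T'X: "T' i \<subseteq> topspace X" if "i \<in> B \<alpha>" for i using TW[OF that] T(1) G_subset by blast
    have T'W: "T' i \<subseteq> W i" if "i \<in> B \<alpha>" for i using TW[OF that] closure_of_subset[OF T'X[OF that]] by blast
    have xT: "x i \<in> cl (T' i)" if i: "i \<in> B \<alpha>" for i
    proof -
      have "x i \<in> cl (supp (c i))" using x[OF i] germ_class_subset[OF gD] BI i by blast
      then show ?thesis using closure_of_mono[of "supp (c i)" "T' i" X] c[OF i] by blast
    qed
    obtain C where C: "\<And>a x. a \<in> B \<alpha> \<Longrightarrow> x \<in> W a \<Longrightarrow> val C x = val (c a) x"
      and suppC: "supp C = (\<Union>a\<in>B \<alpha>. supp (c a))"
      using glue_colourings[OF Wd T'W] c by metis
    have DW: "D j C \<inter> W i = D j (c i) \<inter> W i" if "i \<in> B \<alpha>" "j \<in> I" for i j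
      by (rule germ_class_local[OF gD[OF that(2)]]) (use TW[OF that(1)] C[OF that(1)] in auto)
    have xC: "x i \<in> D i C" "x i \<in> W i" if i: "i \<in> B \<alpha>" for i
    proof -
      show "x i \<in> W i" using xT[OF i] TW[OF i] by blast
      then show "x i \<in> D i C" using DW[OF i, of i] x[OF i] BI i by blast
    qed
    have suppT': "supp C \<subseteq> (\<Union>a\<in>B \<alpha>. T' a)" unfolding suppC using c by blast
    \<comment> \<open>Inside \<open>W i\<close> the colouring shows only class \<open>i\<close>. A
      point outside all \<open>W i\<close> is a limit of pieces, and a neighbourhood free of all
      classes but \<open>j\<close> would contain the closure of a whole piece and with it the point
      \<open>x i\<close> of another class.\<close>
    have empty: "D j C = {}" if j: "j \<in> I - B \<alpha>" for j
    proof (rule ccontr)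
      assume "D j C \<noteq> {}"
      then obtain y where y: "y \<in> D j C" by blast
      have nW: "y \<notin> W i" if "i \<in> B \<alpha>" for i
      proof
        assume "y \<in> W i"
        then have "y \<in> D j (c i)" using DW[OF that, of j] y j by blast
        moreover have "j \<in> I - {i}" using j that by blast
        ultimately show False using c[OF that] by blast
      qed
      have "j \<in> I" using j by blast
      from separatedD[OF sep this y] obtain U where U: "openin X U" "y \<in> U" "\<forall>i\<in>I - {j}. U \<inter> D i C = {}"
        by (elim exE conjE)
      have "y \<in> cl (supp C)" using y germ_class_subset[OF gD[OF \<open>j \<in> I\<close>]] by blast
      then have "y \<in> cl (\<Union>a\<in>B \<alpha>. T' a)" using closure_of_mono[OF suppT'] by blast
      then have "\<exists>i\<in>B \<alpha>. cl (T' i) \<subseteq> U" by (rule lim[OF U(1,2)]) (rule nW)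
      then obtain i where i: "i \<in> B \<alpha>" "cl (T' i) \<subseteq> U" by (elim bexE)
      then have "x i \<in> U \<inter> D i C" "i \<in> I - {j}" using xT[OF i(1)] xC(1)[OF i(1)] BI j by blast+
      then show False using U(3) by blast
    qed
    have JB: "J C U \<subseteq> B \<alpha>" for U using empty unfolding J_def by blast
    have "x ` B \<alpha> \<subseteq> topspace X" using xT cl_subset by blast
    \<comment> \<open>A complete accumulation point of the \<open>x i\<close> sees at least |I|
      classes in each neighbourhood, and the only classes that occur at all have their index in
      \<open>B \<alpha>\<close>.\<close>
    then obtain z where z: "z \<in> topspace X" "\<And>U. openin X U \<Longrightarrow> z \<in> U \<Longrightarrow> |B \<alpha>| \<le>o |{i \<in> B \<alpha>. x i \<in> U}|"
      by (rule complete_accumulation[OF Binf]) (rule that)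
    have xsupp: "x i \<in> cl (supp C)" if "i \<in> B \<alpha>" for i
      using xC(1)[OF that] germ_class_subset[OF gD] BI that by blast
    have zI: "|I| \<le>o |J C U|" if U: "openin X U" "z \<in> U" for U
    proof -
      have "{i \<in> B \<alpha>. x i \<in> U} \<subseteq> J C U" using xC(1) BI unfolding J_def by blast
      then show ?thesis by (rule ordLeq_transitive[OF IB ordLeq_transitive[OF z(2)[OF U] card_of_mono1]])
    qed
    have "z \<in> cl (cl (supp C))"
      unfolding in_closure_of[of z X "cl (supp C)"]
    proof (intro conjI allI impI z(1))
      fix U assume U: "z \<in> U \<and> openin X U"
      then have "|B \<alpha>| \<le>o |{i \<in> B \<alpha>. x i \<in> U}|" using z(2) by simp
      then have "infinite {i \<in> B \<alpha>. x i \<in> U}" by (rule card_of_ordLeq_infinite[OF _ Binf])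
      then obtain i where "i \<in> B \<alpha>" "x i \<in> U" using infinite_imp_nonempty by blast
      then show "\<exists>y. y \<in> cl (supp C) \<and> y \<in> U" using xsupp by blast
    qed
    then have zc: "z \<in> cl (supp C)" by simp
    have "J C (topspace X) - B \<alpha> = {}" using JB by blast
    then have "|J C (topspace X) - B \<alpha>| <o |I|" by (simp only: card_of_finite_less[OF finite.emptyI I])
    then have "z \<in> \<Gamma> \<alpha> C" unfolding \<Gamma>_def using zc zI z(1) by blast
    moreover have "\<Gamma> \<beta> C = {}" if \<beta>: "\<beta> \<in> L - {\<alpha>}" for \<beta>
    proof (rule ccontr)
      assume "\<Gamma> \<beta> C \<noteq> {}"
      then obtain y where y: "y \<in> \<Gamma> \<beta> C" by blast
      obtain U where U: "openin X U" "y \<in> U" "|J C U - B \<beta>| <o |I|" using few[OF y] by blast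
      have l: "|I| \<le>o |J C U|" by (rule large[OF y U(1,2)])
      have "J C U \<subseteq> (J C U - B \<beta>) \<union> (B \<alpha> \<inter> B \<beta>)" using JB by blast
      moreover have "|B \<alpha> \<inter> B \<beta>| <o |I|" by (rule B2) (use \<alpha> \<beta> in auto)
      ultimately show False using not_small[OF _ U(3)] l by blast
    qed
    moreover have "supp C \<subseteq> T" using suppT' TW by blast
    moreover have "|supp C| \<le>o |Z|"
      unfolding suppC by (rule card_of_UNION_ordLeq_infinite[OF Z BZ]) (use c in blast)
    ultimately show "\<exists>c. supp c \<subseteq> T \<and> |supp c| \<le>o |Z| \<and> \<Gamma> \<alpha> c \<noteq> {} \<and> (\<forall>\<beta>\<in>L - {\<alpha>}. \<Gamma> \<beta> c = {})"
      by (intro exI[of _ C] conjI ballI) auto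
  qed
  then show ?thesis using sep\<Gamma> ll by (rule that)
qed

end

lemma card_of_Un_leq: "infinite Z \<Longrightarrow> |A| \<le>o |Z| \<Longrightarrow> |B| \<le>o |Z| \<Longrightarrow> |A \<union> B| \<le>o |Z|"
  by (rule card_of_Un_ordLeq_infinite_Field[OF _ _ _ card_of_Card_order]) (unfold Field_card_of)

context maximal_ideal
begin

section \<open>Joining families built at different cardinals\<close>

lemma has_discrete_leq: "has_discrete T Z \<Longrightarrow> |Z'| \<le>o |Z| \<Longrightarrow> has_discrete T Z'"
  unfolding has_discrete_def using ordLeq_transitive by meson

lemma val_comp: "f 0 = 0 \<Longrightarrow> val (f \<circ> c) x = f (val c x)"
  by (simp add: val_def)

definition graded :: "'i set \<Rightarrow> ('i \<Rightarrow> ('a \<Rightarrow> nat) \<Rightarrow> 'a set) \<Rightarrow> 'z set \<Rightarrow> bool" where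
  "graded L \<Gamma> Z \<longleftrightarrow> realised L \<Gamma> Z \<and> separated L \<Gamma> \<and> locally_large L \<Gamma> Z"

lemma realised_cong:
  assumes D: "realised I D Z" and J: "J \<subseteq> I" and Z: "|Z| \<le>o |Z'|" and eq: "\<And>i. i \<in> J \<Longrightarrow> D' i = D i"
  shows "realised J D' Z'"
  unfolding realised_def
proof (intro conjI allI impI ballI)
  show "germ_class (D' i)" if "i \<in> J" for i
    using realised_germ_class[OF D] J that by (auto simp: eq)
  fix T i assume "T \<subseteq> G \<and> T \<notin> \<I> \<and> i \<in> J"
  then have T: "T \<subseteq> G" "T \<notin> \<I>" "i \<in> I" and i: "i \<in> J" using J by auto
  from realisedD[OF D T] obtain c where
    c: "supp c \<subseteq> T" "|supp c| \<le>o |Z|" "D i c \<noteq> {}" "\<forall>j\<in>I - {i}. D j c = {}"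
    by (elim exE conjE)
  have "D' j c = {}" if "j \<in> J - {i}" for j using c(4) J that eq[of j] by auto
  moreover have "D' i c \<noteq> {}" using c(3) eq[OF i] by simp
  ultimately show "\<exists>c. supp c \<subseteq> T \<and> |supp c| \<le>o |Z'| \<and> D' i c \<noteq> {} \<and> (\<forall>j\<in>J - {i}. D' j c = {})"
    using c(1) ordLeq_transitive[OF c(2) Z] by (intro exI[of _ c] conjI ballI)
qed

lemma separated_cong:
  assumes D: "separated I D" and J: "J \<subseteq> I" and eq: "\<And>i. i \<in> J \<Longrightarrow> D' i = D i"
  shows "separated J D'"
  unfolding separated_def
proof (intro allI impI)
  fix c i x assume "i \<in> J \<and> x \<in> D' i c"
  then have "i \<in> I" "x \<in> D i c" using J eq[of i] by auto
  from separatedD[OF D this] obtain U where U: "openin X U" "x \<in> U" "\<forall>j\<in>I - {i}. U \<inter> D j c = {}"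
    by (elim exE conjE)
  have "U \<inter> D' j c = {}" if "j \<in> J - {i}" for j using U(3) J that eq[of j] by auto
  then show "\<exists>U. openin X U \<and> x \<in> U \<and> (\<forall>j\<in>J - {i}. U \<inter> D' j c = {})"
    using U(1,2) by (intro exI[of _ U] conjI ballI)
qed

lemma locally_large_cong:
  assumes D: "locally_large I D Z" and J: "J \<subseteq> I" and Z: "|Z'| \<le>o |Z|" and eq: "\<And>i. i \<in> J \<Longrightarrow> D' i = D i"
  shows "locally_large J D' Z'"
  unfolding locally_large_def
proof (intro allI impI)
  fix c i x U assume *: "i \<in> J \<and> x \<in> D' i c \<and> openin X U \<and> x \<in> U"
  then have "i \<in> I" "x \<in> D i c" "openin X U" "x \<in> U" using J eq[of i] by auto
  then have "|Z| \<le>o |U \<inter> supp c|" by (rule locally_largeD[OF D])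
  then show "|Z'| \<le>o |U \<inter> supp c|" by (rule ordLeq_transitive[OF Z])
qed

lemma graded_cong:
  assumes "graded I D Z" "J \<subseteq> I" "|Z| =o |Z'|" "\<And>i. i \<in> J \<Longrightarrow> D' i = D i"
  shows "graded J D' Z'"
proof -
  have Z: "|Z| \<le>o |Z'|" "|Z'| \<le>o |Z|"
    using assms(3) ordIso_imp_ordLeq ordIso_symmetric by blast+
  have D: "realised I D Z" "separated I D" "locally_large I D Z" using assms(1) unfolding graded_def by simp_all
  show ?thesis unfolding graded_def
    by (intro conjI realised_cong[OF D(1) assms(2) Z(1)] separated_cong[OF D(2) assms(2)]
        locally_large_cong[OF D(3) assms(2) Z(2)]) (fact assms(4))+
qed

definition level :: "'i set \<Rightarrow> ('i \<Rightarrow> 'z set) \<Rightarrow> 'i \<Rightarrow> 'i set" where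
  "level N S \<beta> = {\<alpha> \<in> N. |S \<alpha>| =o |S \<beta>|}"

text \<open>Two colourings are stored in one: an even value 2n stands for colour \<open>n\<close>,
  and an odd value is a mark.\<close>

definition even_part :: "nat \<Rightarrow> nat" where "even_part n = (if even n then n div 2 else 0)"
definition odd_part :: "nat \<Rightarrow> nat" where "odd_part n = (if odd n then 1 else 0)"

lemma parts_zero [simp]: "even_part 0 = 0" "odd_part 0 = 0"
  by (simp_all add: even_part_def odd_part_def)

text \<open>Families at different cardinals need not exclude each other. Points where
  the odd marks accumulate are limits of whole pieces of the support, so that its local size there
  is exactly \<open>|S \<beta>|\<close> and tells the cardinals apart.\<close>

definition marked :: "('i \<Rightarrow> ('a \<Rightarrow> nat) \<Rightarrow> 'a set) \<Rightarrow> ('i \<Rightarrow> 'z set) \<Rightarrow> 'i \<Rightarrow> ('a \<Rightarrow> nat) \<Rightarrow> 'a set" where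
  "marked \<Gamma> S \<beta> c = cl (\<Gamma> \<beta> (even_part \<circ> c)) \<inter> (cl (supp (odd_part \<circ> c)) \<inter>
     {x \<in> cl (supp c). \<exists>U. openin X U \<and> x \<in> U \<and> |U \<inter> supp c| \<le>o |S \<beta>| })"

lemma germ_class_marked:
  assumes "germ_class (\<Gamma> \<beta>)"
  shows "germ_class (marked \<Gamma> S \<beta>)"
proof -
  have "germ_class (\<lambda>c. cl (\<Gamma> \<beta> (even_part \<circ> c)))"
    by (rule germ_class_comp[OF germ_class_closure[OF assms]]) simp
  moreover have "germ_class (\<lambda>c. cl (supp (odd_part \<circ> c)))"
    by (rule germ_class_comp[OF germ_class_supp]) simp
  ultimately have "germ_class (\<lambda>c. marked \<Gamma> S \<beta> c)"
    unfolding marked_def by (intro germ_class_Int germ_class_size)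
  then show ?thesis by simp
qed

text \<open>On each of countably many pieces the colouring shows class \<beta> in doubled colours
  and has one extra marked point. The marks accumulate at a point \<open>z\<close> outside all
  \<open>W k\<close>; near it lie whole pieces, so class \<beta> accumulates there and
  \<open>z\<close> is positive. If another class \<gamma> occurred, local largeness would bound |S
  \<beta>| and |S \<gamma>| by each other; but within one level the family is separated, and the
  pieces show only \<beta>.\<close>

lemma marked_realised:
  fixes N :: "'i set" and S :: "'i \<Rightarrow> 'z set"
  assumes inf: "\<And>\<alpha>. \<alpha> \<in> N \<Longrightarrow> infinite (S \<alpha>)"
    and \<Gamma>: "\<And>\<alpha>. \<alpha> \<in> N \<Longrightarrow> graded (level N S \<alpha>) \<Gamma> (S \<alpha>)"
    and T: "T \<subseteq> G" "T \<notin> \<I>" and \<beta>: "\<beta> \<in> N"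
  shows "\<exists>c. supp c \<subseteq> T \<and> |supp c| \<le>o |S \<beta>| \<and> marked \<Gamma> S \<beta> c \<inter> \<E> T \<noteq> {} \<and>
    (\<forall>\<gamma>\<in>N - {\<beta>}. marked \<Gamma> S \<gamma> c = {})"
proof -
  have lvl: "\<alpha> \<in> level N S \<alpha>" if "\<alpha> \<in> N" for \<alpha> using that by (simp add: level_def card_of_refl)
  have gc: "germ_class (\<Gamma> \<alpha>)" if "\<alpha> \<in> N" for \<alpha>
    using \<Gamma>[OF that] realised_germ_class[OF _ lvl[OF that]] unfolding graded_def by blast
  have ll: "|S \<alpha>| \<le>o |U \<inter> supp c|" if "\<alpha> \<in> N" "x \<in> \<Gamma> \<alpha> c" "openin X U" "x \<in> U" for \<alpha> c x U
  proof (rule locally_largeD[OF _ lvl[OF that(1)]])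
    show "locally_large (level N S \<alpha>) \<Gamma> (S \<alpha>)" using \<Gamma>[OF that(1)] unfolding graded_def by (elim conjE)
  qed (fact that)+
  have sep: "separated (level N S \<beta>) \<Gamma>" and real: "realised (level N S \<beta>) \<Gamma> (S \<beta>)"
    using \<Gamma>[OF \<beta>] unfolding graded_def by simp_all
  have inf\<beta>: "infinite (S \<beta>)" by (rule inf[OF \<beta>])
  have "has_discrete T (UNIV :: nat set)" by (rule has_discrete_positive[OF infinite_UNIV_nat has_discrete_nat T])
  then obtain T' and W :: "nat \<Rightarrow> 'a set" where
    TW: "\<And>k. openin X (W k) \<and> T' k \<subseteq> T \<and> T' k \<notin> \<I> \<and> cl (T' k) \<subseteq> W k"
    and Wd: "disjoint_family_on W UNIV"
    and lim: "\<And>z P. openin X P \<Longrightarrow> z \<in> P \<Longrightarrow> z \<in> cl (\<Union>k. T' k) \<Longrightarrow> (\<And>k. z \<notin> W k) \<Longrightarrow> \<exists>k. cl (T' k) \<subseteq> P"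
    using positive_family[OF T(1) _ ordLeq_refl[OF card_of_Card_order], of "UNIV :: nat set"]
    by (metis UNIV_I)
  have T'G: "T' k \<subseteq> G" for k using TW[of k] T(1) by (meson order_trans)
  have T'X: "T' k \<subseteq> topspace X" for k using T'G[of k] G_subset by (rule order_trans)
  have T'cl: "T' k \<subseteq> cl (T' k)" for k using T'X by (simp add: closure_of_subset)
  have T'W: "T' k \<subseteq> W k" for k using T'cl[of k] TW[of k] by (meson order_trans)
  have "\<exists>c. supp c \<subseteq> T' k \<and> |supp c| \<le>o |S \<beta>| \<and> \<Gamma> \<beta> c \<noteq> {} \<and> (\<forall>j\<in>level N S \<beta> - {\<beta>}. \<Gamma> j c = {})" for k
    by (rule realisedD[OF real T'G _ lvl[OF \<beta>]]) (use TW[of k] in simp)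
  then obtain c where c: "\<And>k. supp (c k) \<subseteq> T' k \<and> |supp (c k)| \<le>o |S \<beta>| \<and> \<Gamma> \<beta> (c k) \<noteq> {} \<and>
      (\<forall>j\<in>level N S \<beta> - {\<beta>}. \<Gamma> j (c k) = {})" by metis
  have "\<exists>x. x \<in> \<Gamma> \<beta> (c k)" for k using c[of k] by blast
  then obtain x where x: "\<And>k. x k \<in> \<Gamma> \<beta> (c k)" by metis
  have "\<exists>t. t \<in> T' k" for k
  proof -
    have "T' k \<noteq> {}" using TW[of k] set_ideal_empty[OF set_ideal] by metis
    then show ?thesis by blast
  qed
  then obtain t where t: "\<And>k. t k \<in> T' k" by metis
  have tG: "t k \<in> G" for k using t T'G by blast
  have tW: "t k \<in> W k" for k using t T'W by blast
  have Wt: "j = k" if "t j \<in> W k" for j k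
    using disjoint_family_onD[OF Wd, of j k] tW[of j] that by blast
  \<comment> \<open>At a point of a class every neighbourhood contains infinitely many points of the
    support, whereas \<open>t k\<close> has a neighbourhood containing no other point of
    \<open>G\<close>.\<close>
  have isolated: "\<exists>U. openin X U \<and> t k \<in> U \<and> (\<forall>\<alpha>\<in>N. \<forall>c. U \<inter> \<Gamma> \<alpha> c = {})" for k
  proof -
    obtain U where U: "openin X U" "t k \<in> U" "G \<inter> U \<subseteq> {t k}" using G_isolated[OF tG] by blast
    have "U \<inter> \<Gamma> \<alpha> c = {}" if \<alpha>: "\<alpha> \<in> N" for \<alpha> c
    proof (rule ccontr)
      assume "U \<inter> \<Gamma> \<alpha> c \<noteq> {}"
      then obtain y where "y \<in> U" "y \<in> \<Gamma> \<alpha> c" by blast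
      then have "|S \<alpha>| \<le>o |U \<inter> supp c|" using ll[OF \<alpha>] U(1) by simp
      then have "infinite (U \<inter> supp c)" using inf[OF \<alpha>] by (rule card_of_ordLeq_infinite)
      moreover have "U \<inter> supp c \<subseteq> {t k}" using U(3) supp_subset(1)[of c] by blast
      ultimately show False using finite_subset by blast
    qed
    then show ?thesis using U(1,2) by blast
  qed
  have xt: "p \<noteq> t k" if "\<alpha> \<in> N" "p \<in> \<Gamma> \<alpha> c" for \<alpha> p k c
    using isolated[of k] that by blast
  \<comment> \<open>The mark 1 overwrites any colour at \<open>t k\<close>. This does no harm:
    classes are local and their points differ from \<open>t k\<close>.\<close>
  define d where "d k y = (if y = t k then 1 else 2 * c k y)" for k y
  have val_d: "val (d k) y = (if y = t k then 1 else 2 * val (c k) y)" for k y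
    using tG[of k] by (simp add: val_def d_def)
  have supp_d: "supp (d k) = insert (t k) (supp (c k))" for k
    unfolding supp_def val_d by auto
  have dT: "supp (d k) \<subseteq> T' k" for k using c[of k] t[of k] unfolding supp_d by blast
  obtain C where C': "\<And>k x. k \<in> UNIV \<Longrightarrow> x \<in> W k \<Longrightarrow> val C x = val (d k) x"
    and suppC: "supp C = (\<Union>k\<in>UNIV. supp (d k))"
    by (rule glue_colourings[OF Wd T'W dT]) (rule that)
  have C: "val C y = (if y = t k then 1 else 2 * val (c k) y)" if "y \<in> W k" for k y
    using C'[OF UNIV_I that] val_d by simp
  define e where "e = even_part \<circ> C"
  define q where "q = odd_part \<circ> C"
  have se: "supp e \<subseteq> supp C" and sq: "supp q \<subseteq> supp C"
    unfolding e_def q_def by (rule supp_comp, simp)+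
  have suppT': "supp C \<subseteq> (\<Union>k. T' k)" unfolding suppC using dT by blast
  have suppCT: "supp C \<subseteq> T" using suppT' TW by blast
  have suppCS: "|supp C| \<le>o |S \<beta>|" unfolding suppC
  proof (rule card_of_UNION_ordLeq_infinite[OF inf\<beta>])
    show "|UNIV :: nat set| \<le>o |S \<beta>|" using inf\<beta> infinite_iff_card_of_nat by blast
    have "|{t k} \<union> supp (c k)| \<le>o |S \<beta>|" for k
      using c[of k] ordLess_imp_ordLeq[OF card_of_finite_less[OF _ inf\<beta>, of "{t k}"]]
      by (intro card_of_Un_leq[OF inf\<beta>]) simp_all
    then show "\<forall>k\<in>UNIV. |supp (d k)| \<le>o |S \<beta>|" unfolding supp_d by simp
  qed
  have supp_q: "supp q = range t"
  proof
    show "range t \<subseteq> supp q" using C[OF tW] by (auto simp: supp_def q_def val_comp odd_part_def)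
    show "supp q \<subseteq> range t"
    proof
      fix y assume y: "y \<in> supp q"
      then obtain k where "y \<in> T' k" using sq suppT' by blast
      then have "val C y = (if y = t k then 1 else 2 * val (c k) y)" using C T'W by blast
      moreover have "odd (val C y)" using y by (auto simp: supp_def q_def val_comp odd_part_def split: if_splits)
      ultimately show "y \<in> range t" by (auto split: if_splits)
    qed
  qed
  have Vopen: "openin X (W k - {t k})" for k
    by (rule openin_diff[OF _ closedin_Hausdorff_singleton[OF Hausdorff]]) (use TW[of k] tG[of k] G_subset in auto)
  have \<Gamma>W: "\<Gamma> \<alpha> e \<inter> (W k - {t k}) = \<Gamma> \<alpha> (c k) \<inter> (W k - {t k})" if "\<alpha> \<in> N" for \<alpha> k
  proof (rule germ_class_local[OF gc[OF that]])
    show "openin X (W k - {t k})" by (rule Vopen)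
    show "val e y = val (c k) y" if "y \<in> W k - {t k}" for y
      using C[of y k] that by (simp add: e_def val_comp even_part_def)
  qed
  have xcl: "x k \<in> cl (T' k)" for k
    using x[of k] germ_class_subset[OF gc[OF \<beta>], of "c k"] closure_of_mono[of "supp (c k)" "T' k" X] c[of k] by blast
  have xW: "x k \<in> W k - {t k}" for k using xcl[of k] TW[of k] xt[OF \<beta> x] by blast
  have x\<Gamma>: "x k \<in> \<Gamma> \<beta> e" for k using \<Gamma>W[OF \<beta>, of k] x[of k] xW[of k] by blast
  have "inj t" by (rule injI) (metis Wt tW)
  then have "infinite (range t)" using finite_imageD by blast
  moreover have "range t \<subseteq> topspace X" using tG G_subset by blast
  ultimately obtain z where z: "z \<in> topspace X" "\<And>U. openin X U \<Longrightarrow> z \<in> U \<Longrightarrow> infinite (range t \<inter> U)"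
    by (rule infinite_imp_limit_point) (rule that)
  have zW: "z \<notin> W k" for k
  proof
    assume "z \<in> W k"
    then have "infinite (range t \<inter> W k)" using z(2) TW[of k] by blast
    moreover have "range t \<inter> W k \<subseteq> {t k}" using Wt by blast
    ultimately show False using finite_subset by blast
  qed
  have zq: "z \<in> cl (supp q)" unfolding supp_q in_closure_of
  proof (intro conjI allI impI z(1))
    fix U assume "z \<in> U \<and> openin X U"
    then have "infinite (range t \<inter> U)" using z(2) by simp
    then have "range t \<inter> U \<noteq> {}" using infinite_imp_nonempty by blast
    then show "\<exists>y. y \<in> range t \<and> y \<in> U" by blast
  qed
  have clq: "cl (supp q) \<subseteq> cl (\<Union>k. T' k)" using closure_of_mono[OF order_trans[OF sq suppT']] .
  have zlim: "\<exists>k. cl (T' k) \<subseteq> P" if "openin X P" "z \<in> P" for P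
    by (rule lim[OF that]) (use zq clq zW in auto)
  have "z \<in> marked \<Gamma> S \<beta> C"
    unfolding marked_def e_def[symmetric] q_def[symmetric]
  proof (intro IntI zq CollectI conjI exI[of _ "topspace X"])
    show "z \<in> cl (\<Gamma> \<beta> e)" unfolding in_closure_of
    proof (intro conjI allI impI z(1))
      fix U assume "z \<in> U \<and> openin X U"
      then obtain k where "cl (T' k) \<subseteq> U" using zlim by blast
      then show "\<exists>y. y \<in> \<Gamma> \<beta> e \<and> y \<in> U" using xcl x\<Gamma> by blast
    qed
    show "z \<in> cl (supp C)" using closure_of_mono[OF sq] zq by blast
    show "|topspace X \<inter> supp C| \<le>o |S \<beta>|" by (rule ordLeq_transitive[OF card_of_mono1 suppCS]) simp
  qed (use z(1) in simp_all)
  moreover have "z \<in> \<E> T"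
    unfolding positive_points_def
  proof (intro CollectI conjI allI impI z(1))
    fix U assume "openin X U \<and> z \<in> U"
    then obtain k where "cl (T' k) \<subseteq> U" using zlim by blast
    then have "T' k \<subseteq> U \<inter> T" using T'cl[of k] TW[of k] by blast
    then show "U \<inter> T \<notin> \<I>" using posI TW[of k] by metis
  qed
  moreover have "marked \<Gamma> S \<gamma> C = {}" if \<gamma>: "\<gamma> \<in> N - {\<beta>}" for \<gamma>
  proof (rule ccontr)
    assume "marked \<Gamma> S \<gamma> C \<noteq> {}"
    then obtain w U0 where w: "w \<in> cl (\<Gamma> \<gamma> e)" "w \<in> cl (supp q)"
      and U0: "openin X U0" "w \<in> U0" "|U0 \<inter> supp C| \<le>o |S \<gamma>|"
      unfolding marked_def e_def q_def by blast
    have \<gamma>N: "\<gamma> \<in> N" using \<gamma> by simp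
    have wt: "w \<noteq> t k" for k
    proof
      assume "w = t k"
      then obtain U where "openin X U" "w \<in> U" "U \<inter> \<Gamma> \<gamma> e = {}" using isolated[of k] \<gamma>N by blast
      then show False using w(1) unfolding in_closure_of by blast
    qed
    have wW: "w \<notin> W k" for k
    proof
      assume "w \<in> W k"
      then have "w \<in> W k - {t k}" using wt by simp
      then have "\<exists>y. y \<in> range t \<and> y \<in> W k - {t k}"
        using w(2) Vopen[of k] unfolding supp_q in_closure_of by (elim conjE allE[of _ "W k - {t k}"] impE) simp_all
      then obtain j where j: "t j \<in> W k" "t j \<noteq> t k" by blast
      then show False using Wt[OF j(1)] by simp
    qed
    have "w \<in> cl (\<Union>k. T' k)" using w(2) clq by blast
    then have "\<exists>k. cl (T' k) \<subseteq> U0" by (rule lim[OF U0(1,2)]) (rule wW)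
    then obtain k where k: "cl (T' k) \<subseteq> U0" by (elim exE)
    \<comment> \<open>The neighbourhood \<open>U0\<close> contains a point of class \<beta>, so the
      support has at least |S \<beta>| points in it, while the condition in \<open>marked\<close>
      allows at most |S \<gamma>|.\<close>
    have "x k \<in> U0" using xcl[of k] k by blast
    then have "|S \<beta>| \<le>o |U0 \<inter> supp e|" by (rule ll[OF \<beta> x\<Gamma> U0(1)])
    also have "|U0 \<inter> supp e| \<le>o |U0 \<inter> supp C|" by (rule card_of_mono1) (use se in blast)
    finally have le1: "|S \<beta>| \<le>o |S \<gamma>|" using U0(3) by (rule ordLeq_transitive)
    \<comment> \<open>Conversely, a point of class \<gamma> forces |S \<gamma>| points into the
      support, which has at most |S \<beta>|.\<close>
    have "\<Gamma> \<gamma> e \<noteq> {}" using w(1) by auto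
    then obtain y where y: "y \<in> \<Gamma> \<gamma> e" by blast
    have ycl: "y \<in> cl (supp e)" using y germ_class_subset[OF gc[OF \<gamma>N]] by blast
    then have "y \<in> topspace X" using cl_subset by blast
    then have "|S \<gamma>| \<le>o |topspace X \<inter> supp e|" by (rule ll[OF \<gamma>N y openin_topspace])
    also have "|topspace X \<inter> supp e| \<le>o |supp C|" by (rule card_of_mono1) (use se in blast)
    finally have "|S \<gamma>| \<le>o |S \<beta>|" using suppCS by (rule ordLeq_transitive)
    then have lev: "\<gamma> \<in> level N S \<beta>" using le1 \<gamma>N by (simp add: level_def ordIso_iff_ordLeq)
    have yW: "y \<notin> W k" for k
    proof
      assume "y \<in> W k"
      then have "y \<in> W k - {t k}" using xt[OF \<gamma>N y] by blast
      then have "y \<in> \<Gamma> \<gamma> (c k)" using \<Gamma>W[OF \<gamma>N, of k] y by blast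
      then show False using c[of k] lev \<gamma> by blast
    qed
    from separatedD[OF sep lev y] obtain U where U: "openin X U" "y \<in> U" "\<forall>j\<in>level N S \<beta> - {\<gamma>}. U \<inter> \<Gamma> j e = {}"
      by (elim exE conjE)
    have "y \<in> cl (\<Union>k. T' k)" using closure_of_mono[OF order_trans[OF se suppT']] ycl by blast
    then have "\<exists>k. cl (T' k) \<subseteq> U" by (rule lim[OF U(1,2)]) (rule yW)
    then obtain k where "cl (T' k) \<subseteq> U" by (elim exE)
    then have "x k \<in> U \<inter> \<Gamma> \<beta> e" using xcl x\<Gamma> by blast
    moreover have "\<beta> \<in> level N S \<beta> - {\<gamma>}" using lvl[OF \<beta>] \<gamma> by blast
    ultimately show False using U(3) by blast
  qed
  ultimately show ?thesis using suppCT suppCS by (intro exI[of _ C]) blast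
qed

text \<open>Initial family for the countable case: a single coloured point shows its own colour and
  nothing else.\<close>

lemma single_values_realised:
  assumes Z: "infinite Z"
  shows "realised UNIV (\<lambda>n c. {x. val c x = Suc n}) Z"
  unfolding realised_def
proof (intro conjI allI impI ballI)
  show "germ_class (\<lambda>c. {x. val c x = Suc n})" for n by (rule germ_class_val) simp
  fix T and n :: nat assume T: "T \<subseteq> G \<and> T \<notin> \<I> \<and> n \<in> UNIV"
  have "T \<noteq> {}" using T set_ideal_empty[OF set_ideal] by metis
  then obtain t where t: "t \<in> T" by blast
  define c where "c x = (if x = t then Suc n else 0)" for x
  have v: "val c x = (if x = t then Suc n else 0)" for x using t T by (auto simp: val_def c_def)
  have s: "supp c = {t}" by (auto simp: supp_def v)
  have "|supp c| \<le>o |Z|" unfolding s by (rule ordLess_imp_ordLeq[OF card_of_finite_less[OF _ Z]]) simp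
  moreover have "supp c \<subseteq> T" using s t by simp
  moreover have "val c t = Suc n" by (simp add: v)
  moreover have "{x. val c x = Suc m} = {}" if "m \<in> UNIV - {n}" for m using that by (auto simp: v)
  ultimately show "\<exists>c. supp c \<subseteq> T \<and> |supp c| \<le>o |Z| \<and> {x. val c x = Suc n} \<noteq> {} \<and>
      (\<forall>m\<in>UNIV - {n}. {x. val c x = Suc m} = {})"
    by (intro exI[of _ c] conjI ballI) blast+
qed

lemma graded_exists_step:
  fixes I :: "'j set" and L :: "'i set" and Z :: "'z set" and D :: "'j \<Rightarrow> ('a \<Rightarrow> nat) \<Rightarrow> 'a set"
  assumes D: "realised I D Z" and Z: "infinite Z" "|I| \<le>o |Z|" "|Z| \<le>o |I|"
    and disc: "has_discrete G Z" and r: "well_order_on UNIV r"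
    and L: "\<And>\<alpha>. \<alpha> \<in> L \<Longrightarrow> |underS r \<alpha>| \<le>o |Z|"
  shows "\<exists>\<Gamma>. graded L \<Gamma> Z"
proof -
  obtain D' where D': "realised I D' Z" "separated I D'" using realised_imp_separated[OF D] .
  have I: "infinite I" by (rule card_of_ordLeq_infinite[OF Z(3,1)])
  have LI: "|underS r \<alpha>| \<le>o |I|" if "\<alpha> \<in> L" for \<alpha> by (rule ordLeq_transitive[OF L[OF that] Z(3)])
  obtain B where B: "\<And>\<alpha>. \<alpha> \<in> L \<Longrightarrow> B \<alpha> \<subseteq> I \<and> |I| \<le>o |B \<alpha>|"
    "\<And>\<alpha> \<beta>. \<alpha> \<in> L \<Longrightarrow> \<beta> \<in> L \<Longrightarrow> \<alpha> \<noteq> \<beta> \<Longrightarrow> |B \<alpha> \<inter> B \<beta>| <o |I|"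
    by (rule almost_disjoint_family[OF I r LI]) (assumption | rule that)+
  have dT: "has_discrete T Z" if "T \<subseteq> G" "T \<notin> \<I>" for T by (rule has_discrete_positive[OF Z(1) disc that])
  obtain \<Gamma> :: "'i \<Rightarrow> ('a \<Rightarrow> nat) \<Rightarrow> 'a set" where "realised L \<Gamma> Z" "separated L \<Gamma>" "locally_large L \<Gamma> Z"
    by (rule level_step[OF D' Z(1-3) dT B]) (assumption | rule that)+
  then show ?thesis unfolding graded_def by blast
qed

section \<open>Recursion along a well-order of arbitrary length\<close>

context
  fixes r :: "'i rel"
  assumes r: "well_order_on UNIV r"
begin

text \<open>A set whose cardinal is the maximum of |underS r \<nu>| and that of \<open>nat\<close>;
  the second summand keeps it infinite when \<nu> has only finitely many predecessors.\<close>

definition sz :: "'i \<Rightarrow> ('i + nat) set" where "sz \<nu> = underS r \<nu> <+> (UNIV :: nat set)"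

lemma infinite_sz: "infinite (sz \<nu>)"
  by (simp add: sz_def)

lemma underS_leq_sz: "|underS r \<nu>| \<le>o |sz \<nu>|"
  unfolding sz_def by (rule card_of_Plus1)

text \<open>Indices of the same level must draw on one common family, so the choice is made per
  level and not per index: \<open>F\<close> depends only on the set of indices, and being graded
  depends only on the cardinal of the size argument.\<close>

lemma graded_choice:
  assumes "\<And>\<alpha>. \<alpha> \<in> N \<Longrightarrow> \<exists>\<Gamma>. graded (level UNIV sz \<alpha>) \<Gamma> (sz \<alpha>)"
  shows "\<exists>\<Gamma>. \<forall>\<alpha>\<in>N. graded (level N sz \<alpha>) \<Gamma> (sz \<alpha>)"
proof -
  define F where "F L = (SOME \<Gamma>. \<forall>\<alpha>. level UNIV sz \<alpha> = L \<longrightarrow> graded L \<Gamma> (sz \<alpha>))" for L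
  define \<Gamma> where "\<Gamma> \<alpha> = F (level UNIV sz \<alpha>) \<alpha>" for \<alpha>
  have level_eq: "level UNIV sz \<alpha> = level UNIV sz \<beta>" if "|sz \<alpha>| =o |sz \<beta>|" for \<alpha> \<beta>
    using ordIso_transitive[OF _ that] ordIso_transitive[OF _ ordIso_symmetric[OF that]]
    unfolding level_def by blast
  have "graded (level N sz \<alpha>) \<Gamma> (sz \<alpha>)" if \<alpha>: "\<alpha> \<in> N" for \<alpha>
  proof -
    let ?L = "level UNIV sz \<alpha>"
    obtain \<Gamma>0 where g: "graded ?L \<Gamma>0 (sz \<alpha>)" using assms[OF \<alpha>] by (elim exE)
    have "graded ?L \<Gamma>0 (sz \<beta>)" if "level UNIV sz \<beta> = ?L" for \<beta>
    proof (rule graded_cong[OF g])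
      have "\<alpha> \<in> ?L" by (simp add: level_def card_of_refl)
      then show "|sz \<alpha>| =o |sz \<beta>|" unfolding that[symmetric] by (simp add: level_def)
    qed simp_all
    then have "\<exists>\<Gamma>. \<forall>\<beta>. level UNIV sz \<beta> = ?L \<longrightarrow> graded ?L \<Gamma> (sz \<beta>)" by blast
    then have "\<forall>\<beta>. level UNIV sz \<beta> = ?L \<longrightarrow> graded ?L (F ?L) (sz \<beta>)" unfolding F_def by (rule someI_ex)
    then have "graded ?L (F ?L) (sz \<alpha>)" by simp
    then show ?thesis
    proof (rule graded_cong)
      show "level N sz \<alpha> \<subseteq> ?L" by (auto simp: level_def)
      show "|sz \<alpha>| =o |sz \<alpha>|" by (rule card_of_refl)
      fix \<beta> assume "\<beta> \<in> level N sz \<alpha>"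
      then have "level UNIV sz \<beta> = ?L" by (intro level_eq) (simp add: level_def)
      then show "\<Gamma> \<beta> = F ?L \<beta>" by (simp add: \<Gamma>_def)
    qed
  qed
  then show ?thesis by blast
qed

lemma realised_of_graded:
  assumes ex: "\<And>\<alpha>. \<alpha> \<in> N \<Longrightarrow> \<exists>\<Gamma>. graded (level UNIV sz \<alpha>) \<Gamma> (sz \<alpha>)"
    and Z: "\<And>\<alpha>. \<alpha> \<in> N \<Longrightarrow> |sz \<alpha>| \<le>o |Z|"
  shows "\<exists>D. realised N D Z" "has_discrete G N"
proof -
  have "\<exists>\<Gamma>. \<forall>\<alpha>\<in>N. graded (level N sz \<alpha>) \<Gamma> (sz \<alpha>)" by (rule graded_choice) (rule ex)
  then obtain \<Gamma> where \<Gamma>: "\<forall>\<alpha>\<in>N. graded (level N sz \<alpha>) \<Gamma> (sz \<alpha>)" by (elim exE)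
  have gm: "germ_class (marked \<Gamma> sz \<alpha>)" if "\<alpha> \<in> N" for \<alpha>
  proof (rule germ_class_marked)
    have "realised (level N sz \<alpha>) \<Gamma> (sz \<alpha>)" using \<Gamma> that unfolding graded_def by simp
    then show "germ_class (\<Gamma> \<alpha>)" by (rule realised_germ_class) (simp add: level_def that card_of_refl)
  qed
  have mr: "\<exists>c. supp c \<subseteq> T \<and> |supp c| \<le>o |sz \<beta>| \<and> marked \<Gamma> sz \<beta> c \<inter> \<E> T \<noteq> {} \<and>
    (\<forall>\<gamma>\<in>N - {\<beta>}. marked \<Gamma> sz \<gamma> c = {})" if "T \<subseteq> G" "T \<notin> \<I>" "\<beta> \<in> N" for T \<beta>
    by (rule marked_realised[OF infinite_sz _ that]) (use \<Gamma> in simp)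
  have "realised N (marked \<Gamma> sz) Z"
    unfolding realised_def
  proof (intro conjI allI impI ballI gm)
    fix T \<beta> assume "T \<subseteq> G \<and> T \<notin> \<I> \<and> \<beta> \<in> N"
    then have T: "T \<subseteq> G" "T \<notin> \<I>" "\<beta> \<in> N" by simp_all
    from mr[OF T] obtain c where c: "supp c \<subseteq> T" "|supp c| \<le>o |sz \<beta>|" "marked \<Gamma> sz \<beta> c \<inter> \<E> T \<noteq> {}"
      "\<forall>\<gamma>\<in>N - {\<beta>}. marked \<Gamma> sz \<gamma> c = {}" by (elim exE conjE)
    have "marked \<Gamma> sz \<beta> c \<noteq> {}" using c(3) by blast
    then show "\<exists>c. supp c \<subseteq> T \<and> |supp c| \<le>o |Z| \<and> marked \<Gamma> sz \<beta> c \<noteq> {} \<and> (\<forall>\<gamma>\<in>N - {\<beta>}. marked \<Gamma> sz \<gamma> c = {})"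
      using c(1,4) ordLeq_transitive[OF c(2) Z[OF T(3)]] by (intro exI[of _ c] conjI)
  qed
  then show "\<exists>D. realised N D Z" by (intro exI)
  show "has_discrete G N"
  proof (rule has_discrete_of_classes[OF gm])
    fix \<beta> assume \<beta>: "\<beta> \<in> N"
    from mr[OF subset_refl invariant_idealD(3)[OF ideal] \<beta>]
    show "\<exists>c. marked \<Gamma> sz \<beta> c \<inter> \<E> G \<noteq> {} \<and> (\<forall>\<gamma>\<in>N - {\<beta>}. marked \<Gamma> sz \<gamma> c = {})"
      by (elim exE conjE) (intro exI conjI)
  qed
qed

text \<open>Induction along \<open>r\<close>. The families for smaller indices, joined by marking,
  form one family indexed by the predecessors of \<nu>; if there are uncountably many, it has the
  size of \<open>sz \<nu>\<close>. An almost disjoint family of sets of these indices then serves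
  all indices of the level of \<nu> at once, even if there are more than |sz \<nu>| of them.\<close>

lemma graded_exists: "\<exists>\<Gamma>. graded (level UNIV sz \<nu>) \<Gamma> (sz \<nu>)"
proof -
  have "wf (r - Id)" using r by (simp add: well_order_on_def)
  then show ?thesis
  proof (induction \<nu> rule: wf_induct_rule)
    case (less \<nu>)
    have tr: "trans r" "antisym r"
      using r by (simp_all add: well_order_on_def linear_order_on_def partial_order_on_def preorder_on_def)
    have ex: "\<exists>\<Gamma>. graded (level UNIV sz \<alpha>) \<Gamma> (sz \<alpha>)" if "\<alpha> \<in> underS r \<nu>" for \<alpha>
      by (rule less) (use that in \<open>simp add: underS_def\<close>)
    have le: "|sz \<alpha>| \<le>o |sz \<nu>|" if "\<alpha> \<in> underS r \<nu>" for \<alpha>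
    proof (rule card_of_mono1)
      have "underS r \<alpha> \<subseteq> underS r \<nu>" using that tr unfolding underS_def trans_def antisym_def by blast
      then show "sz \<alpha> \<subseteq> sz \<nu>" unfolding sz_def by blast
    qed
    have R: "\<exists>D. realised (underS r \<nu>) D (sz \<nu>)"
      by (rule realised_of_graded(1)) (erule ex, erule le)
    have disc: "has_discrete G (underS r \<nu>)"
      by (rule realised_of_graded(2)) (erule ex, erule le)
    have L: "|underS r \<alpha>| \<le>o |sz \<nu>|" if "\<alpha> \<in> level UNIV sz \<nu>" for \<alpha>
      using that ordLeq_transitive[OF underS_leq_sz[of \<alpha>] ordIso_imp_ordLeq] by (simp add: level_def)
    show ?case
    \<comment> \<open>With at most countably many predecessors, the nonzero values of a colouring
      serve as the countable family.\<close>
    proof (cases "|underS r \<nu>| \<le>o |UNIV :: nat set|")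
      case True
      have le: "|sz \<nu>| \<le>o |UNIV :: nat set|" unfolding sz_def
        by (rule card_of_Plus_ordLeq_infinite_Field[OF _ True _ card_of_Card_order]) (simp_all add: Field_card_of card_of_mono1)
      have ge: "|UNIV :: nat set| \<le>o |sz \<nu>|" unfolding sz_def by (rule card_of_Plus2)
      show ?thesis
        by (rule graded_exists_step[OF single_values_realised[OF infinite_sz] infinite_sz ge le
              has_discrete_leq[OF has_discrete_nat le] r L])
    next
      case False
      then have lt: "|UNIV :: nat set| \<le>o |underS r \<nu>|"
        using not_card_leq_iff ordLess_imp_ordLeq by blast
      have inf: "infinite (underS r \<nu>)" by (rule card_of_ordLeq_infinite[OF lt infinite_UNIV_nat])
      have le: "|sz \<nu>| \<le>o |underS r \<nu>|" unfolding sz_def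
        by (rule card_of_Plus_ordLeq_infinite_Field[OF _ _ lt card_of_Card_order])
          (use inf in \<open>simp_all add: Field_card_of card_of_mono1\<close>)
      obtain D where D: "realised (underS r \<nu>) D (sz \<nu>)" using R by (elim exE)
      show ?thesis
        by (rule graded_exists_step[OF D infinite_sz underS_leq_sz le has_discrete_leq[OF disc le] r L])
    qed
  qed
qed

lemma has_discrete_UNIV: "has_discrete G (UNIV :: 'i set)"
proof (rule realised_of_graded(2)[OF graded_exists])
  show "|sz \<alpha>| \<le>o |UNIV :: ('i + nat) set|" for \<alpha> by (rule card_of_mono1) simp
qed

end

text \<open>The index type of the recursion is free. With \<open>'a set\<close> as index type,
  \<open>'a\<close> would contain as many points as it has subsets, against Cantor's
  theorem.\<close>

lemma contradictory: False
proof -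
  obtain r :: "'a set rel" where "well_order_on UNIV r" using well_order_on by blast
  then have "has_discrete G (UNIV :: 'a set set)" by (rule has_discrete_UNIV)
  then obtain D :: "'a set" where "|UNIV :: 'a set set| \<le>o |D|" unfolding has_discrete_def by blast
  also have "|D| \<le>o |UNIV :: 'a set|" by (rule card_of_mono1) simp
  finally have "|UNIV :: 'a set set| \<le>o |UNIV :: 'a set|" .
  then have "|Pow (UNIV :: 'a set)| \<le>o |UNIV :: 'a set|" by simp
  then show False using card_of_Pow[of "UNIV :: 'a set"] not_card_leq_iff by blast
qed

end

lemma (in recolourable) contradictory: False
proof -
  obtain \<I> where "invariant_ideal \<I>" "\<forall>\<J>. invariant_ideal \<J> \<and> \<I> \<subseteq> \<J> \<longrightarrow> \<J> = \<I>"
    using maximal_invariant_ideal by (elim exE conjE)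
  then interpret maximal_ideal X M G g \<I> by unfold_locales simp_all
  show False by (rule contradictory)
qed

section \<open>Application to CO spaces\<close>

context mn_space
begin

lemma perfect_kernel_nonempty:
  assumes "\<not> scattered_space X"
  shows "perfect_kernel X \<noteq> {}"
proof -
  obtain S where S: "S \<subseteq> topspace X" "S \<noteq> {}" "\<And>x. x \<in> S \<Longrightarrow> \<not> openin (subtopology X S) {x}"
    using assms unfolding scattered_space_def by blast
  have "S \<subseteq> X derived_set_of S"
  proof
    fix x assume x: "x \<in> S"
    show "x \<in> X derived_set_of S"
      unfolding in_derived_set_of
    proof (intro conjI allI impI)
      show "x \<in> topspace X" using x S(1) by blast
      fix U assume U: "x \<in> U \<and> openin X U"
      show "\<exists>y. y \<noteq> x \<and> y \<in> S \<and> y \<in> U"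
      proof (rule ccontr)
        assume "\<nexists>y. y \<noteq> x \<and> y \<in> S \<and> y \<in> U"
        then have "{x} = S \<inter> U" using x U by blast
        then have "openin (subtopology X S) {x}" using U by (metis openin_subtopology_Int2)
        then show False using S(3)[OF x] by simp
      qed
    qed
  qed
  then have "S \<subseteq> perfect_kernel X" by (rule perfect_kernel_maximal)
  then show ?thesis using S(2) by blast
qed

lemma CO_space_homeomorphic:
  assumes "CO_space X" "closedin X F"
  shows "\<exists>U h k. openin X U \<and> homeomorphic_maps (subtopology X F) (subtopology X U) h k \<and>
    (\<forall>n. U \<inter> coloured n X = h ` coloured n (subtopology X F))"
proof -
  have "\<exists>U. closedin X U \<and> openin X U \<and> subtopology X F homeomorphic_space subtopology X U"
    using assms unfolding CO_space_def by simp
  then obtain U where U: "openin X U" "subtopology X F homeomorphic_space subtopology X U" by (elim exE conjE)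
  then obtain h k where hk: "homeomorphic_maps (subtopology X F) (subtopology X U) h k"
    unfolding homeomorphic_space_def by (elim exE)
  have "homeomorphic_map (subtopology X F) (subtopology X U) h"
    using hk homeomorphic_map_maps by (intro iffD2[OF homeomorphic_map_maps]) (rule exI)
  then have "\<forall>n. U \<inter> coloured n X = h ` coloured n (subtopology X F)"
    using homeomorphic_map_coloured coloured_open_subtopology[OF U(1)] by metis
  then show ?thesis using U(1) hk by (intro exI conjI)
qed

text \<open>A convergent sequence in the kernel permits the construction of a closed set with a
  coloured point; the clopen copy of this set carries the coloured point into \<open>X\<close>
  itself.\<close>

lemma coloured_points_nonempty:
  assumes CO: "CO_space X" and ns: "\<not> scattered_space X"
  shows "coloured_points \<noteq> {}"
proof -
  have K: "topspace X \<inter> perfect_kernel X \<noteq> {}" using perfect_kernel_nonempty[OF ns] perfect_kernel_subset[of X] by blast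
  obtain x and y :: "nat \<Rightarrow> 'a" where xy: "x \<in> perfect_kernel X" "range y \<subseteq> topspace X \<inter> perfect_kernel X"
    "x \<notin> range y" "limitin X y x sequentially"
    by (rule kernel_sequence[OF openin_topspace K]) (rule that)
  have y: "range y \<subseteq> perfect_kernel X - {x}" and xX: "x \<in> topspace X"
    using xy perfect_kernel_subset[of X] by blast+
  from coloured_piece[OF y xy(4) openin_topspace xX, of 0]
  obtain F where F: "closedin X F" "\<forall>m. coloured m (subtopology X F) = (if m = 0 then {x} else {})"
    by (elim exE conjE)
  obtain U h k where "openin X U" "homeomorphic_maps (subtopology X F) (subtopology X U) h k"
    and col: "\<forall>n. U \<inter> coloured n X = h ` coloured n (subtopology X F)"
    using CO_space_homeomorphic[OF CO F(1)] by (elim exE conjE)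
  have "U \<inter> coloured 0 X = {h x}" using col F(2) by simp
  then have "h x \<in> coloured 0 X" by blast
  then show ?thesis unfolding coloured_points_def by blast
qed

text \<open>The set \<open>F\<close> from \<open>recolouring\<close> has the same coloured points as
  \<open>X\<close>, now with the colours \<open>c\<close>, so its clopen copy meets the coloured
  points of \<open>X\<close> exactly in their image. Restricting the homeomorphism to the closure of
  the coloured points gives the copy demanded by the locale.\<close>

lemma CO_space_recolourable:
  assumes CO: "CO_space X" and ns: "\<not> scattered_space X"
  shows "recolourable X M coloured_points (\<lambda>s. SOME n. s \<in> coloured n X)"
proof -
  let ?G = coloured_points
  define g where "g s = (SOME n. s \<in> coloured n X)" for s
  have g: "g s = n" if "s \<in> coloured n X" for s n
  proof -
    have "s \<in> coloured (g s) X" unfolding g_def using that by (rule someI)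
    then show ?thesis using coloured_disjoint[OF t1, of "g s" n] that by blast
  qed
  have "\<exists>U h k. openin X U \<and>
      homeomorphic_maps (subtopology X (X closure_of ?G)) (subtopology X (X closure_of ?G \<inter> U)) h k \<and>
      (\<forall>x \<in> X closure_of ?G. h x \<in> ?G \<longleftrightarrow> x \<in> ?G) \<and> (\<forall>s\<in>?G. g (h s) = c s)" for c
  proof -
    obtain F where F: "closedin X F" "\<And>n. coloured n (subtopology X F) = {s \<in> ?G. c s = n}"
      by (rule recolouring[of c]) (rule that)
    obtain U h k where U: "openin X U" and hk: "homeomorphic_maps (subtopology X F) (subtopology X U) h k"
      and col: "\<And>n. U \<inter> coloured n X = h ` {s \<in> ?G. c s = n}"
      using CO_space_homeomorphic[OF CO F(1)] unfolding F(2) by (elim exE conjE) simp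
    have FX: "F \<subseteq> topspace X" using F(1) by (rule closedin_subset)
    have tF: "topspace (subtopology X F) = F" using FX by auto
    have tU: "topspace (subtopology X U) = U" using openin_subset[OF U] by auto
    have GF: "?G \<subseteq> F"
    proof
      fix s assume "s \<in> ?G"
      then have "s \<in> coloured (c s) (subtopology X F)" using F(2) by simp
      then show "s \<in> F"
        unfolding coloured_def kernel_boundary_def using perfect_kernel_subset[of "subtopology X F"] tF by blast
    qed
    have clF: "X closure_of ?G \<subseteq> F" using GF F(1) by (rule closure_of_minimal)
    have hG: "h ` ?G = U \<inter> ?G"
    proof -
      have "h ` ?G = (\<Union>n. h ` {s \<in> ?G. c s = n})" by blast
      also have "\<dots> = (\<Union>n. U \<inter> coloured n X)" using col by simp
      finally show ?thesis unfolding coloured_points_def by blast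
    qed
    have "h ` (X closure_of ?G) = U \<inter> X closure_of ?G"
    proof -
      have "homeomorphic_map (subtopology X F) (subtopology X U) h"
        using hk by (intro iffD2[OF homeomorphic_map_maps]) (rule exI)
      then have "subtopology X U closure_of (h ` ?G) = h ` (subtopology X F closure_of ?G)"
        by (rule homeomorphic_map_closure_of) (use GF tF in simp)
      moreover have "subtopology X F closure_of ?G = X closure_of ?G"
        using clF GF by (simp add: closure_of_subtopology Int_absorb1 Int_absorb2)
      ultimately show ?thesis unfolding hG openin_subtopology_closure[OF U] by simp
    qed
    then have "homeomorphic_maps (subtopology (subtopology X F) (X closure_of ?G))
        (subtopology (subtopology X U) (X closure_of ?G)) h k"
      by (intro homeomorphic_maps_subtopologies[OF hk]) (simp add: FX openin_subset[OF U] Int_absorb1 clF)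
    then have "homeomorphic_maps (subtopology X (X closure_of ?G)) (subtopology X (X closure_of ?G \<inter> U)) h k"
      using clF by (simp add: subtopology_subtopology Int_absorb1 Int_commute)
    moreover have "h x \<in> ?G \<longleftrightarrow> x \<in> ?G" if x: "x \<in> X closure_of ?G" for x
    proof
      assume "h x \<in> ?G"
      moreover have "x \<in> F" using x clF by blast
      have inv: "k (h y) = y" if "y \<in> F" for y
        using hk that tF unfolding homeomorphic_maps_def by simp
      have "h x \<in> U" using hk \<open>x \<in> F\<close> tF tU unfolding homeomorphic_maps_def continuous_map_def by blast
      ultimately have "h x \<in> h ` ?G" using hG by blast
      then obtain s where "s \<in> ?G" "h x = h s" by blast
      then show "x \<in> ?G" using inv[OF \<open>x \<in> F\<close>] inv[of s] GF by auto
    qed (use hG in blast)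
    moreover have "g (h s) = c s" if "s \<in> ?G" for s
    proof (rule g)
      have "h s \<in> U \<inter> coloured (c s) X" unfolding col using that by blast
      then show "h s \<in> coloured (c s) X" by simp
    qed
    ultimately show ?thesis using U by (intro exI[of _ U] exI[of _ h] exI[of _ k] conjI ballI) simp_all
  qed
  moreover have "\<exists>U. openin X U \<and> s \<in> U \<and> ?G \<inter> U \<subseteq> {s}" if s: "s \<in> ?G" for s
  proof -
    obtain U where "openin X U" "s \<in> U" "kernel_boundary X \<inter> U \<subseteq> {s}"
      by (rule coloured_points_isolated[OF s])
    then show ?thesis using coloured_points_subset(1) by blast
  qed
  ultimately show ?thesis
    using coloured_points_nonempty[OF CO ns] coloured_points_subset(2)
    unfolding g_def by unfold_locales
qed

lemma CO_space_imp_scattered: "CO_space X \<Longrightarrow> scattered_space X"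
  using CO_space_recolourable recolourable.contradictory by blast

end

theorem theorem1p2:
  fixes X :: "'a topology" and K :: "'b topology" and f :: "'b \<Rightarrow> 'a"
  assumes "Hausdorff_space X"
    and "compact_space K" and "interval_space K"
    and "continuous_map K X f" and "f ` topspace K = topspace X"
    and "CO_space X"
  shows "scattered_space X"
proof -
  obtain lt where "compact_ordered_space K lt"
    using interval_space_imp_compact_ordered[OF assms(3,2)] by (elim exE)
  then have "\<exists>M. mn_space X M"
    using assms(1,4,5) by (rule compact_ordered_space.image_mn_space)
  then obtain M where "mn_space X M" by (elim exE)
  then show ?thesis using assms(6) by (rule mn_space.CO_space_imp_scattered)
qed

end
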